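(* Let $C=(C_t)_{t\ge0}$ be a nonnegative, progressively measurable, right-continuous process such that $C^{1-R}\le Y$ for some $Y\in\mathbb{SO}_+$. Then there exists a proper solution (proper Epstein--Zin utility process) associated to $C$.
   Context: Work on a filtered probability space $(\Omega,\mathcal F,(\mathcal F_t)_{t\ge0},\mathbb P)$ whose filtration is complete and continuous, with $\mathcal F_0$ trivial; processes are identified up to indistinguishability. $\mathscr P$ denotes progressively measurable processes, $\mathscr P_+$ (resp. $\mathscr P_{++}$) those with nonnegative (resp. strictly positive) values. Parameters $R,S\in(0,1)\cup(1,\infty)$ satisfy $\theta:=\frac{1-R}{1-S}>1$; set $\rho:=\frac{\theta-1}{\theta}=\frac{S-R}{1-R}$. The Epstein--Zin aggregator is $f_{EZ}(c,v)=\frac{c^{1-S}}{1-S}((1-R)v)^{\rho}$ for $c\ge0$ and $v\in(1-R)[0,\infty)$. Given $C\in\mathscr P_+$, a solution (utility process) associated to $C$ is a càdlàg process $V\in\mathscr P$ with values in $(1-R)[0,\infty)$ such that $\mathbb E\int_0^\infty|f_{EZ}(C_s,V_s)|\,ds<\infty$ and $V_t=\mathbb E[\int_t^\infty f_{EZ}(C_s,V_s)\,ds\mid\mathcal F_t]$ for all $t\ge0$. A solution $V$ is proper if for every $t\ge0$, up to null sets, $(1-R)V_t>0$ on the event $\{\mathbb E[\int_t^\infty C_s^{1-R}ds\mid\mathcal F_t]>0\}$. For $X\in\mathscr P_+$ let $J^X_t=\mathbb E[\int_t^\infty X_s\,ds\mid\mathcal F_t]$. $\mathbb{SO}$ is the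 set of $X\in\mathscr P_{++}$ with $\mathbb E\int_0^\infty X_t\,dt<\infty$ for which there are constants $0<k\le K<\infty$ with $kJ^X\le X\le KJ^X$. For $\nu\ge0$, $\mathbb{SO}_\nu$ is the set of $X\in\mathbb{SO}$ with $(e^{\nu t}X_t)_{t\ge0}\in\mathbb{SO}$, and $\mathbb{SO}_+=\bigcup_{\nu>0}\mathbb{SO}_\nu$. *)

theory Defs
  imports "HOL-Probability.Probability"
begin

definition filtered_prob_space :: "'a measure \<Rightarrow> (real \<Rightarrow> 'a measure) \<Rightarrow> bool" where
  "filtered_prob_space M F \<longleftrightarrow>
     prob_space M
   \<and> (\<forall>t\<ge>0. subalgebra M (F t))
   \<and> (\<forall>s t. 0 \<le> s \<and> s \<le> t \<longrightarrow> sets (F s) \<subseteq> sets (F t))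
   \<and> (\<forall>N. N \<subseteq> space M \<and> (\<exists>A\<in>null_sets M. N \<subseteq> A) \<longrightarrow> N \<in> sets (F 0))
   \<and> (\<forall>t\<ge>0. sets (F t) = (\<Inter>s\<in>{t<..}. sets (F s)))
   \<and> (\<forall>t>0. sets (F t) = sigma_sets (space M) (\<Union>s\<in>{0..<t}. sets (F s)))
   \<and> (\<forall>A\<in>sets (F 0). measure M A = 0 \<or> measure M A = 1)"

definition progressive :: "'a measure \<Rightarrow> (real \<Rightarrow> 'a measure) \<Rightarrow> (real \<Rightarrow> 'a \<Rightarrow> real) \<Rightarrow> bool" where
  "progressive M F X \<longleftrightarrow>
     (\<forall>t\<ge>0. (\<lambda>(s, \<omega>). X s \<omega>) \<in> borel_measurable (restrict_space lborel {0..t} \<Otimes>\<^sub>M F t))"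

definition progressive_pos :: "'a measure \<Rightarrow> (real \<Rightarrow> 'a measure) \<Rightarrow> (real \<Rightarrow> 'a \<Rightarrow> real) \<Rightarrow> bool" where
  "progressive_pos M F X \<longleftrightarrow> progressive M F X \<and> (\<forall>t\<ge>0. \<forall>\<omega>\<in>space M. X t \<omega> \<ge> 0)"

definition progressive_strict_pos :: "'a measure \<Rightarrow> (real \<Rightarrow> 'a measure) \<Rightarrow> (real \<Rightarrow> 'a \<Rightarrow> real) \<Rightarrow> bool" where
  "progressive_strict_pos M F X \<longleftrightarrow> progressive M F X \<and> (\<forall>t\<ge>0. \<forall>\<omega>\<in>space M. X t \<omega> > 0)"

definition ext_pow :: "real \<Rightarrow> real \<Rightarrow> ennreal" where
  "ext_pow c a = (if c = 0 \<and> a < 0 then \<top> else ennreal (c powr a))"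

definition Jproc :: "'a measure \<Rightarrow> (real \<Rightarrow> 'a measure) \<Rightarrow> (real \<Rightarrow> 'a \<Rightarrow> real) \<Rightarrow> real \<Rightarrow> 'a \<Rightarrow> real" where
  "Jproc M F X t = real_cond_exp M (F t) (\<lambda>\<omega>. set_lebesgue_integral lborel {t..} (\<lambda>s. X s \<omega>))"

definition SO :: "'a measure \<Rightarrow> (real \<Rightarrow> 'a measure) \<Rightarrow> (real \<Rightarrow> 'a \<Rightarrow> real) set" where
  "SO M F = {X. progressive_strict_pos M F X
      \<and> (\<integral>\<^sup>+\<omega>. (\<integral>\<^sup>+s\<in>{0..}. ennreal (X s \<omega>) \<partial>lborel) \<partial>M) < \<infinity>
      \<and> (\<exists>k K. 0 < k \<and> k \<le> K \<and>
           (\<forall>t\<ge>0. AE \<omega> in M. k * Jproc M F X t \<omega> \<le> X t \<omega> \<and> X t \<omega> \<le> K * Jproc M F X t \<omega>))}"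

definition SO_nu :: "'a measure \<Rightarrow> (real \<Rightarrow> 'a measure) \<Rightarrow> real \<Rightarrow> (real \<Rightarrow> 'a \<Rightarrow> real) set" where
  "SO_nu M F \<nu> = {X. X \<in> SO M F \<and> (\<lambda>t \<omega>. exp (\<nu> * t) * X t \<omega>) \<in> SO M F}"

definition SO_plus :: "'a measure \<Rightarrow> (real \<Rightarrow> 'a measure) \<Rightarrow> (real \<Rightarrow> 'a \<Rightarrow> real) set" where
  "SO_plus M F = (\<Union>\<nu>\<in>{0<..}. SO_nu M F \<nu>)"

definition f_EZ :: "real \<Rightarrow> real \<Rightarrow> real \<Rightarrow> real \<Rightarrow> real" where
  "f_EZ R S c v = c powr (1 - S) / (1 - S) * ((1 - R) * v) powr ((S - R) / (1 - R))"

definition cadlag_paths :: "'a measure \<Rightarrow> (real \<Rightarrow> 'a \<Rightarrow> real) \<Rightarrow> bool" where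
  "cadlag_paths M V \<longleftrightarrow> (AE \<omega> in M. \<forall>t\<ge>0.
      continuous (at_right t) (\<lambda>s. V s \<omega>) \<and> (t > 0 \<longrightarrow> (\<exists>l. ((\<lambda>s. V s \<omega>) \<longlongrightarrow> l) (at_left t))))"

definition right_cont_paths :: "'a measure \<Rightarrow> (real \<Rightarrow> 'a \<Rightarrow> real) \<Rightarrow> bool" where
  "right_cont_paths M C \<longleftrightarrow> (AE \<omega> in M. \<forall>t\<ge>0. continuous (at_right t) (\<lambda>s. C s \<omega>))"

definition EZ_solution :: "'a measure \<Rightarrow> (real \<Rightarrow> 'a measure) \<Rightarrow> real \<Rightarrow> real \<Rightarrow>
    (real \<Rightarrow> 'a \<Rightarrow> real) \<Rightarrow> (real \<Rightarrow> 'a \<Rightarrow> real) \<Rightarrow> bool" where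
  "EZ_solution M F R S C V \<longleftrightarrow>
     progressive M F V
   \<and> cadlag_paths M V
   \<and> (\<forall>t\<ge>0. \<forall>\<omega>\<in>space M. (1 - R) * V t \<omega> \<ge> 0)
   \<and> (\<integral>\<^sup>+\<omega>. (\<integral>\<^sup>+s\<in>{0..}. ennreal \<bar>f_EZ R S (C s \<omega>) (V s \<omega>)\<bar> \<partial>lborel) \<partial>M) < \<infinity>
   \<and> (\<forall>t\<ge>0. AE \<omega> in M. V t \<omega> =
        real_cond_exp M (F t) (\<lambda>\<omega>'. set_lebesgue_integral lborel {t..} (\<lambda>s. f_EZ R S (C s \<omega>') (V s \<omega>'))) \<omega>)"

definition EZ_proper :: "'a measure \<Rightarrow> (real \<Rightarrow> 'a measure) \<Rightarrow> real \<Rightarrow>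
    (real \<Rightarrow> 'a \<Rightarrow> real) \<Rightarrow> (real \<Rightarrow> 'a \<Rightarrow> real) \<Rightarrow> bool" where
  "EZ_proper M F R C V \<longleftrightarrow>
     (\<forall>t\<ge>0. AE \<omega> in M.
        nn_cond_exp M (F t) (\<lambda>\<omega>'. \<integral>\<^sup>+s\<in>{t..}. ext_pow (C s \<omega>') (1 - R) \<partial>lborel) \<omega> > 0
        \<longrightarrow> (1 - R) * V t \<omega> > 0)"

end

theory Submission
  imports Defs
begin

text \<open>
  Put \<open>a = (1 - S) / (1 - R) = 1 / \<theta>\<close> and \<open>u = C\<^sup>1\<^sup>-\<^sup>S\<close>. In terms of \<open>W = (1 - R) V\<close> the equation reads
  \<open>W\<^sub>t = E[\<integral>\<^sub>t\<^sup>\<infinity> \<theta> u W\<^sup>1\<^sup>-\<^sup>a ds | F\<^sub>t]\<close>, whose right-hand side is monotone in \<open>W\<close>. Write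
  \<open>Z\<^sub>t = E[\<integral>\<^sub>t\<^sup>\<infinity> w ds | F\<^sub>t]\<close> with \<open>w = min u e\<^sup>-\<^sup>a\<^sup>s\<close>. Convexity of \<open>x\<^sup>\<theta>\<close> makes \<open>Z\<^sup>\<theta>\<close> a subsolution, and it
  is positive exactly where \<open>E[\<integral>\<^sub>t\<^sup>\<infinity> C\<^sup>1\<^sup>-\<^sup>R ds | F\<^sub>t]\<close> is; a large multiple of \<open>Y + e\<^sup>-\<^sup>s\<close> is a supersolution above it.
  Monotone iteration from \<open>Z\<^sup>\<theta>\<close> therefore converges to a proper solution. Every iterate needs a cadlag version, which
  comes from Doob's upcrossing inequality along the dyadic rationals.
\<close>

section \<open>Upcrossings\<close>

text \<open>The process 0 solves the equation too, and \<open>W powr (1 - a)\<close> is not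
  Lipschitz at 0; monotonicity replaces contraction, and a positive subsolution as starting point
  keeps the limit away from 0. The truncation has rate \<open>a\<close> to give Z \<le> e^(-a t) /
  a: since a \<theta> = 1, the power Z^\<theta> is then at most \<theta>^\<theta> e^(-t), which is
  why e^(-s) is added to \<open>Y\<close>. With D = Y + e^(-s), the estimate u \<le> D^a bounds the
  right-hand side at K D by \<theta> c K^(1-a) D, where D has tails at most c D; as 1 - a < 1, a
  large K absorbs \<theta> c. Conditional expectations are mostly replaced by \<open>ennreal\<close>
  integrals over the events of \<open>F t\<close>: Tonelli and monotone convergence then need no
  integrability, and it suffices to compare iterates almost surely at each fixed time. The limit of
  the iterates is only progressive, with no control of its paths; the solution is a cadlag version
  of the potential which that limit generates.\<close>

text \<open>Trading strategy behind the upcrossing inequality: buy at or below \<open>a\<close>, sell at or above \<open>b\<close>. The flag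
  \<open>upst\<close> says whether the asset is held after the \<open>n\<close>-th observation, and \<open>gain\<close> is the accumulated profit.\<close>

primrec upst :: "real \<Rightarrow> real \<Rightarrow> (nat \<Rightarrow> real) \<Rightarrow> nat \<Rightarrow> bool" where
  "upst a b x 0 = (x 0 \<le> a)"
| "upst a b x (Suc n) = (if upst a b x n then x (Suc n) < b else x (Suc n) \<le> a)"

primrec upcount :: "real \<Rightarrow> real \<Rightarrow> (nat \<Rightarrow> real) \<Rightarrow> nat \<Rightarrow> nat" where
  "upcount a b x 0 = 0"
| "upcount a b x (Suc n) = upcount a b x n + (if upst a b x n \<and> b \<le> x (Suc n) then 1 else 0)"

primrec gain :: "real \<Rightarrow> real \<Rightarrow> (nat \<Rightarrow> real) \<Rightarrow> nat \<Rightarrow> real" where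
  "gain a b x 0 = 0"
| "gain a b x (Suc n) = gain a b x n + (if upst a b x n then x (Suc n) - x n else 0)"

text \<open>A completed round trip earns at least \<open>b - a\<close>. The term
  \<open>x n - a\<close> values an open position against the highest possible purchase price;
  carrying it along makes the induction close.\<close>

lemma gain_ge:
  assumes "a < b"
  shows "(b - a) * upcount a b x n + (if upst a b x n then x n - a else 0) \<le> gain a b x n"
proof (induction n)
  case (Suc n)
  then show ?case using assms by (auto simp: algebra_simps)
qed auto

lemma upst_of_le: "a < b \<Longrightarrow> x n \<le> a \<Longrightarrow> upst a b x n"
  by (cases n) auto

lemma upcount_mono: "m \<le> n \<Longrightarrow> upcount a b x m \<le> upcount a b x n"
  by (induction n rule: dec_induct) auto

text \<open>Only a sale clears the flag, and each sale is counted.\<close>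

lemma upcount_upst_cases:
  assumes "upst a b x p" "p \<le> k"
  shows "upst a b x k \<or> upcount a b x p < upcount a b x k"
  using assms(2)
proof (induction k rule: dec_induct)
  case (step k)
  have "upcount a b x p \<le> upcount a b x k" using step by (intro upcount_mono) auto
  then show ?case using step by (auto split: if_splits)
qed (use assms in auto)

text \<open>Just before \<open>q\<close> the asset is either still held, and then
  \<open>b \<le> x q\<close> forces a sale at \<open>q\<close>, or it has been sold since
  \<open>p\<close>.\<close>

lemma upcount_increases:
  assumes "a < b" "p < q" "x p \<le> a" "b \<le> x q"
  shows "upcount a b x p < upcount a b x q"
proof -
  obtain k where k: "q = Suc k" "p \<le> k" using assms(2) by (cases q) auto
  from upcount_upst_cases[OF upst_of_le[OF assms(1), of x p] k(2)] assms(3)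
  have "upst a b x k \<or> upcount a b x p < upcount a b x k" by auto
  moreover have "upcount a b x p \<le> upcount a b x k" using k by (intro upcount_mono) 
  ultimately show ?thesis using k assms by auto
qed

context prob_space
begin

text \<open>Predictability: the position carried over the step to \<open>Suc n\<close> is known at
  \<open>n\<close>, so it multiplies a centred increment.\<close>

lemma measurable_upst:
  assumes X: "\<And>n. X n \<in> borel_measurable (G n)"
    and G: "\<And>n. subalgebra (G (Suc n)) (G n)"
  shows "Measurable.pred (G n) (\<lambda>\<omega>. upst a b (\<lambda>k. X k \<omega>) n)"
proof (induction n)
  case 0
  show ?case using X[of 0] by simp
next
  case (Suc n)
  have [measurable]: "Measurable.pred (G (Suc n)) (\<lambda>\<omega>. upst a b (\<lambda>k. X k \<omega>) n)"
    using measurable_from_subalg[OF G Suc] .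
  note X[measurable]
  show ?case by simp
qed

text \<open>Doob's upcrossing inequality. The gain has mean zero, and since \<open>X\<close> is
  nonnegative an open position loses at most \<open>a\<close>; hence the bound does not depend on
  the number \<open>n\<close> of observations.\<close>

lemma nn_integral_upcount_le:
  assumes X: "\<And>n. X n \<in> borel_measurable (G n)"
    and G: "\<And>n. subalgebra (G (Suc n)) (G n)"
    and GM: "\<And>n. subalgebra M (G n)"
    and int: "\<And>n. integrable M (X n)"
    and mart: "\<And>n A. A \<in> sets (G n) \<Longrightarrow> set_lebesgue_integral M A (X (Suc n)) = set_lebesgue_integral M A (X n)"
    and nn: "\<And>n. AE \<omega> in M. 0 \<le> X n \<omega>"
    and ab: "0 \<le> a" "a < b"
  shows "(\<integral>\<^sup>+\<omega>. ennreal (upcount a b (\<lambda>k. X k \<omega>) n) \<partial>M) \<le> ennreal (a / (b - a))"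
    and "(\<lambda>\<omega>. upcount a b (\<lambda>k. X k \<omega>) n) \<in> measurable M (count_space UNIV)"
proof -
  have XM[measurable]: "X n \<in> borel_measurable M" for n
    using measurable_from_subalg[OF GM X] .
  have upM[measurable]: "Measurable.pred M (\<lambda>\<omega>. upst a b (\<lambda>k. X k \<omega>) n)" for n
    using measurable_from_subalg[OF GM measurable_upst[of X G, OF X G]] .
  have cM[measurable]: "(\<lambda>\<omega>. upcount a b (\<lambda>k. X k \<omega>) n) \<in> measurable M (count_space UNIV)" for n
    by (induction n) auto
  then show "(\<lambda>\<omega>. upcount a b (\<lambda>k. X k \<omega>) n) \<in> measurable M (count_space UNIV)" .
  have g: "integrable M (\<lambda>\<omega>. gain a b (\<lambda>k. X k \<omega>) n) \<and> (\<integral>\<omega>. gain a b (\<lambda>k. X k \<omega>) n \<partial>M) = 0" for n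
  proof (induction n)
    case (Suc n)
    define A where "A = {\<omega>\<in>space M. upst a b (\<lambda>k. X k \<omega>) n}"
    have AG: "A \<in> sets (G n)"
      using measurable_upst[of X G a b n, OF X G] GM[of n] unfolding A_def pred_def subalgebra_def by simp
    then have AM: "A \<in> sets M" using GM[of n] by (auto simp: subalgebra_def)
    \<comment> \<open>One trading step is a difference of integrands over the
      \<open>G n\<close>-event \<open>A\<close>, the form in which \<open>mart\<close> is
      stated.\<close>
    have eq: "gain a b (\<lambda>k. X k \<omega>) (Suc n) = gain a b (\<lambda>k. X k \<omega>) n
        + (indicator A \<omega> * X (Suc n) \<omega> - indicator A \<omega> * X n \<omega>)" if "\<omega> \<in> space M" for \<omega>
      using that by (auto simp: A_def)
    have i: "integrable M (\<lambda>\<omega>. indicator A \<omega> * X k \<omega>)" for k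
      using integrable_mult_indicator[OF AM int[of k]] by simp
    have "(\<integral>\<omega>. indicator A \<omega> * X (Suc n) \<omega> \<partial>M) = (\<integral>\<omega>. indicator A \<omega> * X n \<omega> \<partial>M)"
      using mart[OF AG] by (simp add: set_lebesgue_integral_def)
    then have "integrable M (\<lambda>\<omega>. gain a b (\<lambda>k. X k \<omega>) n
        + (indicator A \<omega> * X (Suc n) \<omega> - indicator A \<omega> * X n \<omega>)) \<and>
       (\<integral>\<omega>. gain a b (\<lambda>k. X k \<omega>) n
        + (indicator A \<omega> * X (Suc n) \<omega> - indicator A \<omega> * X n \<omega>) \<partial>M) = 0"
      using Suc i by simp
    then show ?case
      using eq by (subst Bochner_Integration.integrable_cong[OF refl eq], simp,
          subst Bochner_Integration.integral_cong[OF refl eq], auto)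
  qed simp
  have le: "AE \<omega> in M. (b - a) * upcount a b (\<lambda>k. X k \<omega>) n \<le> gain a b (\<lambda>k. X k \<omega>) n + a"
    using nn[of n]
  proof eventually_elim
    case (elim \<omega>)
    show ?case using gain_ge[OF ab(2), of "\<lambda>k. X k \<omega>" n] elim ab by (auto split: if_splits)
  qed
  have "AE \<omega> in M. ennreal (upcount a b (\<lambda>k. X k \<omega>) n) \<le> ennreal ((gain a b (\<lambda>k. X k \<omega>) n + a) / (b - a))"
    using le by eventually_elim (use ab in \<open>auto simp: field_simps intro!: ennreal_leI\<close>)
  then have "(\<integral>\<^sup>+\<omega>. ennreal (upcount a b (\<lambda>k. X k \<omega>) n) \<partial>M) \<le> 
     (\<integral>\<^sup>+\<omega>. ennreal ((gain a b (\<lambda>k. X k \<omega>) n + a) / (b - a)) \<partial>M)"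
    by (intro nn_integral_mono_AE)
  also have "\<dots> = ennreal (\<integral>\<omega>. (gain a b (\<lambda>k. X k \<omega>) n + a) / (b - a) \<partial>M)"
  proof (intro nn_integral_eq_integral)
    show "AE \<omega> in M. 0 \<le> (gain a b (\<lambda>k. X k \<omega>) n + a) / (b - a)"
      using le
    proof eventually_elim
      case (elim \<omega>)
      have "0 \<le> (b - a) * upcount a b (\<lambda>k. X k \<omega>) n" using ab by simp
      from order_trans[OF this elim] show ?case using ab by (intro divide_nonneg_pos) auto
    qed
  qed (use g in auto)
  also have "(\<integral>\<omega>. (gain a b (\<lambda>k. X k \<omega>) n + a) / (b - a) \<partial>M) = a / (b - a)"
    using g[of n] by (simp add: prob_space)
  finally show "(\<integral>\<^sup>+\<omega>. ennreal (upcount a b (\<lambda>k. X k \<omega>) n) \<partial>M) \<le> ennreal (a / (b - a))" .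
qed

end

text \<open>Encodes \<open>j\<close> successive upcrossings of [a, b]. The recursion removes the
  latest one, so the earlier ones have to end by its starting time \<open>p\<close>.\<close>

primrec alternates :: "(real \<Rightarrow> real) \<Rightarrow> real \<Rightarrow> real \<Rightarrow> real set \<Rightarrow> nat \<Rightarrow> real \<Rightarrow> bool" where
  "alternates x a b D 0 T = True"
| "alternates x a b D (Suc j) T =
    (\<exists>p\<in>D. \<exists>q\<in>D. p < q \<and> q \<le> T \<and> x p \<le> a \<and> b \<le> x q \<and> alternates x a b D j p)"

lemma alternates_mono:
  "alternates x a b D j T \<Longrightarrow> D \<subseteq> D' \<Longrightarrow> T \<le> T' \<Longrightarrow> alternates x a b D' j T'"
proof (induction j arbitrary: T T')
  case (Suc j)
  from Suc.prems(1) obtain p q where pq: "p\<in>D" "q\<in>D" "p < q" "q \<le> T" "x p \<le> a" "b \<le> x q" "alternates x a b D j p"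
    by auto
  have "alternates x a b D' j p" using Suc.IH[OF pq(7) Suc.prems(2)] by simp
  then show ?case using pq Suc.prems(2,3) unfolding alternates.simps
    by (intro bexI[of _ p] bexI[of _ q]) auto
qed auto

section \<open>Dyadic grids\<close>

definition dyadic_level :: "nat \<Rightarrow> real set" where
  "dyadic_level m = range (\<lambda>k::nat. real k / 2 ^ m)"

definition dyadics :: "real set" where
  "dyadics = (\<Union>m. dyadic_level m)"

lemma dyadic_level_mono: "m \<le> n \<Longrightarrow> dyadic_level m \<subseteq> dyadic_level n"
proof (induction n rule: dec_induct)
  case (step n)
  have "dyadic_level n \<subseteq> dyadic_level (Suc n)"
  proof
    fix q assume "q \<in> dyadic_level n"
    then obtain k where "q = real k / 2 ^ n" by (auto simp: dyadic_level_def)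
    then have "q = real (2 * k) / 2 ^ Suc n" by simp
    then show "q \<in> dyadic_level (Suc n)" unfolding dyadic_level_def by blast
  qed
  with step show ?case by blast
qed auto

lemma countable_dyadics: "countable dyadics"
  by (auto simp: dyadics_def dyadic_level_def)

lemma dyadics_nonneg: "q \<in> dyadics \<Longrightarrow> 0 \<le> q"
  by (auto simp: dyadics_def dyadic_level_def)

lemma zero_dyadics: "0 \<in> dyadics"
  by (auto simp: dyadics_def dyadic_level_def intro!: exI[of _ 0] image_eqI[of _ _ 0])

text \<open>Finitely many dyadic times lie on one common grid, and the grids are nested.\<close>

lemma alternates_dyadics:
  assumes "alternates x a b dyadics j T"
  shows "\<exists>m0. \<forall>m\<ge>m0. alternates x a b (dyadic_level m) j T"
  using assms
proof (induction j arbitrary: T)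
  case (Suc j)
  then obtain p q where pq: "p\<in>dyadics" "q\<in>dyadics" "p < q" "q \<le> T" "x p \<le> a" "b \<le> x q"
    "alternates x a b dyadics j p"
    by auto
  from Suc.IH[OF pq(7)] obtain m0 where m0: "\<forall>m\<ge>m0. alternates x a b (dyadic_level m) j p" by blast
  from pq obtain m1 m2 where m: "p \<in> dyadic_level m1" "q \<in> dyadic_level m2"
    by (auto simp: dyadics_def)
  have "alternates x a b (dyadic_level m) (Suc j) T" if "m \<ge> max m0 (max m1 m2)" for m
  proof -
    have "p \<in> dyadic_level m" "q \<in> dyadic_level m"
      using m that dyadic_level_mono[of m1 m] dyadic_level_mono[of m2 m] by auto
    then show ?thesis using pq m0 that by auto
  qed
  then show ?case by blast
qed auto

text \<open>Induction from the last upcrossing backwards: the count up to its start \<open>k\<close>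
  covers the earlier ones, and \<open>upcount_increases\<close> adds one between \<open>k\<close>
  and \<open>l\<close>.\<close>

lemma alternates_upcount:
  assumes "a < b" "alternates x a b (dyadic_level m) j T" "T \<le> real n / 2 ^ m"
  shows "j \<le> upcount a b (\<lambda>k. x (real k / 2 ^ m)) n"
  using assms(2,3)
proof (induction j arbitrary: T n)
  case (Suc j)
  from Suc.prems obtain k l where kl: "real k / 2 ^ m < real l / 2 ^ m" "real l / 2 ^ m \<le> T"
    "x (real k / 2 ^ m) \<le> a" "b \<le> x (real l / 2 ^ m)" "alternates x a b (dyadic_level m) j (real k / 2 ^ m)"
    by (auto simp: dyadic_level_def)
  have "k < l" using kl(1) by (simp add: divide_less_cancel)
  have "real l / 2 ^ m \<le> real n / 2 ^ m" using kl(2) Suc.prems(2) by linarith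
  then have "l \<le> n" by (simp add: divide_le_cancel)
  have "j \<le> upcount a b (\<lambda>k. x (real k / 2 ^ m)) k" using Suc.IH[OF kl(5)] by simp
  also have "\<dots> < upcount a b (\<lambda>k. x (real k / 2 ^ m)) l"
    using upcount_increases[of a b k l "\<lambda>k. x (real k / 2 ^ m)"] kl \<open>k < l\<close> assms(1) by auto
  also have "\<dots> \<le> upcount a b (\<lambda>k. x (real k / 2 ^ m)) n" by (rule upcount_mono) fact
  finally show ?case by simp
qed auto

section \<open>Regularity along the dyadic rationals\<close>

text \<open>If limit inferior and limit superior differ, two rationals fit strictly between them,
  and \<open>f\<close> is frequently below the one and above the other. Nonnegativity of
  \<open>f\<close> makes these rationals nonnegative, the range in which the upcrossing bound is
  available.\<close>

lemma tendsto_of_no_oscillation: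
  fixes f :: "'a \<Rightarrow> real"
  assumes bd: "\<forall>\<^sub>F x in F. 0 \<le> f x \<and> f x \<le> B"
    and osc: "\<And>a b. a \<in> \<rat> \<Longrightarrow> b \<in> \<rat> \<Longrightarrow> 0 \<le> a \<Longrightarrow> a < b \<Longrightarrow> (\<exists>\<^sub>F x in F. f x \<le> a) \<Longrightarrow> (\<exists>\<^sub>F x in F. b \<le> f x) \<Longrightarrow> False"
  shows "\<exists>l. (f \<longlongrightarrow> l) F"
proof (cases "F = bot")
  case False
  let ?g = "\<lambda>x. ereal (f x)"
  have L0: "0 \<le> Liminf F ?g"
    by (rule Liminf_bounded) (use bd in \<open>auto elim: eventually_mono\<close>)
  have UB: "Limsup F ?g \<le> ereal B"
    by (rule Limsup_bounded) (use bd in \<open>auto elim: eventually_mono\<close>)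
  have LU: "Liminf F ?g \<le> Limsup F ?g" using False by (intro Liminf_le_Limsup) auto
  have "\<not> Liminf F ?g < Limsup F ?g"
  proof
    assume "Liminf F ?g < Limsup F ?g"
    then obtain a :: rat where a: "Liminf F ?g < ereal (real_of_rat a)" "ereal (real_of_rat a) < Limsup F ?g"
      using ereal_dense3 by blast
    then obtain b :: rat where b: "ereal (real_of_rat a) < ereal (real_of_rat b)" "ereal (real_of_rat b) < Limsup F ?g"
      using ereal_dense3 by blast
    have "ereal 0 < ereal (real_of_rat a)" using order.strict_trans1[OF L0 a(1)] by (simp add: zero_ereal_def)
    then have a0: "0 \<le> real_of_rat a" by simp
    have "\<exists>\<^sub>F x in F. f x \<le> real_of_rat a"
    proof (rule ccontr)
      assume "\<not> (\<exists>\<^sub>F x in F. f x \<le> real_of_rat a)"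
      then have "\<forall>\<^sub>F x in F. ereal (real_of_rat a) \<le> ereal (f x)"
        unfolding not_frequently by eventually_elim simp
      then have "ereal (real_of_rat a) \<le> Liminf F ?g" by (rule Liminf_bounded)
      with a(1) show False by simp
    qed
    moreover have "\<exists>\<^sub>F x in F. real_of_rat b \<le> f x"
    proof (rule ccontr)
      assume "\<not> (\<exists>\<^sub>F x in F. real_of_rat b \<le> f x)"
      then have "\<forall>\<^sub>F x in F. ereal (f x) \<le> ereal (real_of_rat b)"
        unfolding not_frequently by eventually_elim simp
      then have "Limsup F ?g \<le> ereal (real_of_rat b)" by (rule Limsup_bounded)
      with b(2) show False by simp
    qed
    ultimately show False using osc[of "real_of_rat a" "real_of_rat b"] a0 b(1) by auto
  qed
  with LU have eq: "Liminf F ?g = Limsup F ?g" by auto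
  obtain l where l: "Limsup F ?g = ereal l"
    using L0 UB eq by (cases "Limsup F ?g") auto
  then have "(?g \<longlongrightarrow> ereal l) F"
    using eq tendsto_iff_Liminf_eq_Limsup[OF False] by metis
  then show ?thesis by auto
qed auto

text \<open>Rational levels and integer horizons keep the conditions countable, so that they can
  hold simultaneously almost surely.\<close>

definition dyadic_regular :: "(real \<Rightarrow> real) \<Rightarrow> bool" where
  "dyadic_regular x \<longleftrightarrow> (\<forall>q\<in>dyadics. 0 \<le> x q)
    \<and> (\<forall>a\<in>\<rat>. \<forall>b\<in>\<rat>. 0 \<le> a \<longrightarrow> a < b \<longrightarrow> (\<forall>T::nat. \<exists>j. \<not> alternates x a b dyadics j (real T)))
    \<and> (\<forall>T::nat. \<exists>B. \<forall>q\<in>dyadics. q \<le> real T \<longrightarrow> x q \<le> B)"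

lemma frequently_at_withinD:
  fixes t :: real
  assumes "\<exists>\<^sub>F x in at t within S. P x" "0 < d"
  shows "\<exists>x\<in>S. x \<noteq> t \<and> dist x t < d \<and> P x"
  using assms unfolding frequently_def eventually_at by blast

abbreviation "at_dyadic_right t \<equiv> at t within (dyadics \<inter> {t<..})"

lemma dyadic_regular_right_limit:
  assumes x: "dyadic_regular x" and t: "0 \<le> t"
  shows "\<exists>l. (x \<longlongrightarrow> l) (at_dyadic_right t)"
proof -
  let ?F = "at_dyadic_right t"
  obtain T :: nat where T: "t + 1 \<le> real T" using real_arch_simple by blast
  obtain B where B: "\<And>q. q \<in> dyadics \<Longrightarrow> q \<le> real T \<Longrightarrow> x q \<le> B"
    using x unfolding dyadic_regular_def by meson
  show ?thesis
  proof (rule tendsto_of_no_oscillation)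
    show "\<forall>\<^sub>F q in ?F. 0 \<le> x q \<and> x q \<le> B"
      unfolding eventually_at using x T B by (auto intro!: exI[of _ 1] simp: dist_real_def dyadic_regular_def)
  next
    fix a b :: real assume ab: "a \<in> \<rat>" "b \<in> \<rat>" "0 \<le> a" "a < b"
      and fa: "\<exists>\<^sub>F q in ?F. x q \<le> a" and fb: "\<exists>\<^sub>F q in ?F. b \<le> x q"
    \<comment> \<open>Going down towards \<open>t\<close>, the latest upcrossing is chosen first, in
      the order in which \<open>alternates\<close> unfolds; the others fit between \<open>t\<close>
      and \<open>p\<close>.\<close>
    have "alternates x a b dyadics j s" if "t < s" for j s
      using that
    proof (induction j arbitrary: s)
      case (Suc j)
      obtain q where q: "q \<in> dyadics" "t < q" "q < s" "b \<le> x q"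
        using frequently_at_withinD[OF fb, of "s - t"] Suc.prems by (auto simp: dist_real_def)
      obtain p where p: "p \<in> dyadics" "t < p" "p < q" "x p \<le> a"
        using frequently_at_withinD[OF fa, of "q - t"] q by (auto simp: dist_real_def)
      show ?case using p q Suc.IH[OF p(2)] unfolding alternates.simps
        by (intro bexI[of _ p] bexI[of _ q]) auto
    qed auto
    then have "\<forall>j. alternates x a b dyadics j (real T)" using T by auto
    then show False using x ab unfolding dyadic_regular_def by blast
  qed
qed

lemma dyadic_regular_left_limit:
  assumes x: "dyadic_regular x" and t: "0 < t"
  shows "\<exists>l. (x \<longlongrightarrow> l) (at t within (dyadics \<inter> {..<t}))"
proof -
  let ?F = "at t within (dyadics \<inter> {..<t})"
  obtain T :: nat where T: "t \<le> real T" using real_arch_simple by blast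
  obtain B where B: "\<And>q. q \<in> dyadics \<Longrightarrow> q \<le> real T \<Longrightarrow> x q \<le> B"
    using x unfolding dyadic_regular_def by meson
  show ?thesis
  proof (rule tendsto_of_no_oscillation)
    show "\<forall>\<^sub>F q in ?F. 0 \<le> x q \<and> x q \<le> B"
      unfolding eventually_at using x T B by (auto intro!: exI[of _ 1] simp: dist_real_def dyadic_regular_def)
  next
    fix a b :: real assume ab: "a \<in> \<rat>" "b \<in> \<rat>" "0 \<le> a" "a < b"
      and fa: "\<exists>\<^sub>F q in ?F. x q \<le> a" and fb: "\<exists>\<^sub>F q in ?F. b \<le> x q"
    \<comment> \<open>Approaching \<open>t\<close> from the left, upcrossings are appended in
      increasing order; the end time \<open>s < t\<close> stays existential to leave room for the
      next one.\<close>
    have "\<exists>s<t. alternates x a b dyadics j s" for j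
    proof (induction j)
      case 0 show ?case using lt_ex by auto
    next
      case (Suc j)
      then obtain s where s: "s < t" "alternates x a b dyadics j s" by blast
      obtain p where p: "p \<in> dyadics" "s < p" "p < t" "x p \<le> a"
        using frequently_at_withinD[OF fa, of "t - s"] s by (auto simp: dist_real_def)
      obtain q where q: "q \<in> dyadics" "p < q" "q < t" "b \<le> x q"
        using frequently_at_withinD[OF fb, of "t - p"] p by (auto simp: dist_real_def)
      have "alternates x a b dyadics j p" using alternates_mono[OF s(2) order.refl, of p] p by simp
      then show ?case using p q unfolding alternates.simps
        by (intro exI[of _ q] conjI bexI[of _ p] bexI[of _ q]) auto
    qed
    then have "\<forall>j. alternates x a b dyadics j (real T)" using T
      by (meson alternates_mono order.refl less_imp_le order.trans)
    then show False using x ab unfolding dyadic_regular_def by blast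
  qed
qed

section \<open>Right limits along the dyadic rationals\<close>

definition dyadic_right :: "nat \<Rightarrow> real \<Rightarrow> real" where
  "dyadic_right n t = real_of_int (\<lfloor>2 ^ n * t\<rfloor> + 1) / 2 ^ n"

text \<open>Rounding by floor plus one stays strictly above \<open>t\<close> even if
  \<open>t\<close> is itself dyadic, as a limit from the right requires.\<close>

lemma dyadic_right_bounds:
  "t < dyadic_right n t" "dyadic_right n t \<le> t + 1 / 2 ^ n"
  unfolding dyadic_right_def by (simp_all add: field_simps) linarith+

lemma dyadic_right_in: "0 \<le> t \<Longrightarrow> dyadic_right n t \<in> dyadics"
proof -
  assume t: "0 \<le> t"
  then have "dyadic_right n t = real (nat (\<lfloor>2 ^ n * t\<rfloor> + 1)) / 2 ^ n"
    unfolding dyadic_right_def by (subst of_nat_nat) auto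
  then show ?thesis unfolding dyadics_def dyadic_level_def by blast
qed

lemma dyadic_right_tendsto: "(\<lambda>n. dyadic_right n t) \<longlonglongrightarrow> t"
proof (rule tendsto_sandwich)
  show "\<forall>\<^sub>F n in sequentially. t \<le> dyadic_right n t"
    by (intro always_eventually allI less_imp_le dyadic_right_bounds)
  show "\<forall>\<^sub>F n in sequentially. dyadic_right n t \<le> t + 1 / 2 ^ n"
    using dyadic_right_bounds(2) by auto
  have "(\<lambda>n. t + (1/2) ^ n) \<longlonglongrightarrow> t + 0"
    by (intro tendsto_intros LIMSEQ_realpow_zero) auto
  then show "(\<lambda>n. t + 1 / 2 ^ n) \<longlonglongrightarrow> t" by (simp add: power_one_over)
qed auto

lemma filterlim_dyadic_right:
  assumes "0 \<le> t"
  shows "filterlim (\<lambda>n. dyadic_right n t) (at_dyadic_right t) sequentially"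
  unfolding filterlim_at
  using dyadic_right_tendsto dyadic_right_bounds(1)[of t] dyadic_right_in[OF assms]
  by (auto simp: order.strict_implies_not_eq intro!: always_eventually) (metis less_irrefl)

lemma at_within_dyadics_nontrivial:
  assumes "0 \<le> t" shows "at_dyadic_right t \<noteq> bot"
  using filterlim_dyadic_right[OF assms] by (auto simp: filterlim_def le_bot filtermap_bot_iff trivial_limit_sequentially bot_unique)

definition right_lim :: "(real \<Rightarrow> real) \<Rightarrow> real \<Rightarrow> real" where
  "right_lim x t = Lim (at_dyadic_right t) x"

lemma right_lim_tendsto:
  assumes "dyadic_regular x" "0 \<le> t"
  shows "(x \<longlongrightarrow> right_lim x t) (at_dyadic_right t)"
proof -
  obtain l where l: "(x \<longlongrightarrow> l) (at_dyadic_right t)"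
    using dyadic_regular_right_limit[OF assms] by blast
  then have "right_lim x t = l"
    unfolding right_lim_def using at_within_dyadics_nontrivial[OF assms(2)] by (intro tendsto_Lim)
  with l show ?thesis by simp
qed

text \<open>Closed balls are stable under limits, so a bound at the dyadic points of an open set
  passes to \<open>right_lim\<close> at its points. This serves right-continuity and left limits
  alike.\<close>

lemma right_lim_close:
  assumes x: "dyadic_regular x" and s: "0 \<le> s"
    and U: "open U" "s \<in> U" and c: "\<And>q. q \<in> dyadics \<Longrightarrow> s < q \<Longrightarrow> q \<in> U \<Longrightarrow> dist (x q) l \<le> e"
  shows "dist (right_lim x s) l \<le> e"
proof -
  let ?F = "at_dyadic_right s"
  have "((\<lambda>q. dist (x q) l) \<longlongrightarrow> dist (right_lim x s) l) ?F"
    by (intro tendsto_intros right_lim_tendsto x s)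
  moreover have "\<forall>\<^sub>F q in ?F. dist (x q) l \<le> e"
    unfolding eventually_at_topological using U c by auto
  ultimately show ?thesis
    using at_within_dyadics_nontrivial[OF s] tendsto_upperbound by blast
qed

lemma right_lim_continuous:
  assumes x: "dyadic_regular x" and t: "0 \<le> t"
  shows "continuous (at_right t) (right_lim x)"
  unfolding continuous_within tendsto_iff
proof (intro allI impI)
  fix e :: real assume e: "0 < e"
  have "\<forall>\<^sub>F q in at_dyadic_right t. dist (x q) (right_lim x t) < e / 2"
    using tendstoD[OF right_lim_tendsto[OF x t], of "e/2"] e by simp
  then obtain d where d: "d > 0" "\<And>q. q \<in> dyadics \<Longrightarrow> t < q \<Longrightarrow> q < t + d \<Longrightarrow> dist (x q) (right_lim x t) < e / 2"
    unfolding eventually_at by (auto simp: dist_real_def)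
  have "dist (right_lim x s) (right_lim x t) < e" if "t < s" "s < t + d" for s
  proof -
    have "dist (right_lim x s) (right_lim x t) \<le> e / 2"
      by (rule right_lim_close[OF x, of _ "{t<..<t+d}"]) (use that t d in \<open>auto intro: less_imp_le\<close>)
    then show ?thesis using e by simp
  qed
  then show "\<forall>\<^sub>F s in at_right t. dist (right_lim x s) (right_lim x t) < e"
    unfolding eventually_at_right_field using d(1) by (intro exI[of _ "t + d"]) auto
qed

text \<open>Values of \<open>right_lim\<close> just before \<open>t\<close> are limits of dyadic
  values just before \<open>t\<close>, so the left limit of \<open>x\<close> along the dyadics is
  inherited.\<close>

lemma right_lim_left_limit:
  assumes x: "dyadic_regular x" and t: "0 < t"
  shows "\<exists>l. (right_lim x \<longlongrightarrow> l) (at_left t)"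
proof -
  obtain l where l: "(x \<longlongrightarrow> l) (at t within (dyadics \<inter> {..<t}))"
    using dyadic_regular_left_limit[OF assms] by blast
  have "(right_lim x \<longlongrightarrow> l) (at_left t)"
    unfolding tendsto_iff
  proof (intro allI impI)
    fix e :: real assume e: "0 < e"
    have "\<forall>\<^sub>F q in at t within (dyadics \<inter> {..<t}). dist (x q) l < e / 2"
      using tendstoD[OF l, of "e/2"] e by simp
    then obtain d where d: "d > 0" "\<And>q. q \<in> dyadics \<Longrightarrow> q < t \<Longrightarrow> t - d < q \<Longrightarrow> dist (x q) l < e / 2"
      unfolding eventually_at by (auto simp: dist_real_def)
    \<comment> \<open>The maximum with 0 keeps \<open>s\<close> in the range where
      \<open>right_lim\<close> is a genuine limit.\<close>
    have "dist (right_lim x s) l < e" if "max 0 (t - d) < s" "s < t" for s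
    proof -
      have "dist (right_lim x s) l \<le> e / 2"
        by (rule right_lim_close[OF x, of _ "{t-d<..<t}"]) (use that t d in \<open>auto intro: less_imp_le\<close>)
      then show ?thesis using e by simp
    qed
    then show "\<forall>\<^sub>F s in at_left t. dist (right_lim x s) l < e"
      unfolding eventually_at_left_field using d(1) t by (intro exI[of _ "max 0 (t - d)"]) auto
  qed
  then show ?thesis ..
qed

lemma right_lim_nonneg:
  assumes "dyadic_regular x" "0 \<le> t" shows "0 \<le> right_lim x t"
proof (rule tendsto_lowerbound[OF right_lim_tendsto[OF assms]])
  show "\<forall>\<^sub>F q in at_dyadic_right t. 0 \<le> x q"
    using assms(1) unfolding dyadic_regular_def eventually_at_topological by auto
qed (use at_within_dyadics_nontrivial[OF assms(2)] in simp)

lemma dyadic_right_right_lim: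
  assumes "dyadic_regular x" "0 \<le> t" shows "(\<lambda>n. x (dyadic_right n t)) \<longlonglongrightarrow> right_lim x t"
  using filterlim_compose[OF right_lim_tendsto[OF assms] filterlim_dyadic_right[OF assms(2)]] .

section \<open>Filtrations\<close>

locale filtered_prob = prob_space M for M :: "'a measure" +
  fixes F :: "real \<Rightarrow> 'a measure"
  assumes filtered: "filtered_prob_space M F"
begin

lemma
  shows filtration_subalgebra: "\<forall>t\<ge>0. subalgebra M (F t)"
    and filtration_increasing: "\<forall>s t. 0 \<le> s \<and> s \<le> t \<longrightarrow> sets (F s) \<subseteq> sets (F t)"
    and filtration_complete: "\<forall>N. N \<subseteq> space M \<and> (\<exists>A\<in>null_sets M. N \<subseteq> A) \<longrightarrow> N \<in> sets (F 0)"
    and filtration_right_continuous: "\<forall>t\<ge>0. sets (F t) = (\<Inter>s\<in>{t<..}. sets (F s))"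
  using filtered unfolding filtered_prob_space_def by - (elim conjE, assumption)+

lemma subalg: "0 \<le> t \<Longrightarrow> subalgebra M (F t)"
  using filtration_subalgebra by blast

lemma space_F: "0 \<le> t \<Longrightarrow> space (F t) = space M"
  using subalg by (simp add: subalgebra_def)

lemma sets_F_mono: "0 \<le> s \<Longrightarrow> s \<le> t \<Longrightarrow> A \<in> sets (F s) \<Longrightarrow> A \<in> sets (F t)"
  using filtration_increasing by blast

lemma sets_F_M: "0 \<le> t \<Longrightarrow> A \<in> sets (F t) \<Longrightarrow> A \<in> sets M"
  using subalg by (auto simp: subalgebra_def)

lemma subalg_mono: "0 \<le> s \<Longrightarrow> s \<le> t \<Longrightarrow> subalgebra (F t) (F s)"
  by (simp add: subalgebra_def space_F subset_iff sets_F_mono)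

lemma F_subalgebra: "0 \<le> t \<Longrightarrow> sigma_finite_subalgebra M (F t)"
  by (intro finite_measure_subalgebra_is_sigma_finite)
    (simp add: finite_measure_subalgebra_def finite_measure_subalgebra_axioms_def finite_measure_axioms subalg)

lemma measurable_F_M: "0 \<le> t \<Longrightarrow> f \<in> measurable (F t) N \<Longrightarrow> f \<in> measurable M N"
  using measurable_from_subalg[OF subalg] .

lemma measurable_F_mono: "0 \<le> s \<Longrightarrow> s \<le> t \<Longrightarrow> f \<in> measurable (F s) N \<Longrightarrow> f \<in> measurable (F t) N"
  using measurable_from_subalg[OF subalg_mono] .

text \<open>Right limits at \<open>t\<close> use values at times after \<open>t\<close>, hence are
  measurable for each later \<open>F s\<close>; right-continuity of the filtration brings them back
  to \<open>F t\<close>.\<close>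

lemma measurable_F_right:
  assumes t: "0 \<le> t" and f: "\<And>s. t < s \<Longrightarrow> f \<in> measurable (F s) N"
  shows "f \<in> measurable (F t) N"
proof (rule measurableI)
  fix x assume "x \<in> space (F t)"
  then show "f x \<in> space N" using measurable_space[OF f[of "t+1"]] t space_F by simp
next
  fix A assume A: "A \<in> sets N"
  have "f -` A \<inter> space M \<in> sets (F s)" if "t < s" for s
    using measurable_sets[OF f[OF that] A] that t space_F by simp
  moreover have "sets (F t) = (\<Inter>s\<in>{t<..}. sets (F s))"
    using filtration_right_continuous t by blast
  ultimately show "f -` A \<inter> space (F t) \<in> sets (F t)"
    using t space_F by simp
qed

text \<open>Completeness puts every subset of a null set into \<open>F 0\<close>, so sets of good
  paths can be used at any time without destroying adaptedness.\<close>

lemma AE_in_F: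
  assumes "AE x in M. P x" "0 \<le> t"
  shows "{x\<in>space M. P x} \<in> sets (F t)"
proof -
  let ?N = "{x\<in>space M. \<not> P x}"
  obtain A where "A \<in> null_sets M" "?N \<subseteq> A" using assms(1) by (auto simp: eventually_ae_filter)
  then have "?N \<in> sets (F 0)" 
    by (intro filtration_complete[rule_format] conjI) auto
  then have "space (F 0) - ?N \<in> sets (F 0)" by (rule sets.compl_sets)
  moreover have "space (F 0) - ?N = {x\<in>space M. P x}" using space_F[OF order.refl] by blast
  ultimately show ?thesis by (intro sets_F_mono[OF order.refl assms(2)]) (simp only:)
qed

lemma progressive_adapted:
  assumes "progressive M F X" "0 \<le> t"
  shows "X t \<in> borel_measurable (F t)"
proof -
  have *: "(\<lambda>(s, x). X s x) \<in> borel_measurable (restrict_space lborel {0..t} \<Otimes>\<^sub>M F t)"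
    using assms by (simp add: progressive_def)
  have "(\<lambda>x. (t, x)) \<in> F t \<rightarrow>\<^sub>M restrict_space lborel {0..t} \<Otimes>\<^sub>M F t"
    using assms(2) by (intro measurable_Pair measurable_const) (auto simp: space_restrict_space)
  from measurable_compose[OF this *] show ?thesis by simp
qed

text \<open>Approximation by step processes that take the value at the right end of the current
  dyadic interval; right-continuity gives convergence.\<close>

lemma progressive_right_continuous:
  assumes ad: "\<And>t. 0 \<le> t \<Longrightarrow> X t \<in> borel_measurable (F t)"
    and rc: "\<And>x t. x \<in> space M \<Longrightarrow> 0 \<le> t \<Longrightarrow> continuous (at_right t) (\<lambda>s. X s x)"
  shows "progressive M F X"
  unfolding progressive_def
proof (intro allI impI)
  fix t :: real assume t: "0 \<le> t"
  let ?N = "restrict_space lborel {0..t} \<Otimes>\<^sub>M F t"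
  \<comment> \<open>Clamping to [0, t] keeps every evaluation time in the past of \<open>t\<close>,
    so that the approximations are \<open>F t\<close>-measurable.\<close>
  define q where "q n i = max 0 (min t (real_of_int (i + 1) / 2 ^ n))" for n :: nat and i :: int
  have q: "0 \<le> q n i" "q n i \<le> t" for n i using t by (auto simp: q_def)
  show "(\<lambda>(s, x). X s x) \<in> borel_measurable ?N"
  proof (rule borel_measurable_LIMSEQ_real)
    fix n
    have m1: "(\<lambda>p. X (q n i) (snd p)) \<in> borel_measurable ?N" for i
      using measurable_F_mono[OF q ad[OF q(1)]] by simp
    have m2: "(\<lambda>p. \<lfloor>2 ^ n * fst p\<rfloor>) \<in> measurable ?N (count_space UNIV)"
    proof -
      have "(\<lambda>s::real. s) \<in> borel_measurable (restrict_space lborel {0..t})"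
        by (intro measurable_restrict_space1) simp
      then have "fst \<in> borel_measurable ?N" by (rule measurable_compose[OF measurable_fst])
      then show ?thesis by simp
    qed
    show "(\<lambda>p. X (q n \<lfloor>2 ^ n * fst p\<rfloor>) (snd p)) \<in> borel_measurable ?N"
      by (rule measurable_compose_countable[OF m1 m2])
  next
    fix p assume "p \<in> space ?N"
    then obtain s x where p: "p = (s, x)" "0 \<le> s" "s \<le> t" "x \<in> space M"
      using space_F[OF t] by (auto simp: space_pair_measure space_restrict_space)
    show "(\<lambda>n. X (q n \<lfloor>2 ^ n * fst p\<rfloor>) (snd p)) \<longlonglongrightarrow> (\<lambda>(s, x). X s x) p"
    \<comment> \<open>At the right end clamping returns exactly \<open>t\<close>; before it, the
      clamped times stay strictly above \<open>s\<close>.\<close>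
    proof (cases "s = t")
      case True
      have "q n \<lfloor>2 ^ n * s\<rfloor> = t" for n
        using dyadic_right_bounds(1)[of s n] t unfolding True dyadic_right_def q_def by auto
      then show ?thesis using p True by simp
    next
      case False
      have eq: "q n \<lfloor>2 ^ n * s\<rfloor> = min t (dyadic_right n s)" for n
        using dyadic_right_bounds(1)[of s n] p t unfolding dyadic_right_def q_def by auto
      have "(\<lambda>n. min t (dyadic_right n s)) \<longlonglongrightarrow> min t s"
        by (intro tendsto_intros dyadic_right_tendsto)
      moreover have "min t s = s" using p by simp
      ultimately have "(\<lambda>n. min t (dyadic_right n s)) \<longlonglongrightarrow> s" by simp
      moreover have "s < min t (dyadic_right n s)" for n
        using dyadic_right_bounds(1)[of s n] p False by auto
      ultimately have "filterlim (\<lambda>n. min t (dyadic_right n s)) (at_right s) sequentially"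
        by (intro tendsto_imp_filterlim_at_right always_eventually allI)
      moreover have "((\<lambda>r. X r x) \<longlongrightarrow> X s x) (at_right s)"
        using rc[OF p(4,2)] by (simp add: continuous_within)
      ultimately have "(\<lambda>n. X (min t (dyadic_right n s)) x) \<longlonglongrightarrow> X s x"
        by (rule filterlim_compose[rotated])
      then show ?thesis using p eq by simp
    qed
  qed
qed

end

section \<open>Comparison of random variables through integrals over events\<close>

lemma (in sigma_finite_subalgebra) nn_integral_real_cond_exp:
  assumes f: "integrable M f" "AE x in M. 0 \<le> f x" and A: "A \<in> sets F"
  shows "(\<integral>\<^sup>+x\<in>A. ennreal (real_cond_exp M F f x) \<partial>M) = (\<integral>\<^sup>+x\<in>A. ennreal (f x) \<partial>M)"
proof -
  have AM: "A \<in> sets M" using A subalg by (auto simp: subalgebra_def)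
  have pos: "AE x in M. 0 \<le> real_cond_exp M F f x" using f by (intro real_cond_exp_pos) auto
  have eq: "(\<integral>\<^sup>+x\<in>A. ennreal (g x) \<partial>M) = ennreal (set_lebesgue_integral M A g)"
    if g: "integrable M g" "AE x in M. 0 \<le> g x" for g
  proof -
    have "(\<integral>\<^sup>+x\<in>A. ennreal (g x) \<partial>M) = (\<integral>\<^sup>+x. ennreal (indicator A x * g x) \<partial>M)"
      by (intro nn_integral_cong) (auto split: split_indicator)
    also have "\<dots> = ennreal (\<integral>x. indicator A x * g x \<partial>M)"
      using integrable_mult_indicator[OF AM g(1)] g(2)
      by (intro nn_integral_eq_integral) (auto split: split_indicator)
    finally show ?thesis by (simp add: set_lebesgue_integral_def)
  qed
  show ?thesis
    using eq[OF real_cond_exp_int(1)[OF f(1)] pos] eq[OF f] real_cond_exp_intA[OF f(1) A] by simp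
qed

text \<open>The event \<open>A\<close> on which the inequality fails is itself a test set.
  Cancellation there needs a finite integral of \<open>X'\<close>, which follows from that of
  \<open>X\<close> because \<open>X'\<close> is smaller on \<open>A\<close>.\<close>

lemma AE_le_of_nn_integral_le:
  assumes sub: "subalgebra M G" and X: "X \<in> borel_measurable G" and X': "X' \<in> borel_measurable G"
    and fin: "(\<integral>\<^sup>+x. X x \<partial>M) < \<infinity>"
    and le: "\<And>A. A \<in> sets G \<Longrightarrow> (\<integral>\<^sup>+x\<in>A. X x \<partial>M) \<le> (\<integral>\<^sup>+x\<in>A. X' x \<partial>M)"
  shows "AE x in M. X x \<le> (X' x :: ennreal)"
proof -
  define A where "A = {x\<in>space M. X' x < X x}"
  have "A = {x\<in>space G. X' x < X x}" using sub by (simp add: A_def subalgebra_def)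
  then have AG: "A \<in> sets G" using X X' by simp
  have [measurable]: "X \<in> borel_measurable M" "X' \<in> borel_measurable M" "A \<in> sets M"
    using measurable_from_subalg[OF sub] X X' AG sub by (auto simp: subalgebra_def)
  have finA: "(\<integral>\<^sup>+x\<in>A. X' x \<partial>M) \<noteq> \<infinity>"
  proof -
    have "(\<integral>\<^sup>+x\<in>A. X' x \<partial>M) \<le> (\<integral>\<^sup>+x. X x \<partial>M)"
      by (intro nn_integral_mono) (auto simp: A_def split: split_indicator)
    then show ?thesis using fin by auto
  qed
  have "(\<integral>\<^sup>+x\<in>A. X' x \<partial>M) + (\<integral>\<^sup>+x. (X x - X' x) * indicator A x \<partial>M)
      = (\<integral>\<^sup>+x. X' x * indicator A x + (X x - X' x) * indicator A x \<partial>M)"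
    by (intro nn_integral_add[symmetric]) auto
  also have "\<dots> = (\<integral>\<^sup>+x\<in>A. X x \<partial>M)"
    by (intro nn_integral_cong) (auto simp: A_def split: split_indicator dest: add_diff_inverse_ennreal[OF less_imp_le])
  also have "\<dots> \<le> (\<integral>\<^sup>+x\<in>A. X' x \<partial>M) + 0" using le[OF AG] by simp
  finally have "(\<integral>\<^sup>+x. (X x - X' x) * indicator A x \<partial>M) \<le> 0"
    using finA by (subst (asm) ennreal_add_left_cancel_le) auto
  then have "AE x in M. (X x - X' x) * indicator A x = 0"
    by (subst nn_integral_0_iff_AE[symmetric]) auto
  then show ?thesis using AE_space
  proof eventually_elim
    case (elim x)
    show ?case
    proof (cases "x \<in> A")
      case True
      then show ?thesis using elim(1) by (intro ennreal_minus_eq_0) simp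
    next
      case False
      then show ?thesis using elim(2) by (simp add: A_def not_less)
    qed
  qed
qed

section \<open>Cadlag versions of closed martingales\<close>

context filtered_prob
begin

abbreviation nnint :: "'a set \<Rightarrow> ('a \<Rightarrow> real) \<Rightarrow> ennreal" where
  "nnint A X \<equiv> (\<integral>\<^sup>+x\<in>A. ennreal (X x) \<partial>M)"

abbreviation tail :: "(real \<Rightarrow> 'a \<Rightarrow> real) \<Rightarrow> real \<Rightarrow> 'a \<Rightarrow> ennreal" where
  "tail g t x \<equiv> (\<integral>\<^sup>+s\<in>{t..}. ennreal (g s x) \<partial>lborel)"

context
  fixes G :: "'a \<Rightarrow> real"
  assumes G: "integrable M G" "\<And>x. 0 \<le> G x"
begin

abbreviation "cexp q x \<equiv> real_cond_exp M (F q) G x"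

lemma cexp_measurable: "0 \<le> q \<Longrightarrow> (\<lambda>x. cexp q x) \<in> borel_measurable M"
  by (rule measurable_F_M) auto

text \<open>\<open>T * 2 ^ m\<close> grid steps cover [0, T]. The limit inferior over the grids lets
  Fatou's lemma carry over the bound without comparing counts on different grids.\<close>

abbreviation upcrossings :: "real \<Rightarrow> real \<Rightarrow> nat \<Rightarrow> 'a \<Rightarrow> ennreal" where
  "upcrossings a b T x \<equiv> liminf (\<lambda>m. ennreal (upcount a b (\<lambda>k. cexp (real k / 2 ^ m) x) (T * 2 ^ m)))"

lemma upcrossings_liminf:
  assumes "0 \<le> a" "a < b"
  shows "(\<lambda>x. upcrossings a b T x) \<in> borel_measurable M"
    (is "?\<Phi> \<in> _")
    and "(\<integral>\<^sup>+x. upcrossings a b T x \<partial>M)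
       \<le> ennreal (a / (b - a))"
proof -
  have *: "(\<integral>\<^sup>+x. ennreal (upcount a b (\<lambda>k. cexp (real k / 2 ^ m) x) n) \<partial>M) \<le> ennreal (a / (b - a))
     \<and> (\<lambda>x. upcount a b (\<lambda>k. cexp (real k / 2 ^ m) x) n) \<in> measurable M (count_space UNIV)" for m n
  proof -
    have sf: "sigma_finite_subalgebra M (F (real k / 2 ^ m))" for k by (intro F_subalgebra) simp
    have 1: "subalgebra (F (real (Suc k) / 2 ^ m)) (F (real k / 2 ^ m))" for k
      by (intro subalg_mono) (auto simp: divide_right_mono)
    have 2: "subalgebra M (F (real k / 2 ^ m))" for k by (intro subalg) simp
    have 3: "integrable M (\<lambda>x. cexp (real k / 2 ^ m) x)" for k
      using sigma_finite_subalgebra.real_cond_exp_int(1)[OF sf G(1)] .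
    have 4: "set_lebesgue_integral M A (\<lambda>x. cexp (real (Suc k) / 2 ^ m) x) = set_lebesgue_integral M A (\<lambda>x. cexp (real k / 2 ^ m) x)"
      if A: "A \<in> sets (F (real k / 2 ^ m))" for A k
    proof -
      have "A \<in> sets (F (real (Suc k) / 2 ^ m))" using 1[of k] A by (auto simp: subalgebra_def)
      then show ?thesis
        using sigma_finite_subalgebra.real_cond_exp_intA[OF sf G(1), of A "Suc k"]
          sigma_finite_subalgebra.real_cond_exp_intA[OF sf G(1) A] by simp
    qed
    have 5: "AE x in M. 0 \<le> cexp (real k / 2 ^ m) x" for k
      by (rule sigma_finite_subalgebra.real_cond_exp_pos[OF sf]) (use G in auto)
    show ?thesis
      using nn_integral_upcount_le[of "\<lambda>k x. cexp (real k / 2 ^ m) x" "\<lambda>k. F (real k / 2 ^ m)" a b n, OF _ 1 2 3 4 5 assms]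
      by auto
  qed
  have m: "(\<lambda>x. ennreal (upcount a b (\<lambda>k. cexp (real k / 2 ^ m) x) (T * 2 ^ m))) \<in> borel_measurable M" for m
    using *[of m "T * 2 ^ m"] by (auto intro: measurable_compose[of _ _ "count_space UNIV"])
  then show "?\<Phi> \<in> borel_measurable M" by simp
  have "(\<integral>\<^sup>+x. ?\<Phi> x \<partial>M) \<le> liminf (\<lambda>m. \<integral>\<^sup>+x. ennreal (upcount a b (\<lambda>k. cexp (real k / 2 ^ m) x) (T * 2 ^ m)) \<partial>M)"
    by (rule nn_integral_liminf[OF m])
  also have "\<dots> \<le> liminf (\<lambda>m. ennreal (a / (b - a)))"
    by (intro Liminf_mono always_eventually allI) (use * in blast)
  finally show "(\<integral>\<^sup>+x. ?\<Phi> x \<partial>M) \<le> ennreal (a / (b - a))" by (simp add: Liminf_const)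
qed

lemma alternates_liminf:
  assumes "a < b" "alternates (\<lambda>q. cexp q x) a b dyadics j (real T)"
  shows "ennreal (real j) \<le> upcrossings a b T x"
proof (rule Liminf_bounded)
  obtain m0 where m0: "\<forall>m\<ge>m0. alternates (\<lambda>q. cexp q x) a b (dyadic_level m) j (real T)"
    using alternates_dyadics[OF assms(2)] by blast
  have "j \<le> upcount a b (\<lambda>k. cexp (real k / 2 ^ m) x) (T * 2 ^ m)" if "m0 \<le> m" for m
    using alternates_upcount[OF assms(1) m0[rule_format, OF that], of "T * 2 ^ m"] by simp
  then show "\<forall>\<^sub>F m in sequentially. ennreal (real j) \<le> ennreal (upcount a b (\<lambda>k. cexp (real k / 2 ^ m) x) (T * 2 ^ m))"
    unfolding eventually_sequentially by (intro exI[of _ m0]) (auto intro!: ennreal_leI)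
qed

text \<open>Oscillation is excluded because the expected number of upcrossings is finite. Local
  boundedness comes from the same inequality: a path that starts below \<open>N\<close> and exceeds
  \<open>N + 1 + n\<close> has upcrossed, and the expected number of such upcrossings tends to 0 as
  \<open>n\<close> grows.\<close>

lemma AE_dyadic_regular: "AE x in M. dyadic_regular (\<lambda>q. cexp q x)"
proof -
  define \<Phi> where "\<Phi> a b T x = upcrossings a b T x"
    for a b T x
  have \<Phi>_meas: "\<Phi> a b T \<in> borel_measurable M" if "0 \<le> a" "a < b" for a b T
    using upcrossings_liminf(1)[OF that] unfolding \<Phi>_def .
  have \<Phi>_int: "(\<integral>\<^sup>+x. \<Phi> a b T x \<partial>M) \<le> ennreal (a / (b - a))" if "0 \<le> a" "a < b" for a b T
    using upcrossings_liminf(2)[OF that] unfolding \<Phi>_def .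
  have nonneg: "AE x in M. \<forall>q\<in>dyadics. 0 \<le> cexp q x"
  proof (subst AE_ball_countable[OF countable_dyadics], intro ballI)
    fix q assume "q \<in> dyadics"
    then have "sigma_finite_subalgebra M (F q)" using dyadics_nonneg F_subalgebra by simp
    from sigma_finite_subalgebra.real_cond_exp_pos[OF this] show "AE x in M. 0 \<le> cexp q x" using G by simp
  qed
  have osc: "AE x in M. \<forall>a\<in>\<rat>. \<forall>b\<in>\<rat>. \<forall>T::nat. 0 \<le> a \<longrightarrow> a < b \<longrightarrow> \<Phi> a b T x \<noteq> \<infinity>"
    unfolding AE_ball_countable[OF countable_rat] AE_all_countable
  proof (intro ballI allI)
    fix a b :: real and T :: nat
    show "AE x in M. 0 \<le> a \<longrightarrow> a < b \<longrightarrow> \<Phi> a b T x \<noteq> \<infinity>"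
    proof (cases "0 \<le> a \<and> a < b")
      case True
      have "(\<integral>\<^sup>+x. \<Phi> a b T x \<partial>M) \<noteq> \<infinity>" using \<Phi>_int[of a b T] True by (auto simp: top_unique)
      then have "AE x in M. \<Phi> a b T x \<noteq> \<infinity>" using True \<Phi>_meas by (intro nn_integral_PInf_AE) auto
      then show ?thesis by auto
    qed auto
  qed
  have bounded: "AE x in M. \<forall>T N::nat. \<exists>n::nat. \<Phi> (real N) (real N + 1 + real n) T x < 1"
    unfolding AE_all_countable
  proof (intro allI)
    fix T N :: nat
    \<comment> \<open>Its expectation is at most \<open>N / (1 + n)\<close> for every
      \<open>n\<close>, so it vanishes almost surely; a value of \<open>\<Phi>\<close> below 1 then
      excludes even a single upcrossing.\<close>
    let ?f = "\<lambda>x. INF n::nat. \<Phi> (real N) (real N + 1 + real n) T x"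
    have m: "?f \<in> borel_measurable M" using \<Phi>_meas by (intro borel_measurable_INF) auto
    have "(\<integral>\<^sup>+x. ?f x \<partial>M) \<le> ennreal (real N / (1 + real n))" for n :: nat
    proof -
      have "(\<integral>\<^sup>+x. ?f x \<partial>M) \<le> (\<integral>\<^sup>+x. \<Phi> (real N) (real N + 1 + real n) T x \<partial>M)"
        by (intro nn_integral_mono INF_lower) auto
      also have "\<dots> \<le> ennreal (real N / (1 + real n))"
        using \<Phi>_int[of "real N" "real N + 1 + real n" T] by (simp add: algebra_simps)
      finally show ?thesis .
    qed
    moreover have "(\<lambda>n. ennreal (real N / (1 + real n))) \<longlonglongrightarrow> ennreal 0"
    proof (rule tendsto_ennrealI)
      have "(\<lambda>n. real N * (1 / real (Suc n))) \<longlonglongrightarrow> real N * 0"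
        by (intro tendsto_mult tendsto_const LIMSEQ_Suc[OF lim_1_over_n])
      then show "(\<lambda>n. real N / (1 + real n)) \<longlonglongrightarrow> 0" by (simp add: add.commute)
    qed
    ultimately have "(\<integral>\<^sup>+x. ?f x \<partial>M) \<le> ennreal 0"
      by (intro LIMSEQ_le_const) auto
    then have "AE x in M. ?f x = 0"
      using m by (subst nn_integral_0_iff_AE[symmetric]) auto
    then show "AE x in M. \<exists>n::nat. \<Phi> (real N) (real N + 1 + real n) T x < 1"
    proof eventually_elim
      case (elim x)
      then have "?f x < 1" by simp
      then show ?case by (auto simp: INF_less_iff)
    qed
  qed
  show ?thesis
    using nonneg osc bounded
  proof eventually_elim
    case (elim x)
    have "\<exists>j. \<not> alternates (\<lambda>q. cexp q x) a b dyadics j (real T)"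
      if ab: "a \<in> \<rat>" "b \<in> \<rat>" "0 \<le> a" "a < b" for a b and T :: nat
    proof (rule ccontr)
      assume "\<not> ?thesis"
      then have "ennreal (real j) \<le> \<Phi> a b T x" for j
        using alternates_liminf[OF ab(4)] unfolding \<Phi>_def by blast
      then have *: "of_nat j \<le> \<Phi> a b T x" for j by (simp add: ennreal_of_nat_eq_real_of_nat)
      obtain j :: nat where "\<Phi> a b T x < of_nat j"
        using elim(2)[rule_format, OF ab(1,2,3,4)] ennreal_Ex_less_of_nat by (metis infinity_ennreal_def less_top)
      with *[of j] show False by simp
    qed
    moreover have "\<exists>B. \<forall>q\<in>dyadics. q \<le> real T \<longrightarrow> cexp q x \<le> B" for T :: nat
    proof -
      obtain N :: nat where N: "cexp 0 x \<le> real N" using real_arch_simple by blast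
      obtain n :: nat where n: "\<Phi> (real N) (real N + 1 + real n) T x < 1" using elim(3) by blast
      have not: "\<not> alternates (\<lambda>q. cexp q x) (real N) (real N + 1 + real n) dyadics 1 (real T)"
      proof
        assume "alternates (\<lambda>q. cexp q x) (real N) (real N + 1 + real n) dyadics 1 (real T)"
        from alternates_liminf[OF _ this] n show False unfolding \<Phi>_def by (simp add: not_less[symmetric])
      qed
      have "cexp q x \<le> real N + 1 + real n" if q: "q \<in> dyadics" "q \<le> real T" for q
      \<comment> \<open>The upcrossing to be excluded starts at time 0 and ends at \<open>q\<close>,
        which must therefore be positive.\<close>
      proof (cases "q = 0")
        case True then show ?thesis using N by simp
      next
        case False
        then have "0 < q" using dyadics_nonneg[OF q(1)] by simp
        then have "\<not> real N + 1 + real n \<le> cexp q x" using not q N zero_dyadics by auto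
        then show ?thesis by simp
      qed
      then show ?thesis by blast
    qed
    ultimately show ?case using elim(1) unfolding dyadic_regular_def by blast
  qed
qed

text \<open>The value 0 off the regular paths makes every path right-continuous, as
  \<open>progressive_right_continuous\<close> asks for all points of the space.\<close>

definition regular_version :: "real \<Rightarrow> 'a \<Rightarrow> real" where
  "regular_version t x = (if dyadic_regular (\<lambda>q. cexp q x) then right_lim (\<lambda>q. cexp q x) t else 0)"

lemma regular_version_adapted: 
  assumes t: "0 \<le> t" shows "regular_version t \<in> borel_measurable (F t)"
proof (rule measurable_F_right[OF t])
  fix s assume s: "t < s"
  define R where "R = {x\<in>space M. dyadic_regular (\<lambda>q. cexp q x)}"
  have R: "R \<in> sets (F s)" unfolding R_def using AE_dyadic_regular s t by (intro AE_in_F) auto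
  \<comment> \<open>From index \<open>n0\<close> on, the dyadic times approximating \<open>t\<close>
    do not exceed \<open>s\<close>, so the approximants are \<open>F s\<close>-measurable.\<close>
  obtain n0 :: nat where n0: "(1/2) ^ n0 < s - t"
    using real_arch_pow_inv[of "s - t" "1/2"] s by auto
  have le: "dyadic_right (n + n0) t \<le> s" for n
  proof -
    have "(1/2::real) ^ (n + n0) \<le> (1/2) ^ n0" by (intro power_decreasing) auto
    then show ?thesis using dyadic_right_bounds(2)[of "n + n0" t] n0 by (simp add: power_one_over)
  qed
  have ge: "0 \<le> dyadic_right n t" for n
    using dyadic_right_bounds(1)[of t n] t by simp
  show "regular_version t \<in> borel_measurable (F s)"
  proof (rule borel_measurable_LIMSEQ_real)
    fix n
    have "(\<lambda>x. cexp (dyadic_right (n + n0) t) x) \<in> borel_measurable (F s)"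
      by (rule measurable_F_mono[OF ge[of "n + n0"] le]) simp
    then show "(\<lambda>x. cexp (dyadic_right (n + n0) t) x * indicator R x) \<in> borel_measurable (F s)"
      using R by simp
  next
    fix x assume "x \<in> space (F s)"
    then have x: "x \<in> space M" using s t by (simp add: space_F)
    show "(\<lambda>n. cexp (dyadic_right (n + n0) t) x * indicator R x) \<longlonglongrightarrow> regular_version t x"
    proof (cases "dyadic_regular (\<lambda>q. cexp q x)")
      case True
      from LIMSEQ_ignore_initial_segment[OF dyadic_right_right_lim[OF this t], of n0] show ?thesis
        using True x by (simp add: regular_version_def R_def)
    qed (use x in \<open>auto simp: regular_version_def R_def\<close>)
  qed
qed

lemma regular_version_nonneg: "0 \<le> t \<Longrightarrow> 0 \<le> regular_version t x"
  by (simp add: regular_version_def right_lim_nonneg)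

lemma regular_version_right_continuous: "0 \<le> t \<Longrightarrow> continuous (at_right t) (\<lambda>s. regular_version s x)"
  using right_lim_continuous[of "\<lambda>q. cexp q x" t] by (cases "dyadic_regular (\<lambda>q. cexp q x)") (auto simp: regular_version_def)

lemma regular_version_left_limit: "0 < t \<Longrightarrow> \<exists>l. ((\<lambda>s. regular_version s x) \<longlongrightarrow> l) (at_left t)"
  using right_lim_left_limit[of "\<lambda>q. cexp q x" t] by (cases "dyadic_regular (\<lambda>q. cexp q x)") (auto simp: regular_version_def)

lemma regular_version_progressive: "progressive M F regular_version"
  using progressive_right_continuous[OF regular_version_adapted regular_version_right_continuous] .

lemma regular_version_LIMSEQ: 
  "0 \<le> t \<Longrightarrow> AE x in M. (\<lambda>n. cexp (dyadic_right n t) x) \<longlonglongrightarrow> regular_version t x"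
  using AE_dyadic_regular by eventually_elim (auto simp: regular_version_def intro: dyadic_right_right_lim)

lemma nn_integral_cexp:
  assumes "0 \<le> s" "A \<in> sets (F s)"
  shows "nnint A (cexp s) = nnint A G"
  using sigma_finite_subalgebra.nn_integral_real_cond_exp[OF F_subalgebra[OF assms(1)] G(1) _ assms(2)] G(2) by simp

text \<open>\<open>A\<close> belongs to \<open>F q\<close> for all later \<open>q\<close>, so the
  integral of \<open>cexp q\<close> over it is that of \<open>G\<close>, constantly along
  \<open>dyadic_right\<close>; Fatou's lemma does the rest.\<close>

lemma nn_integral_regular_version_le:
  assumes t: "0 \<le> t" and A: "A \<in> sets (F t)"
  shows "nnint A (regular_version t) \<le> nnint A G"
proof -
  have ge: "0 \<le> dyadic_right n t" "t \<le> dyadic_right n t" for n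
    using dyadic_right_bounds(1)[of t n] t by simp_all
  note AM = sets_F_M[OF t A]
  have [measurable]: "(\<lambda>x. cexp (dyadic_right n t) x) \<in> borel_measurable M" for n
    using cexp_measurable ge by blast
  have "nnint A (regular_version t)
     = (\<integral>\<^sup>+x. liminf (\<lambda>n. ennreal (cexp (dyadic_right n t) x) * indicator A x) \<partial>M)"
  proof (rule nn_integral_cong_AE, use regular_version_LIMSEQ[OF t] in eventually_elim)
    case (elim x)
    have "(\<lambda>n. ennreal (cexp (dyadic_right n t) x) * indicator A x) \<longlonglongrightarrow> ennreal (regular_version t x) * indicator A x"
      using tendsto_ennrealI[OF elim] by (cases "x \<in> A") auto
    then show ?case by (simp add: lim_imp_Liminf)
  qed
  also have "\<dots> \<le> liminf (\<lambda>n. nnint A (cexp (dyadic_right n t)))"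
    using AM by (intro nn_integral_liminf) simp
  also have "\<dots> = nnint A G"
    using nn_integral_cexp[OF ge(1) sets_F_mono[OF t ge(2) A]] by (simp add: Liminf_const)
  finally show ?thesis .
qed

text \<open>A bound on \<open>G\<close> passes to its conditional expectations and makes dominated
  convergence available.\<close>

lemma nn_integral_regular_version_bounded:
  assumes t: "0 \<le> t" and A: "A \<in> sets (F t)" and bd: "\<And>x. G x \<le> B"
  shows "nnint A (regular_version t) = nnint A G"
proof -
  have ge: "0 \<le> dyadic_right n t" "t \<le> dyadic_right n t" for n
    using dyadic_right_bounds(1)[of t n] t by simp_all
  note [measurable] = sets_F_M[OF t A]
  have [measurable]: "(\<lambda>x. cexp (dyadic_right n t) x) \<in> borel_measurable M" for n
    using cexp_measurable ge by blast
  have [measurable]: "regular_version t \<in> borel_measurable M"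
    using measurable_F_M[OF t regular_version_adapted[OF t]] .
  have bdx: "AE x in M. cexp (dyadic_right n t) x \<le> B" for n
  proof -
    interpret sub: sigma_finite_subalgebra M "F (dyadic_right n t)" by (rule F_subalgebra[OF ge(1)])
    have "AE x in M. cexp (dyadic_right n t) x \<le> real_cond_exp M (F (dyadic_right n t)) (\<lambda>_. B) x"
      by (rule sub.real_cond_exp_mono) (use bd G(1) in auto)
    moreover have "AE x in M. real_cond_exp M (F (dyadic_right n t)) (\<lambda>_. B) x = B"
      by (rule sub.real_cond_exp_F_meas) auto
    ultimately show ?thesis by eventually_elim simp
  qed
  have "(\<lambda>n. nnint A (cexp (dyadic_right n t))) \<longlonglongrightarrow> nnint A (regular_version t)"
  proof (rule nn_integral_dominated_convergence[where w="\<lambda>_. ennreal B"])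
    show "AE x in M. ennreal (cexp (dyadic_right n t) x) * indicator A x \<le> ennreal B" for n
      using bdx[of n] by eventually_elim (auto split: split_indicator intro!: ennreal_leI)
    show "AE x in M. (\<lambda>n. ennreal (cexp (dyadic_right n t) x) * indicator A x) \<longlonglongrightarrow> ennreal (regular_version t x) * indicator A x"
      using regular_version_LIMSEQ[OF t]
    proof eventually_elim
      case (elim x)
      then show ?case using tendsto_ennrealI[OF elim] by (cases "x \<in> A") auto
    qed
  qed (auto simp: emeasure_space_1 ennreal_mult_less_top)
  moreover have "(\<lambda>n. nnint A (cexp (dyadic_right n t))) = (\<lambda>n. nnint A G)"
    using nn_integral_cexp[OF ge(1) sets_F_mono[OF t ge(2) A]] by simp
  ultimately show ?thesis by (simp add: LIMSEQ_const_iff)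
qed

end

lemma regular_version_mono:
  assumes G: "integrable M G" "\<And>x. 0 \<le> G x" and H: "integrable M H" "\<And>x. 0 \<le> H x"
    and le: "\<And>x. G x \<le> H x" and t: "0 \<le> t"
  shows "AE x in M. regular_version G t x \<le> regular_version H t x"
proof -
  have ge: "0 \<le> dyadic_right n t" for n
    using dyadic_right_bounds(1)[of t n] t by simp
  have "AE x in M. \<forall>n. real_cond_exp M (F (dyadic_right n t)) G x \<le> real_cond_exp M (F (dyadic_right n t)) H x"
    unfolding AE_all_countable
    using sigma_finite_subalgebra.real_cond_exp_mono[OF F_subalgebra[OF ge] AE_I2[OF le] G(1) H(1)] by blast
  with regular_version_LIMSEQ[OF G t] regular_version_LIMSEQ[OF H t]
  show ?thesis by eventually_elim (auto intro: LIMSEQ_le)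
qed

text \<open>Fatou gives one inequality; uniform integrability is avoided in the other one by truncating \<open>G\<close>.\<close>

lemma nn_integral_regular_version:
  assumes G: "integrable M G" "\<And>x. 0 \<le> G x" and t: "0 \<le> t" and A: "A \<in> sets (F t)"
  shows "nnint A (regular_version G t) = nnint A G"
proof (rule antisym[OF nn_integral_regular_version_le[OF assms]])
  have [measurable]: "G \<in> borel_measurable M" "A \<in> sets M" using G(1) sets_F_M[OF t A] by auto
  define H where "H n x = min (G x) (real n)" for n x
  have H: "integrable M (H n)" "0 \<le> H n x" "H n x \<le> G x" "H n x \<le> real n" for n x
    unfolding H_def using G by (auto intro!: Bochner_Integration.integrable_bound[OF G(1)])
  have [measurable]: "H n \<in> borel_measurable M" for n using H(1) by auto
  have lim: "(\<lambda>n. nnint A (H n)) \<longlonglongrightarrow> nnint A G"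
  proof (rule nn_integral_dominated_convergence[where w="\<lambda>x. ennreal (G x)"])
    show "AE x in M. ennreal (H n x) * indicator A x \<le> ennreal (G x)" for n
      using H(3)[of n] by (auto split: split_indicator intro!: ennreal_leI)
    show "(\<integral>\<^sup>+ x. ennreal (G x) \<partial>M) < \<infinity>"
      using G by (simp add: nn_integral_eq_integral)
    show "AE x in M. (\<lambda>n. ennreal (H n x) * indicator A x) \<longlonglongrightarrow> ennreal (G x) * indicator A x"
    proof (intro AE_I2 tendsto_eventually)
      fix x
      obtain n :: nat where "G x \<le> real n" using real_arch_simple by blast
      then show "\<forall>\<^sub>F n in sequentially. ennreal (H n x) * indicator A x = ennreal (G x) * indicator A x"
        unfolding eventually_sequentially H_def by (intro exI[of _ n]) auto
    qed
  qed auto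
  show "nnint A G \<le> nnint A (regular_version G t)"
  proof (rule LIMSEQ_le_const2[OF lim], intro exI allI impI)
    fix n
    have "nnint A (H n) = nnint A (regular_version (H n) t)"
      using nn_integral_regular_version_bounded[OF H(1,2) t A H(4)] by simp
    also have "\<dots> \<le> nnint A (regular_version G t)"
    proof (rule nn_integral_mono_AE, use regular_version_mono[OF H(1,2) G H(3) t, of n] in eventually_elim)
      case (elim x)
      then show ?case by (auto split: split_indicator intro!: ennreal_leI)
    qed
    finally show "nnint A (H n) \<le> nnint A (regular_version G t)" .
  qed
qed

end

section \<open>Potentials of progressive processes\<close>

context filtered_prob
begin

text \<open>Clamping the time argument maps the whole line into [0, t], which turns measurability on
  the restricted space into measurability on the full product.\<close>

lemma progressive_clamped:
  assumes g: "progressive M F g" and t: "0 \<le> t"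
  shows "(\<lambda>p. indicator {0..t} (fst p) * g (fst p) (snd p)) \<in> borel_measurable (lborel \<Otimes>\<^sub>M F t)"
proof -
  have 1: "(\<lambda>p. (max 0 (min t (fst p)), snd p)) \<in> lborel \<Otimes>\<^sub>M F t \<rightarrow>\<^sub>M restrict_space lborel {0..t} \<Otimes>\<^sub>M F t"
    using t by (intro measurable_Pair measurable_restrict_space2) auto
  have 2: "(\<lambda>(s, x). g s x) \<in> borel_measurable (restrict_space lborel {0..t} \<Otimes>\<^sub>M F t)"
    using g t by (simp add: progressive_def)
  have [measurable]: "(\<lambda>p. g (max 0 (min t (fst p))) (snd p)) \<in> borel_measurable (lborel \<Otimes>\<^sub>M F t)"
    using measurable_compose[OF 1 2] by simp
  have "(\<lambda>p. indicator {0..t} (fst p) * g (max 0 (min t (fst p))) (snd p)) \<in> borel_measurable (lborel \<Otimes>\<^sub>M F t)"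
    by measurable
  then show ?thesis
    by (rule measurable_cong[THEN iffD1, rotated]) (auto split: split_indicator)
qed

text \<open>Progressive measurability concerns bounded horizons; on the half-line one takes the
  limit over horizons \<open>n\<close>, each \<open>F n\<close> being coarser than
  \<open>M\<close>.\<close>

lemma progressive_joint:
  assumes g: "progressive M F g"
  shows "(\<lambda>p. indicator {0..} (fst p) * g (fst p) (snd p)) \<in> borel_measurable (lborel \<Otimes>\<^sub>M M)"
proof (rule borel_measurable_LIMSEQ_real)
  fix n :: nat
  have id: "(\<lambda>x. x) \<in> M \<rightarrow>\<^sub>M F (real n)" by (rule measurable_F_M[of "real n"]) auto
  have "(\<lambda>p. (fst p, snd p)) \<in> (lborel :: real measure) \<Otimes>\<^sub>M M \<rightarrow>\<^sub>M lborel \<Otimes>\<^sub>M F (real n)"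
    by (intro measurable_Pair measurable_fst measurable_compose[OF measurable_snd id])
  from measurable_compose[OF this progressive_clamped[OF g, of "real n"]]
  show "(\<lambda>p. indicator {0..real n} (fst p) * g (fst p) (snd p)) \<in> borel_measurable (lborel \<Otimes>\<^sub>M M)" by simp
next
  fix p :: "real \<times> 'a"
  obtain n :: nat where "fst p \<le> real n" using real_arch_simple by blast
  then have "\<forall>\<^sub>F n in sequentially. indicator {0..real n} (fst p) * g (fst p) (snd p) = indicator {0..} (fst p) * g (fst p) (snd p)"
    unfolding eventually_sequentially by (intro exI[of _ n]) (auto split: split_indicator)
  then show "(\<lambda>n. indicator {0..real n} (fst p) * g (fst p) (snd p)) \<longlonglongrightarrow> indicator {0..} (fst p) * g (fst p) (snd p)"
    by (rule tendsto_eventually)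
qed

lemma progressive_joint_ennreal:
  assumes g: "progressive M F g" and t: "0 \<le> t"
  shows "(\<lambda>(s, x). ennreal (g s x) * indicator {t..} s) \<in> borel_measurable (lborel \<Otimes>\<^sub>M M)"
proof -
  note progressive_joint[OF g, measurable]
  have "(\<lambda>p. ennreal (indicator {0..} (fst p) * g (fst p) (snd p)) * indicator {t..} (fst p)) \<in> borel_measurable (lborel \<Otimes>\<^sub>M M)"
    by measurable
  then show ?thesis
    by (rule measurable_cong[THEN iffD1, rotated]) (use t in \<open>auto split: split_indicator\<close>)
qed

lemma tail_measurable:
  assumes g: "progressive M F g" and t: "0 \<le> t"
  shows "(\<lambda>x. tail g t x) \<in> borel_measurable M"
proof -
  have "(\<lambda>p. case p of (s, x) \<Rightarrow> ennreal (g s x) * indicator {t..} s) \<in> borel_measurable (lborel \<Otimes>\<^sub>M M)"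
    using progressive_joint_ennreal[OF g t] .
  then have "(\<lambda>(x, s). ennreal (g s x) * indicator {t..} s) \<in> borel_measurable (M \<Otimes>\<^sub>M lborel)"
    by (subst measurable_pair_swap_iff) (simp add: case_prod_beta')
  then show ?thesis by (intro lborel.borel_measurable_nn_integral)
qed

text \<open>Time is integrated after the expectation. In this order it suffices to know the
  integrand almost surely at each fixed time, as in \<open>tail_integral_mono\<close> and
  \<open>tail_integral_cong\<close>; \<open>tail_integral_Fubini\<close> gives the link with the
  pathwise \<open>tail\<close>.\<close>

definition tail_integral :: "(real \<Rightarrow> 'a \<Rightarrow> real) \<Rightarrow> real \<Rightarrow> 'a set \<Rightarrow> ennreal" where
  "tail_integral g t A = (\<integral>\<^sup>+s\<in>{t..}. nnint A (g s) \<partial>lborel)"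

lemma tail_integral_Fubini:
  assumes g: "progressive M F g" and t: "0 \<le> t" and A: "A \<in> sets M"
  shows "(\<integral>\<^sup>+x\<in>A. tail g t x \<partial>M) = tail_integral g t A"
proof -
  interpret P: pair_sigma_finite lborel M ..
  note progressive_joint_ennreal[OF g t, measurable]
  note A[measurable]
  have "(\<lambda>x. ennreal (g s x) * indicator {t..} s) \<in> borel_measurable M" for s
    using measurable_Pair2[OF progressive_joint_ennreal[OF g t], of s] by simp
  then have m1: "(\<lambda>x. ennreal (g s x)) \<in> borel_measurable M" if "t \<le> s" for s
    using that by (metis (no_types, lifting) atLeast_iff indicator_simps(1) measurable_cong mult.right_neutral)
  have m2: "(\<lambda>s. ennreal (g s x) * indicator {t..} s) \<in> borel_measurable lborel" if "x \<in> space M" for x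
    using measurable_Pair1[OF progressive_joint_ennreal[OF g t] that] by simp
  have "(\<integral>\<^sup>+x\<in>A. tail g t x \<partial>M)
    = (\<integral>\<^sup>+x. (\<integral>\<^sup>+s. (ennreal (g s x) * indicator {t..} s) * indicator A x \<partial>lborel) \<partial>M)"
    by (intro nn_integral_cong nn_integral_multc[symmetric] m2)
  also have "\<dots> = (\<integral>\<^sup>+s. (\<integral>\<^sup>+x. (ennreal (g s x) * indicator {t..} s) * indicator A x \<partial>M) \<partial>lborel)"
  proof -
    have "(\<lambda>p. (case p of (s, x) \<Rightarrow> ennreal (g s x) * indicator {t..} s) * indicator A (snd p)) \<in> borel_measurable (lborel \<Otimes>\<^sub>M M)"
      by measurable
    from P.Fubini'[of "\<lambda>s x. (ennreal (g s x) * indicator {t..} s) * indicator A x"] this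
    show ?thesis by (simp add: case_prod_beta')
  qed
  also have "\<dots> = tail_integral g t A"
    unfolding tail_integral_def
  proof (intro nn_integral_cong)
    fix s :: real
    show "(\<integral>\<^sup>+x. (ennreal (g s x) * indicator {t..} s) * indicator A x \<partial>M) = nnint A (g s) * indicator {t..} s"
      by (cases "t \<le> s") auto
  qed
  finally show ?thesis .
qed

lemma tail_integral_measurable:
  assumes g: "progressive M F g" and t: "0 \<le> t" and A: "A \<in> sets M"
  shows "(\<lambda>s. nnint A (g s) * indicator {t..} s) \<in> borel_measurable lborel"
proof -
  note progressive_joint_ennreal[OF g t, measurable]
  note A[measurable]
  have "(\<lambda>(s, x). (ennreal (g s x) * indicator {t..} s) * indicator A x) \<in> borel_measurable (lborel \<Otimes>\<^sub>M M)"
  proof -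
    have "(\<lambda>p. (case p of (s, x) \<Rightarrow> ennreal (g s x) * indicator {t..} s) * indicator A (snd p)) \<in> borel_measurable (lborel \<Otimes>\<^sub>M M)"
      by measurable
    then show ?thesis by (simp add: case_prod_beta')
  qed
  then have "(\<lambda>s. \<integral>\<^sup>+x. (ennreal (g s x) * indicator {t..} s) * indicator A x \<partial>M) \<in> borel_measurable lborel"
    by (intro borel_measurable_nn_integral) 
  moreover have "(\<integral>\<^sup>+x. (ennreal (g s x) * indicator {t..} s) * indicator A x \<partial>M) = nnint A (g s) * indicator {t..} s" for s
    by (cases "t \<le> s") auto
  ultimately show ?thesis by simp
qed

lemma progressive_M: "progressive M F g \<Longrightarrow> 0 \<le> t \<Longrightarrow> g t \<in> borel_measurable M"
  using measurable_F_M progressive_adapted by blast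

lemma tail_integral_mono:
  assumes "0 \<le> t" "\<And>s. t \<le> s \<Longrightarrow> AE x in M. g s x \<le> h s x"
  shows "tail_integral g t A \<le> tail_integral h t A"
  unfolding tail_integral_def
proof (intro nn_integral_mono)
  fix s :: real
  have "nnint A (g s) \<le> nnint A (h s)" if "t \<le> s"
  proof (rule nn_integral_mono_AE, use assms(2)[OF that] in eventually_elim)
    case (elim x)
    then show ?case by (auto split: split_indicator intro!: ennreal_leI)
  qed
  then show "nnint A (g s) * indicator {t..} s \<le> nnint A (h s) * indicator {t..} s"
    by (auto split: split_indicator)
qed

lemma tail_integral_cong:
  assumes "0 \<le> t" "\<And>s. t \<le> s \<Longrightarrow> AE x in M. g s x = h s x"
  shows "tail_integral g t A = tail_integral h t A"
proof (rule antisym)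
  show "tail_integral g t A \<le> tail_integral h t A"
    by (rule tail_integral_mono[OF assms(1)]) (rule eventually_mono[OF assms(2)], auto)
  show "tail_integral h t A \<le> tail_integral g t A"
    by (rule tail_integral_mono[OF assms(1)]) (rule eventually_mono[OF assms(2)], auto)
qed

text \<open>The variable upper limit is moved into the integrand as a condition on \<open>r\<close>,
  so that measurability of parametric integrals applies.\<close>

lemma progressive_integral:
  assumes g: "progressive M F g"
  shows "progressive M F (\<lambda>t x. set_lebesgue_integral lborel {0..t} (\<lambda>s. g s x))"
  unfolding progressive_def
proof (intro allI impI)
  fix t :: real assume t: "0 \<le> t"
  let ?N = "restrict_space lborel {0..t} \<Otimes>\<^sub>M F t"
  note progressive_clamped[OF g t, measurable]
  have "(\<lambda>s::real. s) \<in> borel_measurable (restrict_space lborel {0..t})"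
    by (intro measurable_restrict_space1) simp
  then have [measurable]: "fst \<in> borel_measurable ?N" by (rule measurable_compose[OF measurable_fst])
  have sw: "(\<lambda>q. (snd q, snd (fst q))) \<in> ?N \<Otimes>\<^sub>M lborel \<rightarrow>\<^sub>M lborel \<Otimes>\<^sub>M F t" by measurable
  have h: "(\<lambda>q. indicator {0..t} (snd q) * g (snd q) (snd (fst q))) \<in> borel_measurable (?N \<Otimes>\<^sub>M lborel)"
    using measurable_compose[OF sw progressive_clamped[OF g t]] by simp
  have "(\<lambda>q. if snd q \<le> fst (fst q) then indicator {0..t} (snd q) * g (snd q) (snd (fst q)) else 0) \<in> borel_measurable (?N \<Otimes>\<^sub>M lborel)"
    using h by measurable
  then have "(\<lambda>p. \<integral>r. (if r \<le> fst p then indicator {0..t} r * g r (snd p) else 0) \<partial>lborel) \<in> borel_measurable ?N"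
    by (intro lborel.borel_measurable_lebesgue_integral) (simp add: case_prod_beta')
  then show "(\<lambda>(s, x). set_lebesgue_integral lborel {0..s} (\<lambda>r. g r x)) \<in> borel_measurable ?N"
  proof (rule measurable_cong[THEN iffD1, rotated])
    fix p assume "p \<in> space ?N"
    then have "fst p \<le> t" by (auto simp: space_pair_measure space_restrict_space)
    then show "(\<integral>r. (if r \<le> fst p then indicator {0..t} r * g r (snd p) else 0) \<partial>lborel)
      = (case p of (s, x) \<Rightarrow> set_lebesgue_integral lborel {0..s} (\<lambda>r. g r x))"
      unfolding set_lebesgue_integral_def case_prod_beta
      by (intro Bochner_Integration.integral_cong) (auto split: split_indicator)
  qed
qed

end

text \<open>The lower limit -1 makes \<open>t = 0\<close> an interior point of the interval of
  integration limits.\<close>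

lemma isCont_integral:
  fixes f :: "real \<Rightarrow> real"
  assumes f: "integrable lborel f" and t: "0 \<le> t"
  shows "isCont (\<lambda>t. set_lebesgue_integral lborel {-1..t} f) t"
proof -
  have si: "set_integrable lborel {-1..s} f" for s
    unfolding set_integrable_def using f by (intro integrable_mult_indicator) auto
  have "continuous_on {-1..t+1} (\<lambda>s. integral {-1..s} f)"
    using set_borel_integral_eq_integral(1)[OF si] by (rule indefinite_integral_continuous_1)
  then have "continuous_on {-1..t+1} (\<lambda>s. set_lebesgue_integral lborel {-1..s} f)"
    using set_borel_integral_eq_integral(2)[OF si] by simp
  then show ?thesis by (rule continuous_on_interior) (use t in auto)
qed

section \<open>Cadlag versions of potentials\<close>

context filtered_prob
begin

text \<open>\<open>W\<close> is a nonnegative cadlag version of \<open>E[\<integral>\<^sub>t\<^sup>\<infinity> g ds | F\<^sub>t]\<close>, tested on the sets of \<open>F t\<close>.\<close>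

definition represents :: "(real \<Rightarrow> 'a \<Rightarrow> real) \<Rightarrow> (real \<Rightarrow> 'a \<Rightarrow> real) \<Rightarrow> bool" where
  "represents W g \<longleftrightarrow> progressive M F W \<and> cadlag_paths M W \<and> (\<forall>t\<ge>0. \<forall>x\<in>space M. 0 \<le> W t x)
    \<and> (\<forall>t\<ge>0. \<forall>A\<in>sets (F t). nnint A (W t) = tail_integral g t A)"

text \<open>\<open>W\<close> is the closed martingale of the total integral \<open>G\<close> minus
  the running integral \<open>B\<close>. Both have regular paths, and splitting \<open>G\<close> at
  \<open>t\<close> turns the difference into the conditional expectation of the tail.\<close>

lemma exists_representation:
  assumes g: "progressive M F g" and nn: "\<And>t x. 0 \<le> t \<Longrightarrow> x \<in> space M \<Longrightarrow> 0 \<le> g t x"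
    and fin: "tail_integral g 0 (space M) < \<infinity>"
  shows "\<exists>W. represents W g"
proof -
  define D where "D t x = tail g t x" for t x
  define B where "B t x = set_lebesgue_integral lborel {0..t} (\<lambda>s. g s x)" for t x
  define G where "G x = enn2real (D 0 x)" for x
  have Dm: "D t \<in> borel_measurable M" if "0 \<le> t" for t
    unfolding D_def by (rule tail_measurable[OF g that])
  have DA: "(\<integral>\<^sup>+x\<in>A. D t x \<partial>M) = tail_integral g t A" if "0 \<le> t" "A \<in> sets M" for t A
    using tail_integral_Fubini[OF g that] unfolding D_def .
  have Dint: "(\<integral>\<^sup>+x. D 0 x \<partial>M) < \<infinity>"
  proof -
    have "(\<integral>\<^sup>+x. D 0 x \<partial>M) = (\<integral>\<^sup>+x\<in>space M. D 0 x \<partial>M)" by (intro nn_integral_cong) auto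
    then show ?thesis using DA[of 0 "space M"] fin by simp
  qed
  have Dfin: "AE x in M. D 0 x \<noteq> \<infinity>"
    using Dint Dm by (intro nn_integral_PInf_AE) auto
  then have GD: "AE x in M. ennreal (G x) = D 0 x"
    by eventually_elim (simp add: G_def less_top)
  have G: "integrable M G" "\<And>x. 0 \<le> G x"
  proof (rule integrableI_nonneg)
    show "G \<in> borel_measurable M" unfolding G_def using Dm by simp
    show "(\<integral>\<^sup>+ x. ennreal (G x) \<partial>M) < \<infinity>" using nn_integral_cong_AE[OF GD] Dint by simp
  qed (auto simp: G_def)
  have int: "AE x in M. integrable lborel (\<lambda>s. indicator {0..} s * g s x)"
    using Dfin AE_space
  proof eventually_elim
    case (elim x)
    show ?case
    proof (rule integrableI_nonneg)
      show "(\<lambda>s. indicator {0..} s * g s x) \<in> borel_measurable lborel"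
        using measurable_Pair1[OF progressive_joint[OF g] elim(2)] by simp
      have "(\<integral>\<^sup>+ s. ennreal (indicator {0..} s * g s x) \<partial>lborel) = D 0 x"
        unfolding D_def by (intro nn_integral_cong) (auto split: split_indicator)
      then show "(\<integral>\<^sup>+ s. ennreal (indicator {0..} s * g s x) \<partial>lborel) < \<infinity>"
        using elim(1) by (simp add: less_top)
    qed (use nn elim in \<open>auto split: split_indicator\<close>)
  qed
  have Bprog: "progressive M F B" unfolding B_def by (rule progressive_integral[OF g])
  have Bnn: "0 \<le> B t x" if "x \<in> space M" for t x
    unfolding B_def set_lebesgue_integral_def
    by (intro Bochner_Integration.integral_nonneg) (use nn that in \<open>auto split: split_indicator\<close>)
  have Bcont: "AE x in M. \<forall>t\<ge>0. continuous (at_right t) (\<lambda>s. B s x) \<and> (t > 0 \<longrightarrow> (\<exists>l. ((\<lambda>s. B s x) \<longlongrightarrow> l) (at_left t)))"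
    using int
  proof eventually_elim
    case (elim x)
    let ?B = "\<lambda>t. set_lebesgue_integral lborel {-1..t} (\<lambda>s. indicator {0..} s * g s x)"
    have eq: "?B t = B t x" for t
      unfolding B_def set_lebesgue_integral_def
      by (intro Bochner_Integration.integral_cong) (auto split: split_indicator)
    have "isCont (\<lambda>t. B t x) t" if "0 \<le> t" for t
      using isCont_integral[OF elim that] unfolding eq .
    then show ?case by (auto simp: continuous_at continuous_within intro: tendsto_within_subset)
  qed
  have split: "AE x in M. ennreal (G x) = ennreal (B t x) + D t x" if t: "0 \<le> t" for t
    using GD int AE_space
  proof eventually_elim
    case (elim x)
    have "(\<lambda>s. indicator {0..t} s *\<^sub>R (indicator {0..} s * g s x)) = (\<lambda>s. indicator {0..t} s * g s x)"
      by (auto split: split_indicator)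
    then have si: "integrable lborel (\<lambda>s. indicator {0..t} s * g s x)"
      using integrable_mult_indicator[OF _ elim(2), of "{0..t}"] by simp
    have B: "ennreal (B t x) = (\<integral>\<^sup>+s. ennreal (g s x) * indicator {0..t} s \<partial>lborel)"
    proof -
      have "ennreal (B t x) = (\<integral>\<^sup>+s. ennreal (indicator {0..t} s * g s x) \<partial>lborel)"
        using si nn elim unfolding B_def set_lebesgue_integral_def
        by (subst nn_integral_eq_integral) (auto split: split_indicator)
      also have "\<dots> = (\<integral>\<^sup>+s. ennreal (g s x) * indicator {0..t} s \<partial>lborel)"
        by (intro nn_integral_cong) (auto split: split_indicator)
      finally show ?thesis .
    qed
    have m: "(\<lambda>s. ennreal (g s x) * indicator {u..} s) \<in> borel_measurable lborel" if "0 \<le> u" for u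
      using measurable_Pair1[OF progressive_joint_ennreal[OF g that] elim(3)] by simp
    have m': "(\<lambda>s. ennreal (g s x) * indicator {0..t} s) \<in> borel_measurable lborel"
    proof -
      have "(\<lambda>s. (ennreal (g s x) * indicator {0..} s) * indicator {0..t} s) \<in> borel_measurable lborel"
        using m[of 0] by simp
      then show ?thesis by (rule measurable_cong[THEN iffD1, rotated]) (auto split: split_indicator)
    qed
    \<comment> \<open>Both pieces contain the endpoint \<open>t\<close>, which is a null
      set.\<close>
    have "D 0 x = (\<integral>\<^sup>+s. ennreal (g s x) * indicator {0..t} s + ennreal (g s x) * indicator {t..} s \<partial>lborel)"
      unfolding D_def
      by (intro nn_integral_cong_AE eventually_mono[OF AE_lborel_singleton[of t]])
        (use t in \<open>auto split: split_indicator\<close>)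
    also have "\<dots> = ennreal (B t x) + D t x"
      unfolding D_def B using m[OF t] m' by (intro nn_integral_add)
    finally show ?case using elim(1) by simp
  qed
  let ?X = "regular_version G"
  \<comment> \<open>The maximum makes \<open>W\<close> nonnegative everywhere; as
    \<open>?X t \<ge> B t\<close> almost surely at each time, the integrals are unaffected.\<close>
  define W where "W t x = max 0 (?X t x - B t x)" for t x
  have Xprog: "progressive M F ?X" by (rule regular_version_progressive[OF G])
  have "progressive M F W"
    using Xprog Bprog unfolding progressive_def W_def case_prod_beta
    by (auto intro!: borel_measurable_max borel_measurable_diff)
  moreover have "cadlag_paths M W"
    unfolding cadlag_paths_def using Bcont
  proof (eventually_elim, intro allI impI conjI)
    fix x and t :: real
    assume B: "\<forall>t\<ge>0. continuous (at_right t) (\<lambda>s. B s x) \<and> (t > 0 \<longrightarrow> (\<exists>l. ((\<lambda>s. B s x) \<longlongrightarrow> l) (at_left t)))"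
      and t: "0 \<le> t"
    show "continuous (at_right t) (\<lambda>s. W s x)"
      unfolding W_def using B t regular_version_right_continuous[OF G t]
      by (intro continuous_intros) auto
    assume t': "0 < t"
    obtain l l' where "((\<lambda>s. B s x) \<longlongrightarrow> l) (at_left t)" "((\<lambda>s. ?X s x) \<longlongrightarrow> l') (at_left t)"
      using B t t' regular_version_left_limit[OF G t'] by blast
    then show "\<exists>l. ((\<lambda>s. W s x) \<longlongrightarrow> l) (at_left t)"
      unfolding W_def by (intro exI[of _ "max 0 (l' - l)"] tendsto_intros)
  qed
  moreover have "\<forall>t\<ge>0. \<forall>x\<in>space M. 0 \<le> W t x" by (simp add: W_def)
  moreover have "nnint A (W t) = tail_integral g t A" if t: "0 \<le> t" and A: "A \<in> sets (F t)" for t A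
  proof -
    note AM[measurable] = sets_F_M[OF t A]
    have [measurable]: "?X t \<in> borel_measurable M" "B t \<in> borel_measurable M" "D t \<in> borel_measurable M" "G \<in> borel_measurable M"
      using progressive_M[OF Xprog t] progressive_M[OF Bprog t] Dm[OF t] G by auto
    then have [measurable]: "W t \<in> borel_measurable M" unfolding W_def by measurable
    have X: "nnint A (?X t) = nnint A G" if "A \<in> sets (F t)" for A
      using nn_integral_regular_version[OF G t that] .
    have BG: "nnint A (B t) \<le> nnint A G" for A
    proof (rule nn_integral_mono_AE, use split[OF t] in eventually_elim)
      case (elim x) then show ?case by (auto split: split_indicator)
    qed
    have Gfin: "(\<integral>\<^sup>+x. ennreal (G x) \<partial>M) < \<infinity>" using G by (simp add: nn_integral_eq_integral)
    have Bfin: "(\<integral>\<^sup>+x. ennreal (B t x) \<partial>M) < \<infinity>"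
    proof -
      have "(\<integral>\<^sup>+x. ennreal (B t x) \<partial>M) \<le> (\<integral>\<^sup>+x. ennreal (G x) \<partial>M)"
        by (rule nn_integral_mono_AE, use split[OF t] in eventually_elim) simp
      then show ?thesis using Gfin by (rule order.strict_trans1)
    qed
    \<comment> \<open>\<open>B t\<close> is \<open>F t\<close>-measurable and almost surely below
      \<open>G\<close>, whose integrals over \<open>F t\<close>-events agree with those of
      \<open>?X t\<close>.\<close>
    have "AE x in M. ennreal (B t x) \<le> ennreal (?X t x)"
    proof (rule AE_le_of_nn_integral_le[OF subalg[OF t] _ _ Bfin])
      show "nnint A (B t) \<le> nnint A (?X t)" if "A \<in> sets (F t)" for A
        using BG[of A] X[OF that] by simp
    qed (use progressive_adapted[OF Xprog t] progressive_adapted[OF Bprog t] in auto)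
    then have WB: "AE x in M. ennreal (?X t x) = ennreal (W t x) + ennreal (B t x)"
      using AE_space
    proof eventually_elim
      case (elim x)
      have "B t x \<le> ?X t x" using elim Bnn regular_version_nonneg[OF G t, of x] by (simp add: ennreal_le_iff)
      then show ?case using Bnn[OF elim(2)] by (simp add: W_def ennreal_plus[symmetric] del: ennreal_plus)
    qed
    have BA: "nnint A (B t) \<noteq> \<infinity>"
    proof -
      have "nnint A (B t) \<le> (\<integral>\<^sup>+x. ennreal (B t x) \<partial>M)"
        by (intro nn_integral_mono) (auto split: split_indicator)
      then show ?thesis using Bfin by auto
    qed
    have "nnint A (B t) + nnint A (W t)
        = (\<integral>\<^sup>+x. ennreal (B t x) * indicator A x + ennreal (W t x) * indicator A x \<partial>M)"
      by (intro nn_integral_add[symmetric]) auto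
    also have "\<dots> = nnint A (?X t)"
      by (rule nn_integral_cong_AE, use WB in eventually_elim) (auto split: split_indicator simp: add.commute)
    also have "\<dots> = nnint A G" by (rule X[OF A])
    also have "\<dots> = (\<integral>\<^sup>+x. ennreal (B t x) * indicator A x + D t x * indicator A x \<partial>M)"
      by (rule nn_integral_cong_AE, use split[OF t] in eventually_elim) (auto split: split_indicator)
    also have "\<dots> = nnint A (B t) + (\<integral>\<^sup>+x\<in>A. D t x \<partial>M)"
      by (intro nn_integral_add) auto
    finally have "nnint A (W t) = (\<integral>\<^sup>+x\<in>A. D t x \<partial>M)"
      using BA by (auto simp: ennreal_add_left_cancel)
    then show ?thesis using DA[OF t AM] by simp
  qed
  ultimately show ?thesis unfolding represents_def by blast
qed

end

section \<open>The subsolution\<close>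

text \<open>The tangent inequality of a convex power at \<open>x\<close>, arranged as sums of
  nonnegative terms for later use in \<open>ennreal\<close>. At positive arguments it is Young's
  inequality with weights 1/\<theta> and 1 - 1/\<theta>.\<close>

lemma powr_tangent:
  fixes x y \<theta> :: real
  assumes "1 < \<theta>" "0 \<le> x" "0 \<le> y"
  shows "x powr \<theta> + \<theta> * x powr (\<theta> - 1) * y \<le> y powr \<theta> + \<theta> * x powr (\<theta> - 1) * x"
proof (cases "x = 0 \<or> y = 0")
  case True
  have "x powr (\<theta> - 1) * x = x powr \<theta>" using assms by (cases "x = 0") (auto simp: powr_mult_base mult.commute)
  moreover have "1 * x powr \<theta> \<le> \<theta> * x powr \<theta>" using assms by (intro mult_right_mono) auto
  ultimately show ?thesis using True assms by (auto simp: mult.assoc)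
next
  case False
  then have pos: "0 < x" "0 < y" using assms by auto
  have "(y powr \<theta>) powr (1 / \<theta>) * (x powr \<theta>) powr (1 - 1 / \<theta>) \<le> 1 / \<theta> * y powr \<theta> + (1 - 1 / \<theta>) * x powr \<theta>"
    using assms pos by (intro Youngs_inequality_0) auto
  moreover have "\<theta> * (1 - 1 / \<theta>) = \<theta> - 1" using assms by (simp add: field_simps)
  ultimately have "y * x powr (\<theta> - 1) \<le> 1 / \<theta> * y powr \<theta> + (1 - 1 / \<theta>) * x powr \<theta>"
    using assms pos by (simp add: powr_powr)
  then have "\<theta> * (y * x powr (\<theta> - 1)) \<le> \<theta> * (1 / \<theta> * y powr \<theta> + (1 - 1 / \<theta>) * x powr \<theta>)"
    using assms by (intro mult_left_mono) auto
  also have "\<dots> = y powr \<theta> + (\<theta> - 1) * x powr \<theta>" using assms by (simp add: field_simps)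
  finally have "\<theta> * x powr (\<theta> - 1) * y \<le> y powr \<theta> + (\<theta> - 1) * x powr \<theta>" by (simp add: algebra_simps)
  moreover have "x powr (\<theta> - 1) * x = x powr \<theta>" using pos by (simp add: powr_mult_base mult.commute)
  ultimately show ?thesis by (simp add: algebra_simps)
qed

lemma nn_integral_exp_tail:
  assumes "0 < (a::real)"
  shows "(\<integral>\<^sup>+s\<in>{t..}. ennreal (exp (- (a * s))) \<partial>lborel) = ennreal (exp (- (a * t)) / a)"
proof -
  have "((\<lambda>s. - exp (- (a * s)) / a) \<longlongrightarrow> 0) at_top"
    using assms by real_asymp
  then show ?thesis
    by (subst nn_integral_FTC_atLeast[where F="\<lambda>s. - exp (- (a * s)) / a" and T=0])
      (use assms in \<open>auto intro!: derivative_eq_intros\<close>)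
qed

text \<open>The case \<open>r = 0\<close> stands apart: the sequence then sits at \<open>t\<close>,
  where \<open>at_right t\<close> says nothing.\<close>

lemma continuous_at_right_LIMSEQ:
  fixes f :: "real \<Rightarrow> real"
  assumes "continuous (at_right t) f" "0 \<le> r"
  shows "(\<lambda>n. f (t + 1 / real (Suc n) * r)) \<longlonglongrightarrow> f t"
proof (cases "r = 0")
  case False
  have "(\<lambda>n. t + 1 / real (Suc n) * r) \<longlonglongrightarrow> t + 0 * r"
    by (intro tendsto_intros LIMSEQ_Suc[OF lim_1_over_n])
  then have "filterlim (\<lambda>n. t + 1 / real (Suc n) * r) (at_right t) sequentially"
    using False assms(2) by (intro tendsto_imp_filterlim_at_right always_eventually) auto
  with assms(1) show ?thesis unfolding continuous_within by (rule filterlim_compose)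
qed simp

lemma indicator_affine:
  "0 < h \<Longrightarrow> indicator {t..<t + h} (t + h * r :: real) = (indicator {0..<1} r :: ennreal)"
  by (auto simp: zero_le_mult_iff split: split_indicator)

section \<open>Closure properties of progressive processes\<close>

lemma progressive_mult:
  "progressive M F X \<Longrightarrow> progressive M F Y \<Longrightarrow> progressive M F (\<lambda>t x. X t x * Y t x)"
  unfolding progressive_def case_prod_beta by (auto intro!: borel_measurable_times)

lemma progressive_min:
  "progressive M F X \<Longrightarrow> progressive M F Y \<Longrightarrow> progressive M F (\<lambda>t x. min (X t x) (Y t x))"
  unfolding progressive_def case_prod_beta by (auto intro!: borel_measurable_min)

lemma progressive_powr:
  "progressive M F X \<Longrightarrow> progressive M F (\<lambda>t x. X t x powr c)"
  unfolding progressive_def case_prod_beta by (auto intro!: powr_real_measurable)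

lemma progressive_const: "progressive M F (\<lambda>t x. c)"
  unfolding progressive_def case_prod_beta by auto

lemma progressive_deterministic:
  assumes "d \<in> borel_measurable borel"
  shows "progressive M F (\<lambda>t x. d t)"
  unfolding progressive_def case_prod_beta
proof (intro allI impI)
  fix t :: real
  have "d \<in> borel_measurable (restrict_space lborel {0..t})"
    using assms by (intro measurable_restrict_space1) simp
  then show "(\<lambda>p. d (fst p)) \<in> borel_measurable (restrict_space lborel {0..t} \<Otimes>\<^sub>M F t)"
    by (rule measurable_compose[OF measurable_fst])
qed

section \<open>The tangent argument for powers of a potential\<close>

context filtered_prob
begin

lemma representsD:
  assumes "represents W g"
  shows "progressive M F W" "cadlag_paths M W" "0 \<le> t \<Longrightarrow> x \<in> space M \<Longrightarrow> 0 \<le> W t x"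
    "0 \<le> t \<Longrightarrow> A \<in> sets (F t) \<Longrightarrow> nnint A (W t) = tail_integral g t A"
  using assms unfolding represents_def by auto

text \<open>\<open>Z t\<close> is the conditional expectation of the tail because their integrals
  agree on \<open>F t\<close>-events; this extends the identity from events to nonnegative
  \<open>F t\<close>-measurable weights, such as a tangent slope.\<close>

lemma represents_test_function:
  assumes Z: "represents Z w" and w: "progressive M F w" and t: "0 \<le> t" and \<xi>: "\<xi> \<in> borel_measurable (F t)"
  shows "(\<integral>\<^sup>+x. \<xi> x * ennreal (Z t x) \<partial>M) = (\<integral>\<^sup>+x. \<xi> x * tail w t x \<partial>M)"
proof -
  interpret sub: sigma_finite_subalgebra M "F t" by (rule F_subalgebra[OF t])
  let ?D = "\<lambda>x. tail w t x"
  note D = tail_measurable[OF w t]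
  have ZF: "(\<lambda>x. ennreal (Z t x)) \<in> borel_measurable (F t)"
    using progressive_adapted[OF representsD(1)[OF Z] t] by simp
  have "AE x in M. ennreal (Z t x) = nn_cond_exp M (F t) ?D x"
    using representsD(4)[OF Z t] tail_integral_Fubini[OF w t sets_F_M[OF t]] D ZF
    by (intro sub.nn_cond_exp_charact) auto
  then have "(\<integral>\<^sup>+x. \<xi> x * ennreal (Z t x) \<partial>M) = (\<integral>\<^sup>+x. \<xi> x * nn_cond_exp M (F t) ?D x \<partial>M)"
    by (intro nn_integral_cong_AE) (auto elim: eventually_mono)
  also have "\<dots> = (\<integral>\<^sup>+x. \<xi> x * ?D x \<partial>M)"
    by (rule sub.nn_cond_exp_intg[OF \<xi> D])
  finally show ?thesis .
qed

context
  fixes w Z :: "real \<Rightarrow> 'a \<Rightarrow> real" and a \<theta> :: real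
  assumes w: "progressive M F w" and w_nn: "\<And>s x. 0 \<le> s \<Longrightarrow> x \<in> space M \<Longrightarrow> 0 \<le> w s x"
    and w_le: "\<And>s x. 0 \<le> s \<Longrightarrow> x \<in> space M \<Longrightarrow> w s x \<le> exp (- (a * s))"
    and w_rc: "AE x in M. \<forall>t\<ge>0. continuous (at_right t) (\<lambda>s. w s x)"
    and a: "0 < a" "a < 1" and \<theta>: "\<theta> = 1 / a"
    and Z: "represents Z w"
    and Z_le: "\<And>t x. 0 \<le> t \<Longrightarrow> x \<in> space M \<Longrightarrow> Z t x \<le> exp (- (a * t)) / a"
begin

abbreviation "slope t x \<equiv> ennreal (\<theta> * Z t x powr (\<theta> - 1))"

abbreviation "slope_bound \<equiv> ennreal (\<theta> * (1 / a) powr (\<theta> - 1))"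

lemma theta_gt_1: "1 < \<theta>"
  using a \<theta> by simp

lemma Z_measurable: "0 \<le> t \<Longrightarrow> Z t \<in> borel_measurable (F t)" "0 \<le> t \<Longrightarrow> Z t \<in> borel_measurable M"
  using progressive_adapted[OF representsD(1)[OF Z]] progressive_M[OF representsD(1)[OF Z]] by auto

lemma Z_nn: "0 \<le> t \<Longrightarrow> x \<in> space M \<Longrightarrow> 0 \<le> Z t x"
  using representsD(3)[OF Z] .

lemma Z_le_const: "0 \<le> t \<Longrightarrow> x \<in> space M \<Longrightarrow> Z t x \<le> 1 / a"
proof -
  assume t: "0 \<le> t" "x \<in> space M"
  have "exp (- (a * t)) / a \<le> 1 / a" using a t by (intro divide_right_mono) auto
  then show ?thesis using Z_le[OF t] by simp
qed

text \<open>The tangent at \<open>Z t\<close> bounds \<open>Z t powr \<theta>\<close> by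
  \<open>Z (t + h) powr \<theta>\<close> plus the slope times \<open>Z t - Z (t + h)\<close>. The
  slope is frozen at time \<open>t\<close>, hence an admissible weight at both times, and the
  weighted difference integrates to the weighted integral of \<open>w\<close> over the step.\<close>

lemma increment_le:
  assumes t: "0 \<le> t" and h: "0 < h" and A: "A \<in> sets (F t)"
  shows "nnint A (\<lambda>x. Z t x powr \<theta>) \<le> nnint A (\<lambda>x. Z (t + h) x powr \<theta>)
    + (\<integral>\<^sup>+x. slope t x * indicator A x * (\<integral>\<^sup>+s\<in>{t..<t+h}. ennreal (w s x) \<partial>lborel) \<partial>M)"
    (is "?L \<le> ?R + ?I")
proof -
  let ?\<xi> = "\<lambda>x. slope t x * indicator A x"
  let ?D = "\<lambda>t x. tail w t x"
  let ?J = "\<lambda>x. \<integral>\<^sup>+s\<in>{t..<t+h}. ennreal (w s x) \<partial>lborel"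
  have th: "0 \<le> t + h" "t \<le> t + h" using t h by auto
  have \<xi>: "?\<xi> \<in> borel_measurable (F t)"
    using Z_measurable(1)[OF t] A by simp
  have \<xi>': "?\<xi> \<in> borel_measurable (F (t + h))"
    using measurable_F_mono[OF t th(2) \<xi>] .
  note [measurable] = Z_measurable(2)[OF t] Z_measurable(2)[OF th(1)] sets_F_M[OF t A]
  note [measurable] = tail_measurable[OF w t] tail_measurable[OF w th(1)]
  have m: "(\<lambda>s. ennreal (w s x) * indicator {u..} s) \<in> borel_measurable lborel" if "0 \<le> u" "x \<in> space M" for u x
    using measurable_Pair1[OF progressive_joint_ennreal[OF w that(1)] that(2)] by simp
  have [measurable]: "?J \<in> borel_measurable M"
  proof -
    note progressive_joint_ennreal[OF w t, measurable]
    have "(\<lambda>p. (case p of (s, x) \<Rightarrow> ennreal (w s x) * indicator {t..} s) * indicator {t..<t+h} (fst p)) \<in> borel_measurable (lborel \<Otimes>\<^sub>M M)"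
      by measurable
    then have "(\<lambda>p. ennreal (w (fst p) (snd p)) * indicator {t..<t+h} (fst p)) \<in> borel_measurable (lborel \<Otimes>\<^sub>M M)"
      by (rule measurable_cong[THEN iffD1, rotated]) (auto split: split_indicator)
    then have "(\<lambda>(x, s). ennreal (w s x) * indicator {t..<t+h} s) \<in> borel_measurable (M \<Otimes>\<^sub>M lborel)"
      by (subst measurable_pair_swap_iff) (simp add: case_prod_beta')
    then show ?thesis by (intro lborel.borel_measurable_nn_integral)
  qed
  have D: "?D t x = ?J x + ?D (t + h) x" if "x \<in> space M" for x
  proof -
    have "(\<lambda>s. (ennreal (w s x) * indicator {t..} s) * indicator {t..<t+h} s) \<in> borel_measurable lborel"
      using m[OF t that] by simp
    then have m2: "(\<lambda>s. ennreal (w s x) * indicator {t..<t+h} s) \<in> borel_measurable lborel"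
      by (rule measurable_cong[THEN iffD1, rotated]) (auto split: split_indicator)
    have "?D t x = (\<integral>\<^sup>+s. ennreal (w s x) * indicator {t..<t+h} s + ennreal (w s x) * indicator {t+h..} s \<partial>lborel)"
      using h by (intro nn_integral_cong) (auto split: split_indicator)
    also have "\<dots> = ?J x + ?D (t + h) x"
      using m2 m[OF th(1) that] by (intro nn_integral_add)
    finally show ?thesis .
  qed
  have 1: "(\<integral>\<^sup>+x. ?\<xi> x * ennreal (Z t x) \<partial>M) = ?I + (\<integral>\<^sup>+x. ?\<xi> x * ennreal (Z (t + h) x) \<partial>M)"
  proof -
    have "(\<integral>\<^sup>+x. ?\<xi> x * ennreal (Z t x) \<partial>M) = (\<integral>\<^sup>+x. ?\<xi> x * ?D t x \<partial>M)"
      by (rule represents_test_function[OF Z w t \<xi>])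
    also have "\<dots> = (\<integral>\<^sup>+x. ?\<xi> x * ?J x + ?\<xi> x * ?D (t + h) x \<partial>M)"
      by (intro nn_integral_cong) (simp only: D distrib_left)
    also have "\<dots> = ?I + (\<integral>\<^sup>+x. ?\<xi> x * ?D (t + h) x \<partial>M)"
      by (intro nn_integral_add) measurable
    also have "(\<integral>\<^sup>+x. ?\<xi> x * ?D (t + h) x \<partial>M) = (\<integral>\<^sup>+x. ?\<xi> x * ennreal (Z (t + h) x) \<partial>M)"
      by (rule represents_test_function[OF Z w th(1) \<xi>', symmetric])
    finally show ?thesis .
  qed
  \<comment> \<open>This term will occur on both sides, and cancelling it in \<open>ennreal\<close>
    requires finiteness.\<close>
  have fin: "(\<integral>\<^sup>+x. ?\<xi> x * ennreal (Z (t + h) x) \<partial>M) < \<infinity>"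
  proof -
    have "(\<integral>\<^sup>+x. ?\<xi> x * ennreal (Z (t + h) x) \<partial>M) \<le> (\<integral>\<^sup>+x. ennreal (\<theta> * (1 / a) powr (\<theta> - 1) * (1 / a)) \<partial>M)"
    proof (intro nn_integral_mono)
      fix x assume x: "x \<in> space M"
      have "slope t x * ennreal (Z (t + h) x) = ennreal (\<theta> * Z t x powr (\<theta> - 1) * Z (t + h) x)"
        using theta_gt_1 Z_nn[OF th(1) x] by (intro ennreal_mult[symmetric]) auto
      also have "\<dots> \<le> ennreal (\<theta> * (1 / a) powr (\<theta> - 1) * (1 / a))"
        using theta_gt_1 Z_nn[OF th(1) x] Z_nn[OF t x] Z_le_const[OF th(1) x] Z_le_const[OF t x] a
        by (intro ennreal_leI mult_mono powr_mono2) auto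
      finally show "?\<xi> x * ennreal (Z (t + h) x) \<le> ennreal (\<theta> * (1 / a) powr (\<theta> - 1) * (1 / a))"
        by (auto split: split_indicator)
    qed
    then show ?thesis by (auto simp: emeasure_space_1 intro: order.strict_trans1)
  qed
  have "?L + (\<integral>\<^sup>+x. ?\<xi> x * ennreal (Z (t + h) x) \<partial>M)
     = (\<integral>\<^sup>+x. ennreal (Z t x powr \<theta>) * indicator A x + ?\<xi> x * ennreal (Z (t + h) x) \<partial>M)"
    by (intro nn_integral_add[symmetric]) measurable
  also have "\<dots> \<le> (\<integral>\<^sup>+x. ennreal (Z (t + h) x powr \<theta>) * indicator A x + ?\<xi> x * ennreal (Z t x) \<partial>M)"
  proof (intro nn_integral_mono)
    fix x assume x: "x \<in> space M"
    have "ennreal (Z t x powr \<theta> + \<theta> * Z t x powr (\<theta> - 1) * Z (t + h) x)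
       \<le> ennreal (Z (t + h) x powr \<theta> + \<theta> * Z t x powr (\<theta> - 1) * Z t x)"
      by (intro ennreal_leI powr_tangent theta_gt_1 Z_nn t th x)
    then show "ennreal (Z t x powr \<theta>) * indicator A x + ?\<xi> x * ennreal (Z (t + h) x)
       \<le> ennreal (Z (t + h) x powr \<theta>) * indicator A x + ?\<xi> x * ennreal (Z t x)"
      using theta_gt_1 Z_nn[OF t x] Z_nn[OF th(1) x]
      by (auto split: split_indicator simp: ennreal_mult)
  qed
  also have "\<dots> = ?R + (\<integral>\<^sup>+x. ?\<xi> x * ennreal (Z t x) \<partial>M)"
    by (intro nn_integral_add) measurable
  also have "\<dots> = (?R + ?I) + (\<integral>\<^sup>+x. ?\<xi> x * ennreal (Z (t + h) x) \<partial>M)"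
    unfolding 1 by (simp only: add.assoc)
  finally have "(\<integral>\<^sup>+x. ?\<xi> x * ennreal (Z (t + h) x) \<partial>M) + ?L
     \<le> (\<integral>\<^sup>+x. ?\<xi> x * ennreal (Z (t + h) x) \<partial>M) + (?R + ?I)"
    by (simp only: add.commute)
  then show ?thesis
    unfolding ennreal_add_left_cancel_le using less_imp_neq[OF fin] by simp
qed

abbreviation "step n \<equiv> 1 / real (Suc n)"

text \<open>The mean of \<open>w\<close> over [t, t + step n), substituted to a fixed unit interval
  so that dominated convergence in \<open>n\<close> applies.\<close>

definition avg :: "nat \<Rightarrow> real \<Rightarrow> 'a \<Rightarrow> ennreal" where
  "avg n t x = (\<integral>\<^sup>+r\<in>{0..<1}. ennreal (w (t + step n * r) x) \<partial>lborel)"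

definition moment :: "'a set \<Rightarrow> real \<Rightarrow> ennreal" where
  "moment A t = nnint A (\<lambda>x. Z t x powr \<theta>)"

definition drift :: "'a set \<Rightarrow> nat \<Rightarrow> real \<Rightarrow> ennreal" where
  "drift A n t = (\<integral>\<^sup>+x. slope t x * indicator A x * avg n t x \<partial>M)"

lemma w_section: "x \<in> space M \<Longrightarrow> (\<lambda>s. ennreal (w s x) * indicator {0..} s) \<in> borel_measurable borel"
  using measurable_Pair1[OF progressive_joint_ennreal[OF w order.refl], of x] by simp

lemma w_section_step:
  assumes "x \<in> space M" "0 \<le> t"
  shows "(\<lambda>r. ennreal (w (t + step n * r) x) * indicator {0..<1} r) \<in> borel_measurable borel"
proof -
  note w_section[OF assms(1), measurable]
  have [measurable]: "(\<lambda>r. t + step n * r) \<in> borel_measurable borel" by measurable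
  have "(\<lambda>r. (ennreal (w (t + step n * r) x) * indicator {0..} (t + step n * r)) * indicator {0..<1} r) \<in> borel_measurable borel"
    using measurable_compose[OF \<open>(\<lambda>r. t + step n * r) \<in> _\<close> w_section[OF assms(1)]] by simp
  then show ?thesis
    by (rule measurable_cong[THEN iffD1, rotated]) (use assms in \<open>auto split: split_indicator\<close>)
qed

lemma integral_eq_avg:
  assumes x: "x \<in> space M" and t: "0 \<le> t"
  shows "(\<integral>\<^sup>+s\<in>{t..<t + step n}. ennreal (w s x) \<partial>lborel) = ennreal (step n) * avg n t x"
proof -
  have "(\<lambda>s. (ennreal (w s x) * indicator {0..} s) * indicator {t..<t + step n} s) \<in> borel_measurable borel"
    using w_section[OF x] by simp
  then have m: "(\<lambda>s. ennreal (w s x) * indicator {t..<t + step n} s) \<in> borel_measurable borel"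
    by (rule measurable_cong[THEN iffD1, rotated]) (use t in \<open>auto split: split_indicator\<close>)
  have "(\<integral>\<^sup>+s\<in>{t..<t + step n}. ennreal (w s x) \<partial>lborel)
    = ennreal \<bar>step n\<bar> * (\<integral>\<^sup>+r. ennreal (w (t + step n * r) x) * indicator {t..<t + step n} (t + step n * r) \<partial>lborel)"
    by (rule nn_integral_real_affine[OF m]) simp
  also have "\<dots> = ennreal (step n) * avg n t x"
    unfolding avg_def by (subst indicator_affine) auto
  finally show ?thesis .
qed

lemma avg_le: 
  assumes x: "x \<in> space M" and t: "0 \<le> t"
  shows "avg n t x \<le> ennreal (exp (- (a * t)))"
proof -
  have "avg n t x \<le> (\<integral>\<^sup>+r\<in>{0..<1}. ennreal (exp (- (a * t))) \<partial>(lborel :: real measure))"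
    unfolding avg_def
  proof (intro nn_integral_mono)
    fix r :: real
    have "w (t + step n * r) x \<le> exp (- (a * t))" if "0 \<le> r"
    proof -
      have "w (t + step n * r) x \<le> exp (- (a * (t + step n * r)))" using that t x by (intro w_le) auto
      also have "\<dots> \<le> exp (- (a * t))" using that a by (simp add: distrib_left)
      finally show ?thesis .
    qed
    then show "ennreal (w (t + step n * r) x) * indicator {0..<1} r \<le> ennreal (exp (- (a * t))) * indicator {0..<1} r"
      by (auto split: split_indicator intro!: ennreal_leI)
  qed
  also have "\<dots> = ennreal (exp (- (a * t)))" by (simp add: nn_integral_cmult_indicator)
  finally show ?thesis .
qed

lemma avg_tendsto: "AE x in M. \<forall>t\<ge>0. (\<lambda>n. avg n t x) \<longlonglongrightarrow> ennreal (w t x)"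
  using w_rc AE_space
proof (eventually_elim, intro allI impI)
  fix x and t :: real
  assume rc: "\<forall>t\<ge>0. continuous (at_right t) (\<lambda>s. w s x)" and x: "x \<in> space M" and t: "0 \<le> t"
  have "(\<lambda>n. avg n t x) \<longlonglongrightarrow> (\<integral>\<^sup>+r. ennreal (w t x) * indicator {0..<1} r \<partial>(lborel :: real measure))"
    unfolding avg_def
  proof (rule nn_integral_dominated_convergence[where w="\<lambda>r. indicator {0..<1} r"])
    show "AE r in lborel. ennreal (w (t + step n * r) x) * indicator {0..<1} r \<le> indicator {0..<1} r" for n
    proof (intro AE_I2)
      fix r :: real
      have "w (t + step n * r) x \<le> 1" if r: "0 \<le> r"
      proof -
        have "w (t + step n * r) x \<le> exp (- (a * (t + step n * r)))" using r t x by (intro w_le) auto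
        also have "\<dots> \<le> 1" using r t a by simp
        finally show ?thesis .
      qed
      then show "ennreal (w (t + step n * r) x) * indicator {0..<1} r \<le> indicator {0..<1} r"
        by (auto split: split_indicator)
    qed
    show "AE r in lborel. (\<lambda>n. ennreal (w (t + step n * r) x) * indicator {0..<1} r) \<longlonglongrightarrow> ennreal (w t x) * indicator {0..<1} r"
    proof (intro AE_I2)
      fix r :: real
      show "(\<lambda>n. ennreal (w (t + step n * r) x) * indicator {0..<1} r) \<longlonglongrightarrow> ennreal (w t x) * indicator {0..<1} r"
        using tendsto_ennrealI[OF continuous_at_right_LIMSEQ[of t "\<lambda>s. w s x" r]] rc t
        by (auto split: split_indicator)
    qed
  qed (use w_section_step[OF x t] in auto)
  then show "(\<lambda>n. avg n t x) \<longlonglongrightarrow> ennreal (w t x)" by (simp add: nn_integral_cmult_indicator)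
qed

lemma avg_measurable_joint:
  "(\<lambda>p. avg n (fst p) (snd p) * indicator {0..} (fst p)) \<in> borel_measurable (lborel \<Otimes>\<^sub>M M)"
proof -
  have 1: "(\<lambda>q. (fst (fst q) + step n * snd q, snd (fst q))) \<in> (lborel \<Otimes>\<^sub>M M) \<Otimes>\<^sub>M lborel \<rightarrow>\<^sub>M lborel \<Otimes>\<^sub>M M"
  proof (rule measurable_pair)
    have "(\<lambda>q. fst (fst q) + step n * snd q) \<in> borel_measurable (((lborel :: real measure) \<Otimes>\<^sub>M M) \<Otimes>\<^sub>M (lborel :: real measure))"
      by measurable
    then show "fst \<circ> (\<lambda>q. (fst (fst q) + step n * snd q, snd (fst q))) \<in> (lborel \<Otimes>\<^sub>M M) \<Otimes>\<^sub>M lborel \<rightarrow>\<^sub>M lborel"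
      by (simp add: comp_def)
    show "snd \<circ> (\<lambda>q. (fst (fst q) + step n * snd q, snd (fst q))) \<in> (lborel \<Otimes>\<^sub>M M) \<Otimes>\<^sub>M lborel \<rightarrow>\<^sub>M M"
      by (simp add: comp_def)
  qed
  have 2: "(\<lambda>q. ennreal (w (fst (fst q) + step n * snd q) (snd (fst q))) * indicator {0..} (fst (fst q) + step n * snd q)) \<in> borel_measurable ((lborel \<Otimes>\<^sub>M M) \<Otimes>\<^sub>M lborel)"
    using measurable_compose[OF 1 progressive_joint_ennreal[OF w order.refl]] by simp
  have "(\<lambda>q. ennreal (w (fst (fst q) + step n * snd q) (snd (fst q))) * indicator {0..} (fst (fst q) + step n * snd q)
     * (indicator {0..<1} (snd q) * indicator {0..} (fst (fst q)))) \<in> borel_measurable ((lborel \<Otimes>\<^sub>M M) \<Otimes>\<^sub>M lborel)"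
    using 2 by measurable
  then have "(\<lambda>p. \<integral>\<^sup>+r. ennreal (w (fst p + step n * r) (snd p)) * indicator {0..} (fst p + step n * r)
     * (indicator {0..<1} r * indicator {0..} (fst p)) \<partial>lborel) \<in> borel_measurable (lborel \<Otimes>\<^sub>M M)"
    by (intro lborel.borel_measurable_nn_integral) (simp add: case_prod_beta')
  then show ?thesis
  proof (rule measurable_cong[THEN iffD1, rotated])
    fix p :: "real \<times> 'a" assume "p \<in> space (lborel \<Otimes>\<^sub>M M)"
    then have x: "snd p \<in> space M" by (auto simp: space_pair_measure)
    show "(\<integral>\<^sup>+r. ennreal (w (fst p + step n * r) (snd p)) * indicator {0..} (fst p + step n * r)
     * (indicator {0..<1} r * indicator {0..} (fst p)) \<partial>lborel) = avg n (fst p) (snd p) * indicator {0..} (fst p)"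
    proof (cases "0 \<le> fst p")
      case True
      then show ?thesis unfolding avg_def
        by (auto intro!: nn_integral_cong split: split_indicator)
    qed auto
  qed
qed

lemma avg_measurable: "0 \<le> t \<Longrightarrow> (\<lambda>x. avg n t x) \<in> borel_measurable M"
  using measurable_Pair2[OF avg_measurable_joint, of t n] by simp

lemma Zpow_joint: "(\<lambda>p. ennreal (\<theta> * Z (fst p) (snd p) powr (\<theta> - 1)) * indicator {0..} (fst p)) \<in> borel_measurable (lborel \<Otimes>\<^sub>M M)"
proof -
  note progressive_joint[OF representsD(1)[OF Z], measurable]
  have "(\<lambda>p. ennreal (\<theta> * (indicator {0..} (fst p) * Z (fst p) (snd p)) powr (\<theta> - 1)) * indicator {0..} (fst p)) \<in> borel_measurable (lborel \<Otimes>\<^sub>M M)"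
    by measurable
  then show ?thesis
    by (rule measurable_cong[THEN iffD1, rotated]) (auto split: split_indicator)
qed

lemma drift_measurable:
  assumes t0: "0 \<le> t0" and A: "A \<in> sets M"
  shows "(\<lambda>t. drift A n t * indicator {t0..} t) \<in> borel_measurable lborel"
proof -
  note Zpow_joint[measurable] avg_measurable_joint[measurable] A[measurable]
  have "(\<lambda>p. (ennreal (\<theta> * Z (fst p) (snd p) powr (\<theta> - 1)) * indicator {0..} (fst p)) * indicator A (snd p)
     * (avg n (fst p) (snd p) * indicator {0..} (fst p)) * indicator {t0..} (fst p)) \<in> borel_measurable (lborel \<Otimes>\<^sub>M M)"
    by measurable
  then have "(\<lambda>t. \<integral>\<^sup>+x. (slope t x * indicator {0..} t) * indicator A x
     * (avg n t x * indicator {0..} t) * indicator {t0..} t \<partial>M) \<in> borel_measurable lborel"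
    by (intro borel_measurable_nn_integral) (simp add: case_prod_beta')
  moreover have "(\<integral>\<^sup>+x. (slope t x * indicator {0..} t) * indicator A x
     * (avg n t x * indicator {0..} t) * indicator {t0..} t \<partial>M) = drift A n t * indicator {t0..} t" for t
    using t0 by (cases "t0 \<le> t") (auto simp: drift_def)
  ultimately show ?thesis by simp
qed

lemma Zpow_le: "0 \<le> t \<Longrightarrow> x \<in> space M \<Longrightarrow> \<theta> * Z t x powr (\<theta> - 1) \<le> \<theta> * (1 / a) powr (\<theta> - 1)"
  using theta_gt_1 Z_nn Z_le_const by (intro mult_left_mono powr_mono2) auto

lemma drift_integrand_le:
  assumes "0 \<le> t" "x \<in> space M"
  shows "slope t x * indicator A x * avg n t x \<le> slope_bound * ennreal (exp (- (a * t)))"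
proof -
  have "slope t x * indicator A x \<le> slope_bound"
    using Zpow_le[OF assms] by (auto split: split_indicator intro!: ennreal_leI)
  then show ?thesis using avg_le[OF assms(2,1), of n] by (intro mult_mono) auto
qed

lemma drift_tendsto:
  assumes t: "0 \<le> t" and A: "A \<in> sets M"
  shows "(\<lambda>n. drift A n t) \<longlonglongrightarrow> nnint A (\<lambda>x. \<theta> * w t x * Z t x powr (\<theta> - 1))"
  unfolding drift_def
proof (rule nn_integral_dominated_convergence[where w="\<lambda>_. slope_bound * ennreal (exp (- (a * t)))"])
  note [measurable] = A Z_measurable(2)[OF t] avg_measurable[OF t] progressive_M[OF w t]
  show "(\<lambda>x. slope t x * indicator A x * avg n t x) \<in> borel_measurable M" for n
    by measurable
  show "(\<lambda>x. ennreal (\<theta> * w t x * Z t x powr (\<theta> - 1)) * indicator A x) \<in> borel_measurable M"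
    by measurable
  show "AE x in M. slope t x * indicator A x * avg n t x \<le> slope_bound * ennreal (exp (- (a * t)))" for n
    using drift_integrand_le[OF t] by auto
  show "AE x in M. (\<lambda>n. slope t x * indicator A x * avg n t x) \<longlonglongrightarrow> ennreal (\<theta> * w t x * Z t x powr (\<theta> - 1)) * indicator A x"
    using avg_tendsto AE_space
  proof eventually_elim
    case (elim x)
    have "(\<lambda>n. slope t x * avg n t x) \<longlonglongrightarrow> slope t x * ennreal (w t x)"
      by (intro ennreal_tendsto_cmult) (use elim t in auto)
    moreover have "slope t x * ennreal (w t x) = ennreal (\<theta> * w t x * Z t x powr (\<theta> - 1))"
      using theta_gt_1 w_nn[OF t elim(2)] by (subst ennreal_mult[symmetric]) (auto simp: mult_ac)
    ultimately show ?case by (auto split: split_indicator)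
  qed
qed (auto simp: emeasure_space_1 ennreal_mult_less_top)

lemma drift_le:
  assumes t: "0 \<le> t"
  shows "drift A n t \<le> slope_bound * ennreal (exp (- (a * t)))"
proof -
  have "drift A n t \<le> (\<integral>\<^sup>+x. slope_bound * ennreal (exp (- (a * t))) \<partial>M)"
    unfolding drift_def by (intro nn_integral_mono drift_integrand_le t)
  then show ?thesis by (simp add: emeasure_space_1)
qed

text \<open>The exponential cut-off of \<open>w\<close> reappears, through \<open>drift_le\<close>,
  as an integrable majorant in time.\<close>

lemma drift_integral_tendsto:
  assumes t0: "0 \<le> t0" and A: "A \<in> sets M"
  shows "(\<lambda>n. \<integral>\<^sup>+t\<in>{t0..}. drift A n t \<partial>lborel) \<longlonglongrightarrow> tail_integral (\<lambda>s x. \<theta> * w s x * Z s x powr (\<theta> - 1)) t0 A"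
  unfolding tail_integral_def
proof (rule nn_integral_dominated_convergence[where w="\<lambda>t. slope_bound * (ennreal (exp (- (a * t))) * indicator {t0..} t)"])
  show "(\<integral>\<^sup>+ t. slope_bound * (ennreal (exp (- (a * t))) * indicator {t0..} t) \<partial>lborel) < \<infinity>"
    using nn_integral_exp_tail[OF a(1), of t0] by (subst nn_integral_cmult) (auto simp: ennreal_mult_less_top)
  have "drift A n t * indicator {t0..} t \<le> slope_bound * (ennreal (exp (- (a * t))) * indicator {t0..} t)" for n t
    using drift_le[of t A n] t0 by (auto split: split_indicator)
  then show "AE t in lborel. drift A n t * indicator {t0..} t \<le> slope_bound * (ennreal (exp (- (a * t))) * indicator {t0..} t)" for n
    by simp
  have lim: "(\<lambda>n. drift A n t * indicator {t0..} t) \<longlonglongrightarrow> nnint A (\<lambda>x. \<theta> * w t x * Z t x powr (\<theta> - 1)) * indicator {t0..} t" for t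
    using drift_tendsto[OF _ A, of t] t0 by (auto split: split_indicator)
  then show "AE t in lborel. (\<lambda>n. drift A n t * indicator {t0..} t) \<longlonglongrightarrow> nnint A (\<lambda>x. \<theta> * w t x * Z t x powr (\<theta> - 1)) * indicator {t0..} t"
    by simp
  show "(\<lambda>t. nnint A (\<lambda>x. \<theta> * w t x * Z t x powr (\<theta> - 1)) * indicator {t0..} t) \<in> borel_measurable lborel"
    by (intro tail_integral_measurable[OF _ t0 A] progressive_mult progressive_const w progressive_powr representsD(1)[OF Z])
qed (use drift_measurable[OF t0 A] in auto)

lemma Zpow_progressive: "progressive M F (\<lambda>t x. Z t x powr \<theta>)"
  by (intro progressive_powr representsD(1)[OF Z])

lemma moment_measurable:
  "0 \<le> t0 \<Longrightarrow> A \<in> sets M \<Longrightarrow> (\<lambda>t. moment A t * indicator {t0..} t) \<in> borel_measurable lborel"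
  unfolding moment_def by (rule tail_integral_measurable[OF Zpow_progressive])

text \<open>One factor \<open>Z t x\<close> of the power carries the exponential decay that makes
  \<open>moment\<close> integrable in time; the remaining power is bounded by a constant.\<close>

lemma moment_le:
  assumes t: "0 \<le> t"
  shows "moment A t \<le> ennreal ((1 / a) powr (\<theta> - 1) / a) * ennreal (exp (- (a * t)))"
proof -
  have "moment A t \<le> (\<integral>\<^sup>+x. ennreal ((1 / a) powr (\<theta> - 1) / a) * ennreal (exp (- (a * t))) \<partial>M)"
    unfolding moment_def
  proof (intro nn_integral_mono)
    fix x assume x: "x \<in> space M"
    have "Z t x powr \<theta> = Z t x powr (\<theta> - 1) * Z t x"
      using Z_nn[OF t x] theta_gt_1 by (cases "Z t x = 0") (auto simp: powr_mult_base mult.commute)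
    also have "\<dots> \<le> (1 / a) powr (\<theta> - 1) * (exp (- (a * t)) / a)"
      using Z_nn[OF t x] theta_gt_1 Z_le_const[OF t x] Z_le[OF t x] by (intro mult_mono powr_mono2) auto
    finally have "ennreal (Z t x powr \<theta>) \<le> ennreal ((1 / a) powr (\<theta> - 1) / a * exp (- (a * t)))"
      by (intro ennreal_leI) simp
    then show "ennreal (Z t x powr \<theta>) * indicator A x \<le> ennreal ((1 / a) powr (\<theta> - 1) / a) * ennreal (exp (- (a * t)))"
      using a by (auto split: split_indicator simp: ennreal_mult[symmetric])
  qed
  then show ?thesis by (simp add: emeasure_space_1)
qed

lemma moment_le_const: "0 \<le> t \<Longrightarrow> moment A t \<le> ennreal ((1 / a) powr (\<theta> - 1) / a)"
proof -
  assume t: "0 \<le> t"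
  have "ennreal ((1 / a) powr (\<theta> - 1) / a) * ennreal (exp (- (a * t))) \<le> ennreal ((1 / a) powr (\<theta> - 1) / a) * 1"
    using t a by (intro mult_left_mono) auto
  then show ?thesis using moment_le[OF t, of A] by simp
qed

lemma moment_tendsto:
  assumes t: "0 \<le> t" and A: "A \<in> sets M" and r: "0 \<le> r"
  shows "(\<lambda>n. moment A (t + step n * r)) \<longlonglongrightarrow> moment A t"
  unfolding moment_def
proof (rule nn_integral_dominated_convergence[where w="\<lambda>_. ennreal ((1 / a) powr \<theta>)"])
  have t': "0 \<le> t + step n * r" for n using t r by simp
  note [measurable] = A Z_measurable(2)[OF t] Z_measurable(2)[OF t']
  show "(\<lambda>x. ennreal (Z (t + step n * r) x powr \<theta>) * indicator A x) \<in> borel_measurable M" for n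
    by measurable
  show "(\<lambda>x. ennreal (Z t x powr \<theta>) * indicator A x) \<in> borel_measurable M"
    by measurable
  have "Z (t + step n * r) x powr \<theta> \<le> (1 / a) powr \<theta>" if "x \<in> space M" for x n
    using Z_nn[OF t' that] Z_le_const[OF t' that] theta_gt_1 by (intro powr_mono2) auto
  then show "AE x in M. ennreal (Z (t + step n * r) x powr \<theta>) * indicator A x \<le> ennreal ((1 / a) powr \<theta>)" for n
    by (intro AE_I2) (auto split: split_indicator intro!: ennreal_leI)
  show "AE x in M. (\<lambda>n. ennreal (Z (t + step n * r) x powr \<theta>) * indicator A x) \<longlonglongrightarrow> ennreal (Z t x powr \<theta>) * indicator A x"
    using representsD(2)[OF Z, unfolded cadlag_paths_def] AE_space
  proof eventually_elim
    case (elim x)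
    have "(\<lambda>n. Z (t + step n * r) x) \<longlonglongrightarrow> Z t x"
      using elim t r by (intro continuous_at_right_LIMSEQ[of t "\<lambda>s. Z s x"]) auto
    then have "(\<lambda>n. Z (t + step n * r) x powr \<theta>) \<longlonglongrightarrow> Z t x powr \<theta>"
      using theta_gt_1 Z_nn[OF t' elim(2)] by (intro tendsto_powr' tendsto_const) auto
    from tendsto_ennrealI[OF this] show ?case by (auto split: split_indicator)
  qed
qed (auto simp: emeasure_space_1)

text \<open>Averaging \<open>increment_le\<close> over \<open>t \<ge> t0\<close> instead of summing it over a grid: as the step tends to 0, only
  right-continuity of \<open>Z\<close> and \<open>w\<close> is needed, whereas Riemann sums would produce left limits of \<open>Z\<close>.\<close>

lemma moment_average_le:
  assumes t0: "0 \<le> t0" and A: "A \<in> sets (F t0)"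
  shows "(\<integral>\<^sup>+r\<in>{0..<1}. moment A (t0 + step n * r) \<partial>lborel) \<le> (\<integral>\<^sup>+t\<in>{t0..}. drift A n t \<partial>lborel)"
proof -
  define h where "h = step n"
  have h: "0 < h" by (simp add: h_def)
  note AM = sets_F_M[OF t0 A]
  have t0h: "0 \<le> t0 + h" using t0 h by simp
  have mb: "(\<lambda>t. moment A t * indicator {u..} t) \<in> borel_measurable borel" if "0 \<le> u" for u
    using moment_measurable[OF that AM] by simp
  have db: "(\<lambda>t. drift A n t * indicator {t0..} t) \<in> borel_measurable borel"
    using drift_measurable[OF t0 AM] by simp
  have inc: "moment A t \<le> moment A (t + h) + ennreal h * drift A n t" if t: "t0 \<le> t" for t
  proof -
    have t': "0 \<le> t" using t t0 by simp
    have "(\<integral>\<^sup>+x. slope t x * indicator A x * (\<integral>\<^sup>+s\<in>{t..<t+h}. ennreal (w s x) \<partial>lborel) \<partial>M)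
      = (\<integral>\<^sup>+x. ennreal h * (slope t x * indicator A x * avg n t x) \<partial>M)"
      unfolding h_def by (intro nn_integral_cong) (simp only: integral_eq_avg[OF _ t'] mult_ac)
    also have "\<dots> = ennreal h * drift A n t"
    proof -
      note [measurable] = AM Z_measurable(2)[OF t'] avg_measurable[OF t']
      show ?thesis unfolding drift_def by (intro nn_integral_cmult) measurable
    qed
    finally show ?thesis
      using increment_le[OF t' h sets_F_mono[OF t0 t A]] unfolding moment_def by simp
  qed
  let ?m = "\<lambda>u. \<integral>\<^sup>+t. moment A t * indicator {u..} t \<partial>lborel"
  have shift: "(\<integral>\<^sup>+t. moment A (t + h) * indicator {t0..} t \<partial>lborel) = ?m (t0 + h)"
    by (subst nn_integral_real_affine[OF mb[OF t0h], of 1 h])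
      (auto intro!: nn_integral_cong split: split_indicator simp: add.commute)
  have fin: "?m (t0 + h) < \<infinity>"
  proof -
    have "?m (t0 + h) \<le> (\<integral>\<^sup>+t. ennreal ((1 / a) powr (\<theta> - 1) / a) * (ennreal (exp (- (a * t))) * indicator {t0+h..} t) \<partial>lborel)"
      using moment_le t0h by (intro nn_integral_mono) (auto split: split_indicator)
    also have "\<dots> < \<infinity>"
      using nn_integral_exp_tail[OF a(1), of "t0 + h"] by (subst nn_integral_cmult) (auto simp: ennreal_mult_less_top)
    finally show ?thesis .
  qed
  have m1: "(\<lambda>t. moment A t * indicator {t0..<t0+h} t) \<in> borel_measurable borel"
  proof -
    have "(\<lambda>t. (moment A t * indicator {t0..} t) * indicator {t0..<t0+h} t) \<in> borel_measurable borel"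
      using mb[OF t0] by simp
    then show ?thesis by (rule measurable_cong[THEN iffD1, rotated]) (auto split: split_indicator)
  qed
  have ms: "(\<lambda>t. moment A (t + h) * indicator {t0..} t) \<in> borel_measurable borel"
  proof -
    have "(\<lambda>t. (moment A (t + h) * indicator {t0+h..} (t + h))) \<in> borel_measurable borel"
      by (rule measurable_compose[OF _ mb[OF t0h]]) simp
    then show ?thesis by (rule measurable_cong[THEN iffD1, rotated]) (auto split: split_indicator)
  qed
  \<comment> \<open>The one-step inequality is integrated over \<open>t \<ge> t0\<close>. The
    half-line from \<open>t0 + h\<close> contributes the same finite amount to both sides, and
    cancelling it leaves \<open>moment\<close> over a single step.\<close>
  have "?m (t0 + h) + (\<integral>\<^sup>+t. moment A t * indicator {t0..<t0+h} t \<partial>lborel) = 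
    (\<integral>\<^sup>+t. moment A t * indicator {t0+h..} t + moment A t * indicator {t0..<t0+h} t \<partial>lborel)"
    using mb[OF t0h] m1 by (intro nn_integral_add[symmetric]) auto
  also have "\<dots> = ?m t0"
    using h by (intro nn_integral_cong) (auto split: split_indicator)
  also have "\<dots> \<le> (\<integral>\<^sup>+t. moment A (t + h) * indicator {t0..} t + ennreal h * (drift A n t * indicator {t0..} t) \<partial>lborel)"
    using inc by (intro nn_integral_mono) (auto split: split_indicator)
  also have "\<dots> = ?m (t0 + h) + ennreal h * (\<integral>\<^sup>+t\<in>{t0..}. drift A n t \<partial>lborel)"
  proof (subst nn_integral_add)
    show "(\<integral>\<^sup>+t. moment A (t + h) * indicator {t0..} t \<partial>lborel) + (\<integral>\<^sup>+t. ennreal h * (drift A n t * indicator {t0..} t) \<partial>lborel)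
      = ?m (t0 + h) + ennreal h * (\<integral>\<^sup>+t\<in>{t0..}. drift A n t \<partial>lborel)"
      unfolding shift using db by (subst nn_integral_cmult) auto
  qed (use ms db in auto)
  finally have "(\<integral>\<^sup>+t. moment A t * indicator {t0..<t0+h} t \<partial>lborel) \<le> ennreal h * (\<integral>\<^sup>+t\<in>{t0..}. drift A n t \<partial>lborel)"
    unfolding ennreal_add_left_cancel_le using less_imp_neq[OF fin] by simp
  moreover have "(\<integral>\<^sup>+t. moment A t * indicator {t0..<t0+h} t \<partial>lborel)
     = ennreal h * (\<integral>\<^sup>+r\<in>{0..<1}. moment A (t0 + h * r) \<partial>lborel)"
  proof -
    show ?thesis
      using nn_integral_real_affine[OF m1, of h t0] h unfolding indicator_affine[OF h] by simp
  qed
  ultimately show ?thesis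
    using h unfolding h_def by (simp add: ennreal_mult_le_mult_iff)
qed

text \<open>As the step tends to 0 in \<open>moment_average_le\<close>, the mean of
  \<open>moment\<close> just after \<open>t0\<close> tends to its value at
  \<open>t0\<close>.\<close>

lemma subsolution:
  assumes t0: "0 \<le> t0" and A: "A \<in> sets (F t0)"
  shows "nnint A (\<lambda>x. Z t0 x powr \<theta>) \<le> tail_integral (\<lambda>s x. \<theta> * w s x * Z s x powr (\<theta> - 1)) t0 A"
proof -
  note AM = sets_F_M[OF t0 A]
  have "(\<lambda>n. \<integral>\<^sup>+r\<in>{0..<1}. moment A (t0 + step n * r) \<partial>lborel) \<longlonglongrightarrow> (\<integral>\<^sup>+r\<in>{0..<1}. moment A t0 \<partial>(lborel :: real measure))"
  proof (rule nn_integral_dominated_convergence[where w="\<lambda>r. ennreal ((1 / a) powr (\<theta> - 1) / a) * indicator {0..<1} r"])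
    show "(\<lambda>r. moment A (t0 + step n * r) * indicator {0..<1} r) \<in> borel_measurable lborel" for n
    proof -
      have 1: "(\<lambda>r. t0 + step n * r) \<in> borel_measurable borel" by measurable
      have "(\<lambda>r. (moment A (t0 + step n * r) * indicator {t0..} (t0 + step n * r)) * indicator {0..<1} r) \<in> borel_measurable borel"
        using measurable_compose[OF 1, of "\<lambda>t. moment A t * indicator {t0..} t"] moment_measurable[OF t0 AM] by simp
      then show ?thesis
        unfolding measurable_lborel2 by (rule measurable_cong[THEN iffD1, rotated]) (auto split: split_indicator)
    qed
    show "AE r in lborel. moment A (t0 + step n * r) * indicator {0..<1} r \<le> ennreal ((1 / a) powr (\<theta> - 1) / a) * indicator {0..<1} r" for n
      using moment_le_const[of "t0 + step n * _" A] t0 by (intro AE_I2) (auto split: split_indicator)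
    show "AE r in lborel. (\<lambda>n. moment A (t0 + step n * r) * indicator {0..<1} r) \<longlonglongrightarrow> moment A t0 * indicator {0..<1} r"
      using moment_tendsto[OF t0 AM] by (intro AE_I2) (auto split: split_indicator)
  qed (auto simp: nn_integral_cmult_indicator ennreal_mult_less_top)
  then have "(\<lambda>n. \<integral>\<^sup>+r\<in>{0..<1}. moment A (t0 + step n * r) \<partial>lborel) \<longlonglongrightarrow> moment A t0"
    by (simp add: nn_integral_cmult_indicator)
  from LIMSEQ_le[OF this drift_integral_tendsto[OF t0 AM]] moment_average_le[OF assms]
  show ?thesis unfolding moment_def by blast
qed

end
end

section \<open>Comparison and identification of potentials\<close>

context filtered_prob
begin

lemma nn_integral_process_finite:
  assumes V: "represents V g" and g: "progressive M F g" and fin: "tail_integral g 0 (space M) < \<infinity>" and t: "0 \<le> t"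
  shows "(\<integral>\<^sup>+x. ennreal (V t x) \<partial>M) < \<infinity>"
proof -
  have "(\<integral>\<^sup>+x. ennreal (V t x) \<partial>M) = nnint (space M) (V t)"
    by (intro nn_integral_cong) auto
  also have "\<dots> = tail_integral g t (space M)"
    using representsD(4)[OF V t, of "space M"] space_F[OF t] sets.top[of "F t"] by simp
  also have "\<dots> \<le> tail_integral g 0 (space M)"
    unfolding tail_integral_def using t by (intro nn_integral_mono) (auto split: split_indicator)
  finally show ?thesis using fin by (rule order.strict_trans1)
qed

lemma represents_le:
  assumes V: "represents V g" and g: "progressive M F g" and fin: "tail_integral g 0 (space M) < \<infinity>" and t: "0 \<le> t"
    and X: "X \<in> borel_measurable (F t)"
    and le: "\<And>A. A \<in> sets (F t) \<Longrightarrow> tail_integral g t A \<le> (\<integral>\<^sup>+x\<in>A. X x \<partial>M)"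
  shows "AE x in M. ennreal (V t x) \<le> X x"
proof (rule AE_le_of_nn_integral_le[OF subalg[OF t] _ X nn_integral_process_finite[OF V g fin t]])
  show "(\<lambda>x. ennreal (V t x)) \<in> borel_measurable (F t)"
    using progressive_adapted[OF representsD(1)[OF V] t] by simp
  show "nnint A (V t) \<le> (\<integral>\<^sup>+x\<in>A. X x \<partial>M)" if "A \<in> sets (F t)" for A
    using le[OF that] representsD(4)[OF V t that] by simp
qed

lemma represents_mono:
  assumes V: "represents V g" and V': "represents V' g'" and g: "progressive M F g"
    and fin: "tail_integral g 0 (space M) < \<infinity>" and t: "0 \<le> t"
    and le: "\<And>s. t \<le> s \<Longrightarrow> AE x in M. g s x \<le> g' s x"
  shows "AE x in M. V t x \<le> V' t x"
proof -
  have "AE x in M. ennreal (V t x) \<le> ennreal (V' t x)"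
  proof (rule represents_le[OF V g fin t])
    show "(\<lambda>x. ennreal (V' t x)) \<in> borel_measurable (F t)"
      using progressive_adapted[OF representsD(1)[OF V'] t] by simp
    show "tail_integral g t A \<le> nnint A (V' t)" if "A \<in> sets (F t)" for A
      using tail_integral_mono[OF t le] representsD(4)[OF V' t that] by simp
  qed
  then show ?thesis using AE_space
    by eventually_elim (use representsD(3)[OF V' t] in \<open>simp add: ennreal_le_iff\<close>)
qed

text \<open>At each time the cut changes \<open>V\<close> on a null set only, so the represented
  tail stays. It turns an almost sure bound into one at all points, the form in which
  \<open>subsolution\<close> takes its bound on \<open>Z\<close>.\<close>

lemma represents_min:
  assumes V: "represents V g" and b: "continuous_on UNIV b" "\<And>t. 0 \<le> t \<Longrightarrow> 0 \<le> b t"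
    and le: "\<And>t. 0 \<le> t \<Longrightarrow> AE x in M. V t x \<le> b t"
  shows "represents (\<lambda>t x. min (V t x) (b t)) g"
  unfolding represents_def
proof (intro conjI allI impI ballI)
  show "progressive M F (\<lambda>t x. min (V t x) (b t))"
    by (intro progressive_min progressive_deterministic representsD(1)[OF V] borel_measurable_continuous_onI b)
  have bc: "(b \<longlongrightarrow> b t) (at t within S)" for t S
    using b(1) by (metis UNIV_I continuous_on_def tendsto_within_subset top_greatest)
  show "cadlag_paths M (\<lambda>t x. min (V t x) (b t))"
    unfolding cadlag_paths_def using representsD(2)[OF V, unfolded cadlag_paths_def]
  proof (eventually_elim, intro allI impI conjI)
    fix x and t :: real
    assume *: "\<forall>t\<ge>0. continuous (at_right t) (\<lambda>s. V s x) \<and> (0 < t \<longrightarrow> (\<exists>l. ((\<lambda>s. V s x) \<longlongrightarrow> l) (at_left t)))" and t: "0 \<le> t"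
    show "continuous (at_right t) (\<lambda>s. min (V s x) (b s))"
      using * t bc unfolding continuous_within by (auto intro!: tendsto_min)
    assume "0 < t"
    then obtain l where "((\<lambda>s. V s x) \<longlongrightarrow> l) (at_left t)" using * t by blast
    then show "\<exists>l. ((\<lambda>s. min (V s x) (b s)) \<longlongrightarrow> l) (at_left t)"
      using bc by (intro exI[of _ "min l (b t)"] tendsto_min)
  qed
next
  fix t :: real and x assume "0 \<le> t" "x \<in> space M"
  then show "0 \<le> min (V t x) (b t)" using representsD(3)[OF V] b by simp
next
  fix t :: real and A assume t: "0 \<le> t" and A: "A \<in> sets (F t)"
  have "nnint A (\<lambda>x. min (V t x) (b t)) = nnint A (V t)"
    by (rule nn_integral_cong_AE, use le[OF t] in eventually_elim) (simp add: min_absorb1)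
  then show "nnint A (\<lambda>x. min (V t x) (b t)) = tail_integral g t A"
    using representsD(4)[OF V t A] by simp
qed

text \<open>Bridge to the real-valued conditional expectations of the definitions: almost surely the
  tail is finite, and there the real integral agrees with it.\<close>

lemma real_cond_exp_tail:
  assumes pos: "progressive_pos M F g" and fin: "tail_integral g 0 (space M) < \<infinity>" and t: "0 \<le> t"
  shows "integrable M (\<lambda>x. set_lebesgue_integral lborel {t..} (\<lambda>s. g s x))"
    and "AE x in M. 0 \<le> real_cond_exp M (F t) (\<lambda>x. set_lebesgue_integral lborel {t..} (\<lambda>s. g s x)) x"
    and "A \<in> sets (F t) \<Longrightarrow> nnint A (\<lambda>x. real_cond_exp M (F t) (\<lambda>x. set_lebesgue_integral lborel {t..} (\<lambda>s. g s x)) x) = tail_integral g t A"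
proof -
  have g: "progressive M F g" and nn: "\<And>t x. 0 \<le> t \<Longrightarrow> x \<in> space M \<Longrightarrow> 0 \<le> g t x"
    using pos by (auto simp: progressive_pos_def)
  interpret sub: sigma_finite_subalgebra M "F t" by (rule F_subalgebra[OF t])
  let ?H = "\<lambda>x. set_lebesgue_integral lborel {t..} (\<lambda>s. g s x)"
  let ?D = "\<lambda>x. tail g t x"
  note D = tail_measurable[OF g t]
  have Hm: "?H \<in> borel_measurable M"
  proof -
    note progressive_joint[OF g, measurable]
    have "(\<lambda>p. indicator {t..} (fst p) *\<^sub>R (indicator {0..} (fst p) * g (fst p) (snd p))) \<in> borel_measurable (lborel \<Otimes>\<^sub>M M)"
      by measurable
    then have "(\<lambda>p. indicator {t..} (fst p) *\<^sub>R g (fst p) (snd p)) \<in> borel_measurable (lborel \<Otimes>\<^sub>M M)"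
      by (rule measurable_cong[THEN iffD1, rotated]) (use t in \<open>auto split: split_indicator\<close>)
    then have "(\<lambda>(x, s). indicator {t..} s *\<^sub>R g s x) \<in> borel_measurable (M \<Otimes>\<^sub>M lborel)"
      by (subst measurable_pair_swap_iff) (simp add: case_prod_beta')
    then show ?thesis unfolding set_lebesgue_integral_def
      by (intro lborel.borel_measurable_lebesgue_integral)
  qed
  have Dint: "(\<integral>\<^sup>+x. ?D x \<partial>M) < \<infinity>"
  proof -
    have "(\<integral>\<^sup>+x. ?D x \<partial>M) = (\<integral>\<^sup>+x\<in>space M. ?D x \<partial>M)" by (intro nn_integral_cong) auto
    also have "\<dots> = tail_integral g t (space M)" by (rule tail_integral_Fubini[OF g t]) simp
    also have "\<dots> \<le> tail_integral g 0 (space M)"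
      unfolding tail_integral_def using t by (intro nn_integral_mono) (auto split: split_indicator)
    finally show ?thesis using fin by (rule order.strict_trans1)
  qed
  have Dfin: "AE x in M. ?D x \<noteq> \<infinity>" using Dint D by (intro nn_integral_PInf_AE) auto
  have HD: "AE x in M. ennreal (?H x) = ?D x"
    using Dfin AE_space
  proof eventually_elim
    case (elim x)
    have m: "(\<lambda>s. indicator {t..} s *\<^sub>R g s x) \<in> borel_measurable lborel"
    proof -
      have "(\<lambda>s. indicator {t..} s *\<^sub>R (indicator {0..} s * g s x)) \<in> borel_measurable lborel"
        using measurable_Pair1[OF progressive_joint[OF g] elim(2)] by simp
      then show ?thesis
        by (rule measurable_cong[THEN iffD1, rotated]) (use t in \<open>auto split: split_indicator\<close>)
    qed
    have eq: "(\<integral>\<^sup>+s. ennreal (indicator {t..} s *\<^sub>R g s x) \<partial>lborel) = ?D x"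
      by (intro nn_integral_cong) (auto split: split_indicator)
    have "integrable lborel (\<lambda>s. indicator {t..} s *\<^sub>R g s x)"
      using m eq elim nn t by (intro integrableI_nonneg) (auto simp: less_top split: split_indicator)
    then show ?case unfolding set_lebesgue_integral_def eq[symmetric]
      using nn elim t by (intro nn_integral_eq_integral[symmetric]) (auto split: split_indicator)
  qed
  have Hnn: "AE x in M. 0 \<le> ?H x"
    using AE_space unfolding set_lebesgue_integral_def
    by eventually_elim (use nn t in \<open>auto intro!: Bochner_Integration.integral_nonneg split: split_indicator\<close>)
  show int: "integrable M ?H"
    using Hm Hnn nn_integral_cong_AE[OF HD] Dint by (intro integrableI_nonneg) auto
  show "AE x in M. 0 \<le> real_cond_exp M (F t) ?H x"
    using sub.real_cond_exp_pos[OF Hnn Hm] .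
  show "nnint A (real_cond_exp M (F t) ?H) = tail_integral g t A" if A: "A \<in> sets (F t)"
  proof -
    have "nnint A (real_cond_exp M (F t) ?H) = nnint A ?H"
      by (rule sub.nn_integral_real_cond_exp[OF int Hnn A])
    also have "\<dots> = (\<integral>\<^sup>+x\<in>A. ?D x \<partial>M)"
      by (rule nn_integral_cong_AE, use HD in eventually_elim) simp
    also have "\<dots> = tail_integral g t A" by (rule tail_integral_Fubini[OF g t sets_F_M[OF t A]])
    finally show ?thesis .
  qed
qed

text \<open>Two nonnegative \<open>F t\<close>-measurable variables with equal finite integrals over
  all events of \<open>F t\<close> coincide almost surely.\<close>

lemma represents_real_cond_exp:
  assumes V: "represents V g" and pos: "progressive_pos M F g"
    and fin: "tail_integral g 0 (space M) < \<infinity>" and t: "0 \<le> t"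
  shows "AE x in M. V t x = real_cond_exp M (F t) (\<lambda>x. set_lebesgue_integral lborel {t..} (\<lambda>s. g s x)) x"
proof -
  let ?E = "real_cond_exp M (F t) (\<lambda>x. set_lebesgue_integral lborel {t..} (\<lambda>s. g s x))"
  have g: "progressive M F g" using pos by (simp add: progressive_pos_def)
  note E = real_cond_exp_tail[OF pos fin t]
  have m: "(\<lambda>x. ennreal (?E x)) \<in> borel_measurable (F t)" by simp
  have 1: "AE x in M. ennreal (V t x) \<le> ennreal (?E x)"
    using E(3) by (intro represents_le[OF V g fin t m]) simp
  have Vm: "(\<lambda>x. ennreal (V t x)) \<in> borel_measurable (F t)"
    using progressive_adapted[OF representsD(1)[OF V] t] by simp
  have eq: "nnint A ?E = nnint A (V t)" if "A \<in> sets (F t)" for A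
    using E(3)[OF that] representsD(4)[OF V t that] by simp
  have "(\<integral>\<^sup>+x. ennreal (?E x) \<partial>M) = nnint (space M) ?E" by (intro nn_integral_cong) auto
  also have "\<dots> = nnint (space M) (V t)"
    using eq[of "space M"] space_F[OF t] sets.top[of "F t"] by simp
  also have "\<dots> = (\<integral>\<^sup>+x. ennreal (V t x) \<partial>M)" by (intro nn_integral_cong) auto
  also have "\<dots> < \<infinity>" by (rule nn_integral_process_finite[OF V g fin t])
  finally have 2: "AE x in M. ennreal (?E x) \<le> ennreal (V t x)"
    using eq by (intro AE_le_of_nn_integral_le[OF subalg[OF t] m Vm]) auto
  show ?thesis using 1 2 E(2) AE_space
    by eventually_elim (use representsD(3)[OF V t] in \<open>auto simp: ennreal_le_iff\<close>)
qed

text \<open>Monotone convergence twice, over the probability space at fixed time and then over time;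
  the exceptional null set may depend on the time.\<close>

lemma tail_integral_monotone_convergence:
  assumes g: "\<And>n. progressive M F (g n)" and t: "0 \<le> t" and A: "A \<in> sets M"
    and mono: "\<And>n s. t \<le> s \<Longrightarrow> AE x in M. g n s x \<le> g (Suc n) s x"
    and lim: "\<And>s. t \<le> s \<Longrightarrow> AE x in M. (\<lambda>n. g n s x) \<longlonglongrightarrow> h s x"
  shows "tail_integral h t A = (SUP n. tail_integral (g n) t A)"
proof -
  let ?I = "\<lambda>n s. nnint A (g n s)"
  have inner: "nnint A (h s) = (SUP n. ?I n s)" if s: "t \<le> s" for s
  proof -
    have s0: "0 \<le> s" using s t by simp
    note [measurable] = progressive_M[OF g s0] A
    have "AE x in M. \<forall>n. g n s x \<le> g (Suc n) s x"
      unfolding AE_all_countable using mono[OF s] by blast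
    with lim[OF s] have "AE x in M. ennreal (h s x) * indicator A x = (SUP n. ennreal (g n s x) * indicator A x)"
    proof eventually_elim
      case (elim x)
      have "incseq (\<lambda>n. ennreal (g n s x))" using elim(2) by (intro incseq_SucI ennreal_leI) auto
      from LIMSEQ_unique[OF LIMSEQ_SUP[OF this] tendsto_ennrealI[OF elim(1)]]
      show ?case by (cases "x \<in> A") auto
    qed
    then have "nnint A (h s) = (\<integral>\<^sup>+x. (SUP n. ennreal (g n s x) * indicator A x) \<partial>M)"
      by (rule nn_integral_cong_AE)
    also have "\<dots> = (SUP n. ?I n s)"
    proof (rule nn_integral_monotone_convergence_SUP_AE)
      show "AE x in M. ennreal (g n s x) * indicator A x \<le> ennreal (g (Suc n) s x) * indicator A x" for n
        using mono[OF s, of n] by eventually_elim (auto split: split_indicator intro!: ennreal_leI)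
    qed measurable
    finally show ?thesis .
  qed
  have "tail_integral h t A = (\<integral>\<^sup>+s. (SUP n. ?I n s * indicator {t..} s) \<partial>lborel)"
    unfolding tail_integral_def
  proof (intro nn_integral_cong)
    fix s :: real
    show "nnint A (h s) * indicator {t..} s = (SUP n. ?I n s * indicator {t..} s)"
      using inner[of s] by (cases "t \<le> s") auto
  qed
  also have "\<dots> = (SUP n. tail_integral (g n) t A)"
    unfolding tail_integral_def
  proof (rule nn_integral_monotone_convergence_SUP_AE)
    have "?I n s * indicator {t..} s \<le> ?I (Suc n) s * indicator {t..} s" for n s
    proof (cases "t \<le> s")
      case True
      have "?I n s \<le> ?I (Suc n) s"
      proof (rule nn_integral_mono_AE)
        show "AE x in M. ennreal (g n s x) * indicator A x \<le> ennreal (g (Suc n) s x) * indicator A x"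
          using mono[OF True, of n] by eventually_elim (auto split: split_indicator intro!: ennreal_leI)
      qed
      then show ?thesis using True by simp
    qed simp
    then show "AE s in lborel. ?I n s * indicator {t..} s \<le> ?I (Suc n) s * indicator {t..} s" for n
      by simp
  qed (rule tail_integral_measurable[OF g t A])
  finally show ?thesis .
qed

lemma nn_integral_const_set: "A \<in> sets M \<Longrightarrow> (\<integral>\<^sup>+x\<in>A. k \<partial>M) = k * emeasure M A"
  by (rule nn_integral_cmult_indicator)

lemma nn_integral_cmult_process:
  assumes X: "X \<in> borel_measurable M" and A: "A \<in> sets M" and k: "0 \<le> k"
  shows "nnint A (\<lambda>x. k * X x) = ennreal k * nnint A X"
proof -
  note [measurable] = X A
  have "nnint A (\<lambda>x. k * X x) = (\<integral>\<^sup>+x. ennreal k * (ennreal (X x) * indicator A x) \<partial>M)"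
    using k by (intro nn_integral_cong) (auto simp: ennreal_mult' split: split_indicator)
  also have "\<dots> = ennreal k * nnint A X"
    by (intro nn_integral_cmult) measurable
  finally show ?thesis .
qed

lemma tail_integral_cmult:
  assumes g: "progressive M F g" and t: "0 \<le> t" and A: "A \<in> sets M" and k: "0 \<le> k"
  shows "tail_integral (\<lambda>s x. k * g s x) t A = ennreal k * tail_integral g t A"
proof -
  have "tail_integral (\<lambda>s x. k * g s x) t A
    = (\<integral>\<^sup>+s. ennreal k * (nnint A (g s) * indicator {t..} s) \<partial>lborel)"
    unfolding tail_integral_def using t nn_integral_cmult_process[OF progressive_M[OF g] A k]
    by (intro nn_integral_cong) (auto split: split_indicator)
  also have "\<dots> = ennreal k * tail_integral g t A"
    unfolding tail_integral_def by (intro nn_integral_cmult tail_integral_measurable[OF g t A])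
  finally show ?thesis .
qed

text \<open>The constant in the last claim is 1/k with \<open>k\<close> from \<open>SO\<close>: the
  bound \<open>k * Jproc M F Y t x \<le> Y t x\<close> is integrated over events of
  \<open>F t\<close>.\<close>

lemma SO_D:
  assumes "Y \<in> SO M F"
  shows "progressive M F Y" "0 \<le> t \<Longrightarrow> x \<in> space M \<Longrightarrow> 0 < Y t x" "tail_integral Y 0 (space M) < \<infinity>"
    "\<exists>c>0. \<forall>t\<ge>0. \<forall>A\<in>sets (F t). tail_integral Y t A \<le> ennreal c * nnint A (Y t)"
proof -
  show prog: "progressive M F Y" using assms by (auto simp: SO_def progressive_strict_pos_def)
  have pos: "0 < Y t x" if "0 \<le> t" "x \<in> space M" for t x
    using assms that by (auto simp: SO_def progressive_strict_pos_def)
  then show "0 \<le> t \<Longrightarrow> x \<in> space M \<Longrightarrow> 0 < Y t x" .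
  have "(\<integral>\<^sup>+x. tail Y 0 x \<partial>M) < \<infinity>" using assms by (simp add: SO_def)
  moreover have "(\<integral>\<^sup>+x. tail Y 0 x \<partial>M) = tail_integral Y 0 (space M)"
    unfolding tail_integral_Fubini[OF prog order.refl sets.top, symmetric] by (intro nn_integral_cong) auto
  ultimately show fin: "tail_integral Y 0 (space M) < \<infinity>" by simp
  have pp: "progressive_pos M F Y"
    using prog pos unfolding progressive_pos_def by (auto intro: less_imp_le)
  obtain k where k: "0 < k" "\<And>t. 0 \<le> t \<Longrightarrow> AE x in M. k * Jproc M F Y t x \<le> Y t x"
    using assms unfolding SO_def by fastforce
  have "tail_integral Y t A \<le> ennreal (1 / k) * nnint A (Y t)" if t: "0 \<le> t" and A: "A \<in> sets (F t)" for t A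
  proof -
    note [measurable] = sets_F_M[OF t A] progressive_M[OF prog t]
    have "tail_integral Y t A = nnint A (Jproc M F Y t)"
      unfolding Jproc_def using real_cond_exp_tail(3)[OF pp fin t A] by simp
    also have "\<dots> \<le> (\<integral>\<^sup>+x. ennreal (1 / k) * (ennreal (Y t x) * indicator A x) \<partial>M)"
    proof (rule nn_integral_mono_AE, use k(2)[OF t] AE_space in eventually_elim)
      case (elim x)
      have "ennreal (Jproc M F Y t x) \<le> ennreal (1 / k * Y t x)"
        using elim k(1) by (intro ennreal_leI) (simp add: field_simps)
      then show ?case using k(1) pos[OF t elim(2)] by (auto split: split_indicator simp: ennreal_mult[symmetric])
    qed
    also have "\<dots> = ennreal (1 / k) * nnint A (Y t)"
      by (intro nn_integral_cmult) measurable
    finally show ?thesis .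
  qed
  then show "\<exists>c>0. \<forall>t\<ge>0. \<forall>A\<in>sets (F t). tail_integral Y t A \<le> ennreal c * nnint A (Y t)"
    using k(1) by (intro exI[of _ "1 / k"]) auto
qed

end

section \<open>Monotone iteration\<close>

context filtered_prob
begin

context
  fixes u Y :: "real \<Rightarrow> 'a \<Rightarrow> real" and a \<theta> :: real
  assumes u: "progressive M F u" and u_nn: "\<And>s x. 0 \<le> s \<Longrightarrow> x \<in> space M \<Longrightarrow> 0 \<le> u s x"
    and u_rc: "AE x in M. \<forall>t\<ge>0. continuous (at_right t) (\<lambda>s. u s x)"
    and a: "0 < a" "a < 1" and \<theta>: "\<theta> = 1 / a"
    and Y: "Y \<in> SO M F" and u_le: "\<And>s x. 0 \<le> s \<Longrightarrow> x \<in> space M \<Longrightarrow> u s x \<le> Y s x powr a"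
begin

definition driver :: "(real \<Rightarrow> 'a \<Rightarrow> real) \<Rightarrow> real \<Rightarrow> 'a \<Rightarrow> real" where
  "driver W s x = \<theta> * u s x * W s x powr (1 - a)"

definition truncated :: "real \<Rightarrow> 'a \<Rightarrow> real" where
  "truncated s x = min (u s x) (exp (- (a * s)))"

text \<open>The term \<open>exp (- s)\<close> lets a multiple of the supersolution lie above the subsolution.\<close>

definition dominating :: "real \<Rightarrow> 'a \<Rightarrow> real" where
  "dominating s x = Y s x + exp (- s)"

lemma theta_pos: "1 < \<theta>" "0 < \<theta>"
  using a \<theta> by simp_all

lemma progressive_driver: "progressive M F W \<Longrightarrow> progressive M F (driver W)"
  unfolding driver_def by (intro progressive_mult progressive_const progressive_powr u)

lemma driver_nn: "0 \<le> s \<Longrightarrow> x \<in> space M \<Longrightarrow> 0 \<le> driver W s x"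
  unfolding driver_def using u_nn theta_pos by simp

lemma driver_mono:
  "0 \<le> s \<Longrightarrow> x \<in> space M \<Longrightarrow> 0 \<le> W s x \<Longrightarrow> W s x \<le> W' s x \<Longrightarrow> driver W s x \<le> driver W' s x"
  unfolding driver_def using u_nn[of s x] theta_pos a by (intro mult_left_mono powr_mono2) auto

lemma truncated:
  "progressive M F truncated"
  "0 \<le> s \<Longrightarrow> x \<in> space M \<Longrightarrow> 0 \<le> truncated s x"
  "truncated s x \<le> exp (- (a * s))" "truncated s x \<le> u s x"
  "AE x in M. \<forall>t\<ge>0. continuous (at_right t) (\<lambda>s. truncated s x)"
proof -
  show "progressive M F truncated"
    unfolding truncated_def
    by (intro progressive_min u progressive_deterministic borel_measurable_continuous_onI continuous_intros)
  show "AE x in M. \<forall>t\<ge>0. continuous (at_right t) (\<lambda>s. truncated s x)"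
    unfolding truncated_def using u_rc by eventually_elim (auto intro!: continuous_intros)
qed (use u_nn in \<open>auto simp: truncated_def\<close>)

lemma tail_integral_truncated_le:
  assumes t: "0 \<le> t" and A: "A \<in> sets M"
  shows "tail_integral truncated t A \<le> (\<integral>\<^sup>+x\<in>A. ennreal (exp (- (a * t)) / a) \<partial>M)"
proof -
  have "tail_integral truncated t A \<le> tail_integral (\<lambda>s x. exp (- (a * s))) t A"
    by (rule tail_integral_mono[OF t]) (use truncated(3) in auto)
  also have "\<dots> = (\<integral>\<^sup>+s. emeasure M A * (ennreal (exp (- (a * s))) * indicator {t..} s) \<partial>lborel)"
    unfolding tail_integral_def nn_integral_const_set[OF A] by (simp only: mult_ac)
  also have "\<dots> = emeasure M A * ennreal (exp (- (a * t)) / a)"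
    using nn_integral_exp_tail[OF a(1), of t] by (subst nn_integral_cmult) auto
  finally show ?thesis unfolding nn_integral_const_set[OF A] by (simp only: mult.commute)
qed

lemma tail_integral_truncated_finite: "tail_integral truncated 0 (space M) < \<infinity>"
proof -
  have "tail_integral truncated 0 (space M) \<le> (\<integral>\<^sup>+x\<in>space M. ennreal (exp (- (a * 0)) / a) \<partial>M)"
    by (rule tail_integral_truncated_le) auto
  also have "\<dots> < \<infinity>" by (simp add: nn_integral_cmult_indicator emeasure_space_1)
  finally show ?thesis .
qed

lemma exists_truncated_representation:
  "\<exists>Z. represents Z truncated \<and> (\<forall>t\<ge>0. \<forall>x\<in>space M. Z t x \<le> exp (- (a * t)) / a)"
proof -
  obtain Z where Z: "represents Z truncated"
    using exists_representation[OF truncated(1,2) tail_integral_truncated_finite] by auto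
  have le: "AE x in M. Z t x \<le> exp (- (a * t)) / a" if t: "0 \<le> t" for t
  proof -
    have "AE x in M. ennreal (Z t x) \<le> ennreal (exp (- (a * t)) / a)"
      using tail_integral_truncated_le[OF t sets_F_M[OF t]]
      by (intro represents_le[OF Z truncated(1) tail_integral_truncated_finite t]) auto
    then show ?thesis by eventually_elim (use a in \<open>simp add: ennreal_le_iff\<close>)
  qed
  have "represents (\<lambda>t x. min (Z t x) (exp (- (a * t)) / a)) truncated"
    by (rule represents_min[OF Z _ _ le]) (use a in \<open>auto intro!: continuous_intros\<close>)
  then show ?thesis by fastforce
qed

lemma dominating_ge: "0 \<le> s \<Longrightarrow> x \<in> space M \<Longrightarrow> exp (- s) \<le> dominating s x" "Y s x \<le> dominating s x"
  using SO_D(2)[OF Y, of s x] by (auto simp: dominating_def)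

lemma progressive_dominating: "progressive M F dominating"
proof -
  have "progressive M F (\<lambda>t x. exp (- t))"
    by (intro progressive_deterministic borel_measurable_continuous_onI continuous_intros)
  then show ?thesis using SO_D(1)[OF Y] unfolding dominating_def progressive_def case_prod_beta
    by (auto intro!: borel_measurable_add)
qed

lemma tail_integral_dominating_split:
  assumes t: "0 \<le> t" and A: "A \<in> sets M"
  shows "tail_integral dominating t A = tail_integral Y t A + (\<integral>\<^sup>+x\<in>A. ennreal (exp (- t)) \<partial>M)"
    and "nnint A (dominating t) = nnint A (Y t) + (\<integral>\<^sup>+x\<in>A. ennreal (exp (- t)) \<partial>M)"
proof -
  note A[measurable]
  have ex: "progressive M F (\<lambda>t x. exp (- t))"
    by (intro progressive_deterministic borel_measurable_continuous_onI continuous_intros)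
  have split: "nnint A (dominating s) = nnint A (Y s) + (\<integral>\<^sup>+x\<in>A. ennreal (exp (- s)) \<partial>M)"
    if "0 \<le> s" for s
  proof -
    note [measurable] = progressive_M[OF SO_D(1)[OF Y] that]
    have "nnint A (dominating s) = (\<integral>\<^sup>+x. ennreal (Y s x) * indicator A x + ennreal (exp (- s)) * indicator A x \<partial>M)"
      unfolding dominating_def using SO_D(2)[OF Y that]
      by (intro nn_integral_cong) (auto simp: ennreal_plus less_imp_le split: split_indicator)
    also have "\<dots> = nnint A (Y s) + (\<integral>\<^sup>+x\<in>A. ennreal (exp (- s)) \<partial>M)"
      by (intro nn_integral_add) measurable
    finally show ?thesis .
  qed
  then show "nnint A (dominating t) = nnint A (Y t) + (\<integral>\<^sup>+x\<in>A. ennreal (exp (- t)) \<partial>M)"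
    using t by blast
  have "tail_integral dominating t A = (\<integral>\<^sup>+s. nnint A (Y s) * indicator {t..} s + (\<integral>\<^sup>+x\<in>A. ennreal (exp (- s)) \<partial>M) * indicator {t..} s \<partial>lborel)"
    unfolding tail_integral_def using split t by (intro nn_integral_cong) (auto split: split_indicator)
  also have "\<dots> = tail_integral Y t A + tail_integral (\<lambda>s x. exp (- s)) t A"
    unfolding tail_integral_def
    by (intro nn_integral_add tail_integral_measurable[OF SO_D(1)[OF Y] t A] tail_integral_measurable[OF ex t A])
  also have "tail_integral (\<lambda>s x. exp (- s)) t A = (\<integral>\<^sup>+s. emeasure M A * (ennreal (exp (- s)) * indicator {t..} s) \<partial>lborel)"
    unfolding tail_integral_def nn_integral_const_set[OF A] by (simp only: mult_ac)
  also have "\<dots> = (\<integral>\<^sup>+x\<in>A. ennreal (exp (- t)) \<partial>M)"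
    using nn_integral_exp_tail[of 1 t] unfolding nn_integral_const_set[OF A]
    by (subst nn_integral_cmult) (auto simp: mult.commute)
  finally show "tail_integral dominating t A = tail_integral Y t A + (\<integral>\<^sup>+x\<in>A. ennreal (exp (- t)) \<partial>M)" .
qed

lemma tail_integral_dominating_finite: "tail_integral dominating 0 (space M) < \<infinity>"
  using SO_D(3)[OF Y] nn_integral_const_set[OF sets.top]
  unfolding tail_integral_dominating_split(1)[OF order.refl sets.top] by (simp add: emeasure_space_1)

text \<open>The exponential term equals its own tail integral, so it satisfies the bound with
  constant 1; hence the maximum with 1.\<close>

lemma tail_integral_dominating_le:
  "\<exists>c\<ge>1. \<forall>t\<ge>0. \<forall>A\<in>sets (F t). tail_integral dominating t A \<le> ennreal c * nnint A (dominating t)"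
proof -
  obtain c0 where c0: "0 < c0" "\<And>t A. 0 \<le> t \<Longrightarrow> A \<in> sets (F t) \<Longrightarrow> tail_integral Y t A \<le> ennreal c0 * nnint A (Y t)"
    using SO_D(4)[OF Y] by blast
  define c where "c = max c0 1"
  have "tail_integral dominating t A \<le> ennreal c * nnint A (dominating t)" if t: "0 \<le> t" and A: "A \<in> sets (F t)" for t A
    unfolding tail_integral_dominating_split[OF t sets_F_M[OF t A]] distrib_left
  proof (rule add_mono)
    have "ennreal c0 * nnint A (Y t) \<le> ennreal c * nnint A (Y t)"
      unfolding c_def by (intro mult_right_mono ennreal_leI) auto
    with c0(2)[OF t A] show "tail_integral Y t A \<le> ennreal c * nnint A (Y t)" by (rule order.trans)
    have "1 * (\<integral>\<^sup>+x\<in>A. ennreal (exp (- t)) \<partial>M) \<le> ennreal c * (\<integral>\<^sup>+x\<in>A. ennreal (exp (- t)) \<partial>M)"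
      unfolding c_def by (intro mult_right_mono) auto
    then show "(\<integral>\<^sup>+x\<in>A. ennreal (exp (- t)) \<partial>M) \<le> ennreal c * (\<integral>\<^sup>+x\<in>A. ennreal (exp (- t)) \<partial>M)" by simp
  qed
  then show ?thesis unfolding c_def by (intro exI[of _ "max c0 1"]) auto
qed

text \<open>The exponents \<open>a\<close> from \<open>u\<close> and \<open>1 - a\<close> from the
  driver add up to 1, so the bound is linear in \<open>dominating\<close>, while \<open>K\<close>
  enters only with the power \<open>1 - a\<close>.\<close>

lemma driver_dominating:
  assumes s: "0 \<le> s" and x: "x \<in> space M" and K: "0 \<le> K" and W: "0 \<le> W s x" "W s x \<le> K * dominating s x"
  shows "driver W s x \<le> \<theta> * K powr (1 - a) * dominating s x"
proof -
  have d: "0 < dominating s x" using dominating_ge(1)[OF s x] exp_gt_zero[of "- s"] by linarith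
  have "u s x \<le> dominating s x powr a"
    using u_le[OF s x] powr_mono2[of a "Y s x" "dominating s x"] dominating_ge(2)[of s x] SO_D(2)[OF Y s x] a by simp
  then have "driver W s x \<le> \<theta> * dominating s x powr a * (K * dominating s x) powr (1 - a)"
    unfolding driver_def using theta_pos a W u_nn[OF s x] d by (intro mult_mono mult_left_mono powr_mono2) auto
  also have "\<dots> = \<theta> * K powr (1 - a) * (dominating s x powr a * dominating s x powr (1 - a))"
    using K d by (simp add: powr_mult)
  also have "dominating s x powr a * dominating s x powr (1 - a) = dominating s x"
    using d by (simp flip: powr_add)
  finally show ?thesis .
qed

lemma dominating_nonneg: "0 \<le> s \<Longrightarrow> x \<in> space M \<Longrightarrow> 0 \<le> dominating s x"
  using dominating_ge(1)[of s x] exp_gt_zero[of "- s"] by linarith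

lemma tail_integral_driver_le:
  assumes t: "0 \<le> t" and A: "A \<in> sets M" and K: "0 \<le> K"
    and W: "\<And>s. t \<le> s \<Longrightarrow> AE x in M. 0 \<le> W s x \<and> W s x \<le> K * dominating s x"
  shows "tail_integral (driver W) t A \<le> ennreal (\<theta> * K powr (1 - a)) * tail_integral dominating t A"
proof -
  let ?k = "\<theta> * K powr (1 - a)"
  have k: "0 \<le> ?k" using theta_pos by simp
  have "tail_integral (driver W) t A \<le> tail_integral (\<lambda>s x. ?k * dominating s x) t A"
  proof (rule tail_integral_mono[OF t])
    fix s assume s: "t \<le> s"
    show "AE x in M. driver W s x \<le> ?k * dominating s x"
      using W[OF s] AE_space by eventually_elim (use s t K in \<open>auto intro!: driver_dominating\<close>)
  qed
  also have "\<dots> = ennreal ?k * tail_integral dominating t A"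
    by (rule tail_integral_cmult[OF progressive_dominating t A k])
  finally show ?thesis .
qed

text \<open>The choice of a cadlag version by \<open>SOME\<close> is meaningful as long as a
  representation of the driver exists, which is established along the iteration.\<close>

definition solution_iterates :: "(real \<Rightarrow> 'a \<Rightarrow> real) \<Rightarrow> nat \<Rightarrow> real \<Rightarrow> 'a \<Rightarrow> real" where
  "solution_iterates W0 = rec_nat W0 (\<lambda>n V. SOME V'. represents V' (driver V))"

text \<open>Monotonicity of the driver propagates the order of the first two iterates, which comes
  from \<open>sub\<close>, while \<open>super\<close> preserves the upper bound. The limit thus
  exists almost surely at each time, and monotone convergence identifies it as a fixed
  point.\<close>

lemma exists_fixed_point_above:
  assumes W0: "progressive M F W0" "\<And>t x. 0 \<le> t \<Longrightarrow> x \<in> space M \<Longrightarrow> 0 \<le> W0 t x"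
    and K: "0 \<le> K" and W0_le: "\<And>t. 0 \<le> t \<Longrightarrow> AE x in M. W0 t x \<le> K * dominating t x"
    and sub: "\<And>t A. 0 \<le> t \<Longrightarrow> A \<in> sets (F t) \<Longrightarrow> nnint A (W0 t) \<le> tail_integral (driver W0) t A"
    and super: "\<And>t A. 0 \<le> t \<Longrightarrow> A \<in> sets (F t) \<Longrightarrow>
      ennreal (\<theta> * K powr (1 - a)) * tail_integral dominating t A \<le> nnint A (\<lambda>x. K * dominating t x)"
  shows "\<exists>W. represents W (driver W) \<and> tail_integral (driver W) 0 (space M) < \<infinity>
     \<and> (\<forall>t\<ge>0. AE x in M. W0 t x \<le> W t x)"
proof -
  define W where "W = solution_iterates W0"
  have W_0: "W 0 = W0" and W_Suc: "W (Suc n) = (SOME V'. represents V' (driver (W n)))" for n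
    by (simp_all add: W_def solution_iterates_def)
  \<comment> \<open>Invariant of the iteration: it makes the tail of the driver finite, so that the
    next iterate exists, and is inherited by that iterate.\<close>
  define dom where "dom V \<longleftrightarrow> progressive M F V \<and> (\<forall>t\<ge>0. \<forall>x\<in>space M. 0 \<le> V t x)
     \<and> (\<forall>t\<ge>0. AE x in M. V t x \<le> K * dominating t x)" for V
  have domD: "progressive M F V" "\<And>t x. 0 \<le> t \<Longrightarrow> x \<in> space M \<Longrightarrow> 0 \<le> V t x"
    "\<And>s. 0 \<le> s \<Longrightarrow> AE x in M. 0 \<le> V s x \<and> V s x \<le> K * dominating s x" if "dom V" for V
  proof -
    show 1: "progressive M F V" "\<And>t x. 0 \<le> t \<Longrightarrow> x \<in> space M \<Longrightarrow> 0 \<le> V t x"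
      using that by (auto simp: dom_def)
    fix s :: real assume s: "0 \<le> s"
    then have "AE x in M. V s x \<le> K * dominating s x" using that by (simp add: dom_def)
    then show "AE x in M. 0 \<le> V s x \<and> V s x \<le> K * dominating s x"
      using AE_space by eventually_elim (use 1 s in auto)
  qed
  have dom_fin: "tail_integral (driver V) 0 (space M) < \<infinity>" if V: "dom V" for V
  proof -
    have "tail_integral (driver V) 0 (space M) \<le> ennreal (\<theta> * K powr (1 - a)) * tail_integral dominating 0 (space M)"
      by (intro tail_integral_driver_le domD(3)[OF V] K) auto
    also have "\<dots> < \<infinity>" using tail_integral_dominating_finite by (simp add: ennreal_mult_less_top)
    finally show ?thesis .
  qed
  have dom_rep: "\<exists>V'. represents V' (driver V)" if V: "dom V" for V
    using exists_representation[OF progressive_driver[OF domD(1)[OF V]] driver_nn dom_fin[OF V]] by auto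
  have dom_step: "dom V'" if V: "dom V" and V': "represents V' (driver V)" for V V'
    unfolding dom_def
  proof (intro conjI allI impI ballI)
    show "progressive M F V'" by (rule representsD(1)[OF V'])
    show "0 \<le> V' t x" if "0 \<le> t" "x \<in> space M" for t x by (rule representsD(3)[OF V' that])
    fix t :: real assume t: "0 \<le> t"
    have "AE x in M. ennreal (V' t x) \<le> ennreal (K * dominating t x)"
    proof (rule represents_le[OF V' progressive_driver[OF domD(1)[OF V]] dom_fin[OF V] t])
      show "(\<lambda>x. ennreal (K * dominating t x)) \<in> borel_measurable (F t)"
        using progressive_adapted[OF progressive_dominating t] by simp
      fix A assume A: "A \<in> sets (F t)"
      have "tail_integral (driver V) t A \<le> ennreal (\<theta> * K powr (1 - a)) * tail_integral dominating t A"
        using t by (intro tail_integral_driver_le domD(3)[OF V] K sets_F_M[OF t A]) auto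
      then show "tail_integral (driver V) t A \<le> nnint A (\<lambda>x. K * dominating t x)"
        using super[OF t A] by (rule order.trans)
    qed
    then show "AE x in M. V' t x \<le> K * dominating t x"
      using AE_space by eventually_elim (use K dominating_nonneg[OF t] in \<open>simp add: ennreal_le_iff\<close>)
  qed
  have domW: "dom (W n)" and repW: "represents (W (Suc n)) (driver (W n))" for n
  proof -
    have rep: "represents (W (Suc n)) (driver (W n))" if "dom (W n)" for n
      unfolding W_Suc using someI_ex[OF dom_rep[OF that]] .
    show "dom (W n)" for n
    proof (induction n)
      case 0
      show ?case using W0 W0_le by (simp add: W_0 dom_def)
    next
      case (Suc n)
      show ?case by (rule dom_step[OF Suc rep[OF Suc]])
    qed
    from rep[OF this] show "represents (W (Suc n)) (driver (W n))" .
  qed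
  have incW: "AE x in M. W n t x \<le> W (Suc n) t x" if "0 \<le> t" for n t
    using that
  proof (induction n arbitrary: t)
    case 0
    have fin: "(\<integral>\<^sup>+x. ennreal (W0 t x) \<partial>M) < \<infinity>"
    proof -
      have "(\<integral>\<^sup>+x. ennreal (W0 t x) \<partial>M) = nnint (space M) (W0 t)" by (intro nn_integral_cong) auto
      also have "\<dots> \<le> tail_integral (driver W0) t (space M)"
        using sub[OF 0, of "space M"] space_F[OF 0] sets.top[of "F t"] by simp
      also have "\<dots> \<le> tail_integral (driver W0) 0 (space M)"
        unfolding tail_integral_def using 0 by (intro nn_integral_mono) (auto split: split_indicator)
      finally show ?thesis using dom_fin[OF domW[of 0]] unfolding W_0 by (rule order.strict_trans1)
    qed
    have "AE x in M. ennreal (W0 t x) \<le> ennreal (W (Suc 0) t x)"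
    proof (rule AE_le_of_nn_integral_le[OF subalg[OF 0] _ _ fin])
      show "nnint A (W0 t) \<le> nnint A (W (Suc 0) t)" if "A \<in> sets (F t)" for A
        using sub[OF 0 that] representsD(4)[OF repW 0 that, of 0] by (simp add: W_0)
    qed (use progressive_adapted[OF W0(1) 0] progressive_adapted[OF domD(1)[OF domW] 0] in auto)
    then show ?case unfolding W_0
      using AE_space by eventually_elim (use domD(2)[OF domW 0] in \<open>simp add: ennreal_le_iff\<close>)
  next
    case (Suc n)
    show ?case
    proof (rule represents_mono[OF repW repW progressive_driver[OF domD(1)[OF domW]] dom_fin[OF domW] Suc.prems])
      fix s assume "t \<le> s"
      then have s: "0 \<le> s" using Suc.prems by simp
      show "AE x in M. driver (W n) s x \<le> driver (W (Suc n)) s x"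
        using Suc.IH[OF s] AE_space by eventually_elim (use s domD(2)[OF domW s] in \<open>auto intro!: driver_mono\<close>)
    qed
  qed
  \<comment> \<open>The supremum is defined and measurable everywhere; that it is finite and the
    limit of the iterates holds only almost surely at each time.\<close>
  define L where "L t x = enn2real (SUP n. ennreal (W n t x))" for t x
  have AE_L: "AE x in M. incseq (\<lambda>n. W n t x) \<and> (\<lambda>n. W n t x) \<longlonglongrightarrow> L t x \<and> ennreal (L t x) = (SUP n. ennreal (W n t x))"
    if t: "0 \<le> t" for t
  proof -
    have "AE x in M. \<forall>n. W n t x \<le> W (Suc n) t x" unfolding AE_all_countable using incW[OF t] by blast
    moreover have "AE x in M. \<forall>n. 0 \<le> W n t x \<and> W n t x \<le> K * dominating t x"
      unfolding AE_all_countable using domD(3)[OF domW t] by blast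
    ultimately show ?thesis
    proof eventually_elim
      case (elim x)
      have inc: "incseq (\<lambda>n. W n t x)" using elim by (intro incseq_SucI) auto
      have "(SUP n. ennreal (W n t x)) \<le> ennreal (K * dominating t x)"
        using elim by (intro SUP_least ennreal_leI) auto
      then have "(SUP n. ennreal (W n t x)) < top" by (rule order.strict_trans1) simp
      then have L: "ennreal (L t x) = (SUP n. ennreal (W n t x))" by (simp add: L_def)
      have "(\<lambda>n. ennreal (W n t x)) \<longlonglongrightarrow> ennreal (L t x)"
        unfolding L using inc by (intro LIMSEQ_SUP) (auto simp: incseq_def intro!: ennreal_leI)
      then have "(\<lambda>n. W n t x) \<longlonglongrightarrow> L t x"
        using elim by (subst (asm) tendsto_ennreal_iff) (auto simp: L_def)
      then show ?case using inc L by blast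
    qed
  qed
  have L_prog: "progressive M F L"
    unfolding progressive_def L_def case_prod_beta
  proof (intro allI impI)
    fix t :: real assume t: "0 \<le> t"
    have "(\<lambda>p. W n (fst p) (snd p)) \<in> borel_measurable (restrict_space lborel {0..t} \<Otimes>\<^sub>M F t)" for n
      using domD(1)[OF domW[of n]] t unfolding progressive_def case_prod_beta by blast
    then have "(\<lambda>p. ennreal (W n (fst p) (snd p))) \<in> borel_measurable (restrict_space lborel {0..t} \<Otimes>\<^sub>M F t)" for n
      by (rule measurable_compose[OF _ measurable_ennreal])
    note this[measurable]
    show "(\<lambda>p. enn2real (SUP n. ennreal (W n (fst p) (snd p)))) \<in> borel_measurable (restrict_space lborel {0..t} \<Otimes>\<^sub>M F t)"
      by measurable
  qed
  have domL: "dom L"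
    unfolding dom_def
  proof (intro conjI allI impI ballI L_prog)
    show "0 \<le> L t x" for t x by (simp add: L_def)
    fix t :: real assume t: "0 \<le> t"
    have "AE x in M. \<forall>n. 0 \<le> W n t x \<and> W n t x \<le> K * dominating t x"
      unfolding AE_all_countable using domD(3)[OF domW t] by blast
    with AE_L[OF t] show "AE x in M. L t x \<le> K * dominating t x"
      by eventually_elim (auto intro: LIMSEQ_le_const2)
  qed
  \<comment> \<open>Nothing is known about the paths of \<open>L\<close>; \<open>V\<close> is to
    become its cadlag version.\<close>
  obtain V where V: "represents V (driver L)" using dom_rep[OF domL] by blast
  have VL: "AE x in M. V t x = L t x" if t: "0 \<le> t" for t
  proof -
    have eq: "nnint A (L t) = nnint A (V t)" if A: "A \<in> sets (F t)" for A
    proof -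
      note [measurable] = progressive_M[OF domD(1)[OF domW] t] sets_F_M[OF t A]
      \<comment> \<open>The index is shifted because it is \<open>W (Suc n)\<close> that represents
        \<open>driver (W n)\<close>; an increasing sequence keeps its supremum.\<close>
      have "nnint A (L t) = (\<integral>\<^sup>+x. (SUP n. ennreal (W (Suc n) t x) * indicator A x) \<partial>M)"
      proof (rule nn_integral_cong_AE, use AE_L[OF t] in eventually_elim)
        case (elim x)
        then have inc: "incseq (\<lambda>n. ennreal (W n t x))" by (auto simp: incseq_def intro!: ennreal_leI)
        have "(SUP n. ennreal (W (Suc n) t x)) = (SUP n. ennreal (W n t x))"
          using LIMSEQ_unique[OF LIMSEQ_SUP LIMSEQ_Suc[OF LIMSEQ_SUP[OF inc]]] inc
          by (simp add: incseq_Suc_iff)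
        then show ?case using elim by (cases "x \<in> A") auto
      qed
      also have "\<dots> = (SUP n. nnint A (W (Suc n) t))"
      proof (rule nn_integral_monotone_convergence_SUP_AE)
        show "AE x in M. ennreal (W (Suc n) t x) * indicator A x \<le> ennreal (W (Suc (Suc n)) t x) * indicator A x" for n
          using incW[OF t, of "Suc n"] by eventually_elim (auto split: split_indicator intro!: ennreal_leI)
      qed measurable
      also have "\<dots> = (SUP n. tail_integral (driver (W n)) t A)"
        using representsD(4)[OF repW t A] by simp
      also have "\<dots> = tail_integral (driver L) t A"
      proof (rule tail_integral_monotone_convergence[symmetric, OF progressive_driver[OF domD(1)[OF domW]] t sets_F_M[OF t A]])
        fix n s assume "t \<le> s"
        then have s: "0 \<le> s" using t by simp
        show "AE x in M. driver (W n) s x \<le> driver (W (Suc n)) s x"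
          using incW[OF s] AE_space by eventually_elim (use s domD(2)[OF domW s] in \<open>auto intro!: driver_mono\<close>)
      next
        fix s assume "t \<le> s"
        then have s: "0 \<le> s" using t by simp
        show "AE x in M. (\<lambda>n. driver (W n) s x) \<longlonglongrightarrow> driver L s x"
          using AE_L[OF s] AE_space
        proof eventually_elim
          case (elim x)
          have "(\<lambda>n. W n s x powr (1 - a)) \<longlonglongrightarrow> L s x powr (1 - a)"
            using elim a domD(2)[OF domW s] by (intro tendsto_powr' tendsto_const) auto
          then show ?case unfolding driver_def by (intro tendsto_mult tendsto_const)
        qed
      qed
      also have "\<dots> = nnint A (V t)" using representsD(4)[OF V t A] by simp
      finally show ?thesis .
    qed
    have Vm: "(\<lambda>x. ennreal (V t x)) \<in> borel_measurable (F t)" and Lm: "(\<lambda>x. ennreal (L t x)) \<in> borel_measurable (F t)"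
      using progressive_adapted[OF representsD(1)[OF V] t] progressive_adapted[OF L_prog t] by auto
    have "AE x in M. ennreal (V t x) \<le> ennreal (L t x)"
      using eq representsD(4)[OF V t]
      by (intro represents_le[OF V progressive_driver[OF L_prog] dom_fin[OF domL] t Lm]) auto
    moreover have "AE x in M. ennreal (L t x) \<le> ennreal (V t x)"
    proof (rule AE_le_of_nn_integral_le[OF subalg[OF t] Lm Vm])
      have "(\<integral>\<^sup>+x. ennreal (L t x) \<partial>M) = nnint (space M) (L t)" by (intro nn_integral_cong) auto
      also have "\<dots> = nnint (space M) (V t)"
        using eq[of "space M"] space_F[OF t] sets.top[of "F t"] by simp
      also have "\<dots> = (\<integral>\<^sup>+x. ennreal (V t x) \<partial>M)" by (intro nn_integral_cong) auto
      also have "\<dots> < \<infinity>" by (rule nn_integral_process_finite[OF V progressive_driver[OF L_prog] dom_fin[OF domL] t])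
      finally show "(\<integral>\<^sup>+x. ennreal (L t x) \<partial>M) < \<infinity>" .
    qed (use eq in auto)
    ultimately show ?thesis using AE_space
      by eventually_elim (use representsD(3)[OF V t] in \<open>auto simp: ennreal_le_iff L_def\<close>)
  qed
  \<comment> \<open>Equality at each fixed time suffices to exchange \<open>L\<close> for
    \<open>V\<close> inside the driver, which closes the fixed-point equation.\<close>
  have cong: "tail_integral (driver V) t A = tail_integral (driver L) t A" if t: "0 \<le> t" for t A
  proof (rule tail_integral_cong[OF t])
    fix s assume "t \<le> s"
    then have "0 \<le> s" using t by simp
    from VL[OF this] show "AE x in M. driver V s x = driver L s x"
      by eventually_elim (simp add: driver_def)
  qed
  have "represents V (driver V)" using V cong unfolding represents_def by simp
  moreover have "tail_integral (driver V) 0 (space M) < \<infinity>" using cong[of 0] dom_fin[OF domL] by simp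
  moreover have "AE x in M. W0 t x \<le> V t x" if t: "0 \<le> t" for t
    using AE_L[OF t] VL[OF t]
    by eventually_elim (metis W_0 incseq_le)
  ultimately show ?thesis by blast
qed

lemma exists_solution:
  "\<exists>W Z. represents W (driver W) \<and> tail_integral (driver W) 0 (space M) < \<infinity>
     \<and> represents Z truncated \<and> (\<forall>t\<ge>0. AE x in M. Z t x powr \<theta> \<le> W t x)"
proof -
  obtain Z where Z: "represents Z truncated" and Zb: "\<And>t x. 0 \<le> t \<Longrightarrow> x \<in> space M \<Longrightarrow> Z t x \<le> exp (- (a * t)) / a"
    using exists_truncated_representation by blast
  obtain c where c: "1 \<le> c" "\<And>t A. 0 \<le> t \<Longrightarrow> A \<in> sets (F t) \<Longrightarrow>
      tail_integral dominating t A \<le> ennreal c * nnint A (dominating t)"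
    using tail_integral_dominating_le by blast
  \<comment> \<open>The first entry gives \<open>K powr a \<ge> \<theta> * c\<close>, which is the
    supersolution inequality; the second puts the bound on \<open>Z t x powr \<theta>\<close> below
    \<open>K * dominating t x\<close>.\<close>
  define K where "K = max ((\<theta> * c) powr \<theta>) (\<theta> powr \<theta>)"
  have K: "0 < K" using theta_pos by (simp add: K_def less_max_iff_disj)
  have Kc: "\<theta> * K powr (1 - a) * c \<le> K"
  proof -
    have "\<theta> * c = ((\<theta> * c) powr \<theta>) powr a" using theta_pos c a \<theta> by (simp add: powr_powr)
    also have "\<dots> \<le> K powr a" unfolding K_def using a by (intro powr_mono2) auto
    finally have "K powr (1 - a) * (\<theta> * c) \<le> K powr (1 - a) * K powr a" by (intro mult_left_mono) auto
    also have "\<dots> = K" using K by (simp flip: powr_add)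
    finally show ?thesis by (simp add: mult_ac)
  qed
  have "\<exists>W. represents W (driver W) \<and> tail_integral (driver W) 0 (space M) < \<infinity>
     \<and> (\<forall>t\<ge>0. AE x in M. Z t x powr \<theta> \<le> W t x)"
  proof (rule exists_fixed_point_above)
    show "progressive M F (\<lambda>t x. Z t x powr \<theta>)" by (intro progressive_powr representsD(1)[OF Z])
    show "0 \<le> K" using K by simp
  next
    fix t :: real assume t: "0 \<le> t"
    show "AE x in M. Z t x powr \<theta> \<le> K * dominating t x"
    proof (intro AE_I2)
      fix x assume x: "x \<in> space M"
      have "Z t x powr \<theta> \<le> (\<theta> * exp (- (a * t))) powr \<theta>"
        using Zb[OF t x] representsD(3)[OF Z t x] theta_pos \<theta> by (intro powr_mono2) auto
      also have "\<dots> = \<theta> powr \<theta> * exp (- t)"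
      proof -
        \<comment> \<open>Here \<open>a * \<theta> = 1\<close> converts the decay rate
          \<open>a\<close> of \<open>Z\<close> into rate 1.\<close>
        have "exp (- (a * t)) powr \<theta> = exp (- t)" using \<theta> a by (simp add: powr_def)
        then show ?thesis using theta_pos by (simp add: powr_mult)
      qed
      also have "\<dots> \<le> K * dominating t x"
      proof (intro mult_mono)
        show "\<theta> powr \<theta> \<le> K" by (simp add: K_def)
      qed (use dominating_ge(1)[OF t x] K in auto)
      finally show "Z t x powr \<theta> \<le> K * dominating t x" .
    qed
    fix A assume A: "A \<in> sets (F t)"
    have "nnint A (\<lambda>x. Z t x powr \<theta>) \<le> tail_integral (\<lambda>s x. \<theta> * truncated s x * Z s x powr (\<theta> - 1)) t A"
      by (rule subsolution[OF truncated(1,2,3,5) a \<theta> Z Zb t A]) auto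
    also have "\<dots> \<le> tail_integral (driver (\<lambda>t x. Z t x powr \<theta>)) t A"
    proof (rule tail_integral_mono[OF t], intro AE_I2)
      fix s x assume "t \<le> s" and x: "x \<in> space M"
      \<comment> \<open>Applied to the power \<open>Z powr \<theta>\<close>, the exponent of the
        driver becomes that of the tangent slope.\<close>
      have "\<theta> * (1 - a) = \<theta> - 1" using \<theta> a by (simp add: field_simps)
      then have "(Z s x powr \<theta>) powr (1 - a) = Z s x powr (\<theta> - 1)" by (simp add: powr_powr)
      then show "\<theta> * truncated s x * Z s x powr (\<theta> - 1) \<le> driver (\<lambda>t x. Z t x powr \<theta>) s x"
        unfolding driver_def using truncated(4)[of s x] theta_pos by (auto intro!: mult_right_mono)
    qed
    finally show "nnint A (\<lambda>x. Z t x powr \<theta>) \<le> tail_integral (driver (\<lambda>t x. Z t x powr \<theta>)) t A" .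
    have "ennreal (\<theta> * K powr (1 - a)) * tail_integral dominating t A
       \<le> ennreal (\<theta> * K powr (1 - a)) * (ennreal c * nnint A (dominating t))"
      by (intro mult_left_mono c(2) t A) auto
    also have "\<dots> = ennreal (\<theta> * K powr (1 - a) * c) * nnint A (dominating t)"
      using c(1) theta_pos by (simp add: ennreal_mult mult.assoc)
    also have "\<dots> \<le> ennreal K * nnint A (dominating t)"
      by (intro mult_right_mono ennreal_leI Kc) auto
    also have "\<dots> = nnint A (\<lambda>x. K * dominating t x)"
      using K by (intro nn_integral_cmult_process[symmetric] progressive_M[OF progressive_dominating t] sets_F_M[OF t A]) auto
    finally show "ennreal (\<theta> * K powr (1 - a)) * tail_integral dominating t A \<le> nnint A (\<lambda>x. K * dominating t x)" .
  qed auto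
  then show ?thesis using Z by blast
qed

lemmas exists_solution_unfolded = exists_solution[unfolded driver_def[abs_def] truncated_def[abs_def]]

end
end

section \<open>Existence of a proper solution\<close>

text \<open>A finite bound excludes the value \<open>\<top>\<close>, so \<open>c = 0\<close> can
  occur only with a nonnegative exponent.\<close>

lemma ext_pow_le_ennrealD:
  assumes "ext_pow c a \<le> ennreal y"
  shows "ext_pow c a = ennreal (c powr a)" "c = 0 \<Longrightarrow> 0 \<le> a"
  using assms by (auto simp: ext_pow_def top_unique split: if_splits)

theorem theorem4p3:
  fixes M :: "'a measure" and F :: "real \<Rightarrow> 'a measure"
    and R S :: real and C Y :: "real \<Rightarrow> 'a \<Rightarrow> real"
  assumes "filtered_prob_space M F"
    and "R > 0" "R \<noteq> 1" "S > 0" "S \<noteq> 1" "(1 - R) / (1 - S) > 1"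
    and "progressive_pos M F C"
    and "right_cont_paths M C"
    and "Y \<in> SO_plus M F"
    and "\<forall>t\<ge>0. \<forall>\<omega>\<in>space M. ext_pow (C t \<omega>) (1 - R) \<le> ennreal (Y t \<omega>)"
  shows "\<exists>V. EZ_solution M F R S C V \<and> EZ_proper M F R C V"
proof -
  interpret filtered_prob M F
    using assms(1) conjunct1[OF assms(1)[unfolded filtered_prob_space_def]]
    by (intro filtered_prob.intro filtered_prob_axioms.intro)
  define a where "a = (1 - S) / (1 - R)"
  define \<theta> where "\<theta> = (1 - R) / (1 - S)"
  have \<theta>: "\<theta> = 1 / a" by (simp add: \<theta>_def a_def)
  have "1 < \<theta>" using assms(6) by (simp add: \<theta>_def)
  then have a: "0 < a" "a < 1"
    unfolding \<theta> by (auto simp: less_divide_eq_1 split: if_splits)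
  have aR: "(1 - R) * a = 1 - S" using assms(3) by (simp add: a_def)
  have YSO: "Y \<in> SO M F" using assms(9) by (auto simp: SO_plus_def SO_nu_def)
  have C: "progressive M F C" and C_nn: "\<And>t \<omega>. 0 \<le> t \<Longrightarrow> \<omega> \<in> space M \<Longrightarrow> 0 \<le> C t \<omega>"
    using assms(7) by (auto simp: progressive_pos_def)
  have pow: "ext_pow (C t \<omega>) (1 - R) = ennreal (C t \<omega> powr (1 - R))" "C t \<omega> = 0 \<Longrightarrow> R < 1"
    "C t \<omega> powr (1 - R) \<le> Y t \<omega>" if "0 \<le> t" "\<omega> \<in> space M" for t \<omega>
  proof -
    have le: "ext_pow (C t \<omega>) (1 - R) \<le> ennreal (Y t \<omega>)" using assms(10) that by blast
    note * = ext_pow_le_ennrealD[OF le]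
    show "ext_pow (C t \<omega>) (1 - R) = ennreal (C t \<omega> powr (1 - R))" by (rule *(1))
    show "R < 1" if "C t \<omega> = 0" using *(2)[OF that] assms(3) by simp
    show "C t \<omega> powr (1 - R) \<le> Y t \<omega>"
      using le SO_D(2)[OF YSO that] unfolding *(1) by (simp add: ennreal_le_iff)
  qed
  define u where "u t \<omega> = C t \<omega> powr (1 - S)" for t \<omega>
  have u: "progressive M F u" unfolding u_def by (intro progressive_powr C)
  have u_nn: "0 \<le> u t \<omega>" for t \<omega> by (simp add: u_def)
  have u_rc: "AE \<omega> in M. \<forall>t\<ge>0. continuous (at_right t) (\<lambda>s. u s \<omega>)"
    using assms(8)[unfolded right_cont_paths_def] AE_space
  proof (eventually_elim, intro allI impI)
    fix \<omega> and t :: real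
    assume *: "\<forall>t\<ge>0. continuous (at_right t) (\<lambda>s. C s \<omega>)" and \<omega>: "\<omega> \<in> space M" and t: "0 \<le> t"
    have "\<forall>\<^sub>F s in at_right t. 0 \<le> C s \<omega>"
      unfolding eventually_at_right_field using C_nn[OF _ \<omega>] t by (intro exI[of _ "t + 1"]) auto
    \<comment> \<open>\<open>C\<close> can vanish only if \<open>R < 1\<close>, and then
      \<open>1 - S = (1 - R) * a\<close> is positive, so the power is continuous at 0 as
      well.\<close>
    moreover have "0 < 1 - S" if "C t \<omega> = 0"
    proof -
      have "0 < (1 - R) * a" using pow(2)[OF t \<omega> that] a by simp
      then show ?thesis unfolding aR .
    qed
    ultimately show "continuous (at_right t) (\<lambda>s. u s \<omega>)"
      unfolding u_def continuous_within
      using * t by (intro tendsto_powr' tendsto_const) (auto simp: continuous_within)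
  qed
  have u_le: "u t \<omega> \<le> Y t \<omega> powr a" if "0 \<le> t" "\<omega> \<in> space M" for t \<omega>
  proof -
    have "u t \<omega> = (C t \<omega> powr (1 - R)) powr a" unfolding u_def powr_powr aR ..
    also have "\<dots> \<le> Y t \<omega> powr a" using pow(3)[OF that] a by (intro powr_mono2) auto
    finally show ?thesis .
  qed
  obtain W Z where W: "represents W (\<lambda>s \<omega>. \<theta> * u s \<omega> * W s \<omega> powr (1 - a))"
    and fin: "tail_integral (\<lambda>s \<omega>. \<theta> * u s \<omega> * W s \<omega> powr (1 - a)) 0 (space M) < \<infinity>"
    and Z: "represents Z (\<lambda>s \<omega>. min (u s \<omega>) (exp (- (a * s))))"
    and ZW: "\<And>t. 0 \<le> t \<Longrightarrow> AE \<omega> in M. Z t \<omega> powr \<theta> \<le> W t \<omega>"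
    using exists_solution_unfolded[OF u u_nn u_rc a \<theta> YSO u_le] by auto
  define G where "G s \<omega> = \<theta> * u s \<omega> * W s \<omega> powr (1 - a)" for s \<omega>
  have G: "progressive M F G"
    unfolding G_def by (intro progressive_mult progressive_const progressive_powr u representsD(1)[OF W])
  have G_nn: "0 \<le> G s \<omega>" for s \<omega> using \<open>1 < \<theta>\<close> u_nn by (simp add: G_def)
  have Gpos: "progressive_pos M F G" using G G_nn by (simp add: progressive_pos_def)
  have WG: "represents W G" using W by (simp add: G_def[abs_def])
  have finG: "tail_integral G 0 (space M) < \<infinity>" using fin by (simp add: G_def[abs_def])
  define V where "V t \<omega> = W t \<omega> / (1 - R)" for t \<omega>
  have VW: "(1 - R) * V t \<omega> = W t \<omega>" for t \<omega> using assms(3) by (simp add: V_def)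
  \<comment> \<open>In terms of \<open>W\<close> the aggregator is the driver divided by
    \<open>1 - R\<close>, because the exponent \<rho> equals \<open>1 - a\<close> and
    \<open>\<theta> / (1 - R) = 1 / (1 - S)\<close>.\<close>
  have f: "f_EZ R S (C s \<omega>) (V s \<omega>) = G s \<omega> / (1 - R)" for s \<omega>
  proof -
    have e: "(S - R) / (1 - R) = 1 - a" using assms(3) by (simp add: a_def field_simps)
    have "\<theta> / (1 - R) = 1 / (1 - S)" using assms(3) by (simp add: \<theta>_def)
    then have "G s \<omega> / (1 - R) = 1 / (1 - S) * (u s \<omega> * W s \<omega> powr (1 - a))"
      unfolding G_def by (metis mult.assoc times_divide_eq_left)
    then show ?thesis unfolding f_EZ_def VW e u_def by simp
  qed
  have "EZ_solution M F R S C V"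
    unfolding EZ_solution_def
  proof (intro conjI allI impI ballI)
    show "progressive M F V"
      using progressive_mult[OF representsD(1)[OF W] progressive_const[of M F "1 / (1 - R)"]] by (simp add: V_def[abs_def])
    show "cadlag_paths M V"
      unfolding cadlag_paths_def using representsD(2)[OF W, unfolded cadlag_paths_def]
    proof (eventually_elim, intro allI impI conjI)
      fix \<omega> and t :: real
      assume *: "\<forall>t\<ge>0. continuous (at_right t) (\<lambda>s. W s \<omega>) \<and> (0 < t \<longrightarrow> (\<exists>l. ((\<lambda>s. W s \<omega>) \<longlongrightarrow> l) (at_left t)))"
        and t: "0 \<le> t"
      show "continuous (at_right t) (\<lambda>s. V s \<omega>)"
        unfolding V_def using * t assms(3) by (intro continuous_intros) auto
      assume "0 < t"
      then obtain l where "((\<lambda>s. W s \<omega>) \<longlongrightarrow> l) (at_left t)" using * t by blast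
      then show "\<exists>l. ((\<lambda>s. V s \<omega>) \<longlongrightarrow> l) (at_left t)"
        unfolding V_def using assms(3) by (intro exI[of _ "l / (1 - R)"] tendsto_intros) auto
    qed
    show "0 \<le> (1 - R) * V t \<omega>" if "0 \<le> t" "\<omega> \<in> space M" for t \<omega>
      unfolding VW by (rule representsD(3)[OF W that])
    show "(\<integral>\<^sup>+\<omega>. (\<integral>\<^sup>+s\<in>{0..}. ennreal \<bar>f_EZ R S (C s \<omega>) (V s \<omega>)\<bar> \<partial>lborel) \<partial>M) < \<infinity>"
    proof -
      \<comment> \<open>The sign of \<open>1 - R\<close> is not fixed, hence the absolute value in
        the factor.\<close>
      let ?G = "\<lambda>s \<omega>. 1 / \<bar>1 - R\<bar> * G s \<omega>"
      have "\<bar>f_EZ R S (C s \<omega>) (V s \<omega>)\<bar> = ?G s \<omega>" for s \<omega>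
        unfolding f using G_nn[of s \<omega>] by (simp add: abs_divide)
      then have "(\<integral>\<^sup>+\<omega>. (\<integral>\<^sup>+s\<in>{0..}. ennreal \<bar>f_EZ R S (C s \<omega>) (V s \<omega>)\<bar> \<partial>lborel) \<partial>M)
        = (\<integral>\<^sup>+\<omega>\<in>space M. tail ?G 0 \<omega> \<partial>M)"
        by (simp only:) (intro nn_integral_cong, simp)
      also have "\<dots> = tail_integral ?G 0 (space M)"
        by (intro tail_integral_Fubini progressive_mult progressive_const G) auto
      also have "\<dots> = ennreal (1 / \<bar>1 - R\<bar>) * tail_integral G 0 (space M)"
        by (intro tail_integral_cmult G) auto
      also have "\<dots> < \<infinity>" using finG by (simp add: ennreal_mult_less_top)
      finally show ?thesis .
    qed
    fix t :: real assume t: "0 \<le> t"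
    interpret sub: sigma_finite_subalgebra M "F t" by (rule F_subalgebra[OF t])
    let ?H = "\<lambda>\<omega>. set_lebesgue_integral lborel {t..} (\<lambda>s. G s \<omega>)"
    have f_H: "(\<lambda>\<omega>. set_lebesgue_integral lborel {t..} (\<lambda>s. f_EZ R S (C s \<omega>) (V s \<omega>))) = (\<lambda>\<omega>. ?H \<omega> / (1 - R))"
      unfolding f by (simp add: set_lebesgue_integral_def fun_eq_iff)
    have cdiv: "AE \<omega> in M. real_cond_exp M (F t) (\<lambda>\<omega>. ?H \<omega> / (1 - R)) \<omega> = real_cond_exp M (F t) ?H \<omega> / (1 - R)"
      by (rule sub.real_cond_exp_cdiv[OF real_cond_exp_tail(1)[OF Gpos finG t]])
    have W_H: "AE \<omega> in M. W t \<omega> = real_cond_exp M (F t) ?H \<omega>"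
      by (rule represents_real_cond_exp[OF WG Gpos finG t])
    show "AE \<omega> in M. V t \<omega> = real_cond_exp M (F t)
        (\<lambda>\<omega>'. set_lebesgue_integral lborel {t..} (\<lambda>s. f_EZ R S (C s \<omega>') (V s \<omega>'))) \<omega>"
      unfolding f_H using cdiv W_H by eventually_elim (simp add: V_def)
  qed
  moreover have "EZ_proper M F R C V"
    unfolding EZ_proper_def VW
  proof (intro allI impI)
    fix t :: real assume t: "0 \<le> t"
    interpret sub: sigma_finite_subalgebra M "F t" by (rule F_subalgebra[OF t])
    let ?w = "\<lambda>s \<omega>. min (u s \<omega>) (exp (- (a * s)))"
    let ?E = "\<lambda>\<omega>. \<integral>\<^sup>+s\<in>{t..}. ext_pow (C s \<omega>) (1 - R) \<partial>lborel"
    have w: "progressive M F ?w"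
      by (intro progressive_min u progressive_deterministic borel_measurable_continuous_onI continuous_intros)
    have E: "?E \<in> borel_measurable M"
    proof (rule measurable_cong[THEN iffD1])
      show "(\<lambda>\<omega>. tail (\<lambda>s \<omega>. C s \<omega> powr (1 - R)) t \<omega>) \<in> borel_measurable M"
        by (intro tail_measurable progressive_powr C t)
      show "tail (\<lambda>s \<omega>. C s \<omega> powr (1 - R)) t \<omega> = ?E \<omega>" if "\<omega> \<in> space M" for \<omega>
        using pow(1)[OF _ that] t by (intro nn_integral_cong) (auto split: split_indicator)
    qed
    \<comment> \<open>On \<open>B\<close> the lower bound \<open>Z t \<omega> powr \<theta>\<close>
      for \<open>W\<close> gives nothing. But \<open>Z\<close> represents the tail of
      \<open>?w\<close>, so this tail vanishes almost surely on \<open>B\<close>; then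
      \<open>C\<close> is zero at almost all times from \<open>t\<close> on, and the conditional
      expectation in \<open>EZ_proper\<close> vanishes there too.\<close>
    define B where "B = {\<omega>\<in>space M. Z t \<omega> \<le> 0}"
    have "B = {\<omega>\<in>space (F t). Z t \<omega> \<le> 0}" using space_F[OF t] by (simp add: B_def)
    then have B: "B \<in> sets (F t)" using progressive_adapted[OF representsD(1)[OF Z] t] by simp
    note BM = sets_F_M[OF t B]
    have "(\<integral>\<^sup>+\<omega>\<in>B. tail ?w t \<omega> \<partial>M) = nnint B (Z t)"
      using representsD(4)[OF Z t B] tail_integral_Fubini[OF w t BM] by simp
    also have "\<dots> = (\<integral>\<^sup>+\<omega>. 0 \<partial>M)"
      by (intro nn_integral_cong) (auto simp: B_def ennreal_neg split: split_indicator)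
    also have "\<dots> = 0" by simp
    finally have "AE \<omega> in M. tail ?w t \<omega> * indicator B \<omega> = 0"
      using tail_measurable[OF w t] BM by (subst (asm) nn_integral_0_iff_AE) auto
    then have EB: "AE \<omega> in M. ?E \<omega> * indicator B \<omega> = 0"
      using AE_space
    proof eventually_elim
      case (elim \<omega>)
      show ?case
      proof (cases "\<omega> \<in> B")
        case True
        then have "tail ?w t \<omega> = 0" using elim(1) by simp
        then have "AE s in lborel. ennreal (?w s \<omega>) * indicator {t..} s = 0"
          using measurable_Pair1[OF progressive_joint_ennreal[OF w t] elim(2)]
          by (subst (asm) nn_integral_0_iff_AE) auto
        then have "AE s in lborel. ext_pow (C s \<omega>) (1 - R) * indicator {t..} s = 0"
        proof eventually_elim
          case (elim s)
          show ?case
          proof (cases "t \<le> s")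
            case True
            then have "?w s \<omega> \<le> 0" using elim by (simp add: ennreal_eq_0_iff)
            \<comment> \<open>The exponential is positive, so the truncation creates no zeros: it is
              \<open>u\<close> that vanishes.\<close>
            then have "u s \<omega> \<le> 0" using exp_gt_zero[of "- (a * s)"] by (auto simp: min_le_iff_disj simp del: exp_gt_zero)
            then have "C s \<omega> = 0" using u_nn[of s \<omega>] by (simp add: u_def)
            \<comment> \<open>By \<open>pow\<close>, the value of \<open>ext_pow\<close> at 0 is
              \<open>0 powr (1 - R)\<close>, that is 0, and not \<open>\<top>\<close>.\<close>
            then show ?thesis using pow(1)[of s \<omega>] True t \<open>\<omega> \<in> space M\<close> by simp
          qed simp
        qed
        then have "?E \<omega> = (\<integral>\<^sup>+s. 0 \<partial>(lborel :: real measure))" by (rule nn_integral_cong_AE)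
        then show ?thesis by simp
      qed simp
    qed
    \<comment> \<open>As \<open>B\<close> is an event of \<open>F t\<close>, its indicator passes
      through the conditional expectation.\<close>
    have "(\<integral>\<^sup>+\<omega>. indicator B \<omega> * nn_cond_exp M (F t) ?E \<omega> \<partial>M) = (\<integral>\<^sup>+\<omega>. indicator B \<omega> * ?E \<omega> \<partial>M)"
      using B by (intro sub.nn_cond_exp_intg E) auto
    also have "\<dots> = (\<integral>\<^sup>+\<omega>. 0 \<partial>M)"
      by (rule nn_integral_cong_AE, use EB in eventually_elim) (simp add: mult.commute)
    also have "\<dots> = 0" by simp
    finally have "AE \<omega> in M. indicator B \<omega> * nn_cond_exp M (F t) ?E \<omega> = 0"
      using BM by (subst (asm) nn_integral_0_iff_AE) auto
    then show "AE \<omega> in M. 0 < nn_cond_exp M (F t) ?E \<omega> \<longrightarrow> 0 < W t \<omega>"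
      using ZW[OF t] AE_space
    proof eventually_elim
      case (elim \<omega>)
      show ?case
      proof
        assume "0 < nn_cond_exp M (F t) ?E \<omega>"
        then have "\<omega> \<notin> B" using elim(1) by (auto simp: indicator_def)
        then have "0 < Z t \<omega>" using elim(3) by (simp add: B_def)
        then have "0 < Z t \<omega> powr \<theta>" by simp
        then show "0 < W t \<omega>" using elim(2) by (rule order.strict_trans2)
      qed
    qed
  qed
  ultimately show ?thesis by blast
qed

end
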